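(* Let $\mathcal{C}$ be a 2-category having (small, conical) oplax bicolimits, let $I$ be a small 2-category, let $\Sigma$ be a class of 1-cells of $I$ containing identities and stable under composition, and let $F:I\to\mathcal{C}$ be a 2-functor. Let $\mathscr{X}_{F,\Sigma}$ be the codescent object in $\mathcal{C}$ associated to $(F,\Sigma)$ (constructed in the context). Whenever the bicoequalizer of $\mathscr{X}_{F,\Sigma}$ exists, it is a $\sigma$-bicolimit of $F$ relative to $\Sigma$: $$\mathrm{bicoeq}(\mathscr{X}_{F,\Sigma})\simeq \Sigma\text{-}\mathrm{bicolim}_I\,F .$$
   Context: 2-categories and 2-functors are strict; $\mathcal{K}[X,Y]$ denotes a hom-category; juxtaposition of 1-cells and 2-cells denotes whiskering. **Oplax cocones, $\sigma$-cocones.** For a 2-functor $F:I\to\mathcal{C}$, an oplax cocone with tip $B$ consists of 1-cells $q_i:F(i)\to B$ and, for each $d:i\to j$ in $I$, a 2-cell $q_d:q_jF(d)\Rightarrow q_i$, compatible with identities and composition and such that $q_{d'}\circ(q_jF(\sigma))=q_d$ for each 2-cell $\sigma:d\Rightarrow d'$. Morphisms of oplax cocones are modifications: families of 2-cells $q_i\Rightarrow q_i'$ compatible with the $q_d,q'_d$. For a class $\Sigma$ of 1-cells of $I$, a $\sigma$-cocone (relative to $\Sigma$) is an oplax cocone with $q_d$ invertible for all $d\in\Sigma$. The oplax bicolimit (resp. $\sigma$-bicolimit relative to $\Sigma$) of $F$ is an oplax cocone (resp. $\sigma$-cocone) with tip $L$ such that composition with it gives equivalences, natural in $B$, between $\mathcal{C}[L,B]$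 and the category of oplax cocones (resp. $\sigma$-cocones) with tip $B$. **Codescent objects.** A codescent object $\mathscr{X}$ in $\mathcal{K}$ consists of objects $\mathscr{X}(0),\mathscr{X}(1),\mathscr{X}(2)$, 1-cells $p_0,p_1,p_2:\mathscr{X}(2)\to\mathscr{X}(1)$, $d_0,d_1:\mathscr{X}(1)\to\mathscr{X}(0)$, $i:\mathscr{X}(0)\to\mathscr{X}(1)$, and invertible 2-cells $n_0:d_0i\Rightarrow 1$, $n_1:d_1i\Rightarrow 1$, $\theta_{01}:d_0p_0\Rightarrow d_0p_1$, $\theta_{02}:d_1p_0\Rightarrow d_0p_2$, $\theta_{12}:d_1p_1\Rightarrow d_1p_2$. A pair $(q:\mathscr{X}(0)\to C,\ \xi:qd_0\Rightarrow qd_1)$ with $\xi$ invertible pseudocoequalizes $\mathscr{X}$ if $(qn_1)\circ(\xi i)=qn_0$ and $(q\theta_{12})\circ(\xi p_1)\circ(q\theta_{01})=(\xi p_2)\circ(q\theta_{02})\circ(\xi p_0)$. Morphisms $(q,\xi)\to(q',\xi')$ are 2-cells $q\Rightarrow q'$ compatible with $\xi,\xi'$. A bicoequalizer of $\mathscr{X}$ is a pseudocoequalizing pair with tip $\mathrm{bicoeq}(\mathscr{X})$ such that composition with it gives equivalences, natural in $C$, from $\mathcal{K}[\mathrm{bicoeq}(\mathscr{X}),C]$ to the category of pseudocoequalizing pairs with tip $C$. **Indexing 2-categories.** $\Sigma^2$ has as objects the 1-cells $d$ of $I$ lying in $\Sigma$; 1-cells $d\to d'$ are pseudosquares: $\phi_0:\mathrm{dom}\,d\to\mathrm{dom}\,d'$,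 $\phi_1:\mathrm{cod}\,d\to\mathrm{cod}\,d'$ arbitrary 1-cells of $I$ (not required to be in $\Sigma$), with an invertible 2-cell $\phi:d'\phi_0\Rightarrow\phi_1d$; 2-cells are pairs $\lambda_0:\phi_0\Rightarrow\psi_0$, $\lambda_1:\phi_1\Rightarrow\psi_1$ compatible with $\phi,\psi$. $\Sigma^3$ has as objects the invertible 2-cells $\phi:(p_2\phi)(p_0\phi)\Rightarrow p_1\phi$ of $I$ (triangles) whose three edges $p_0\phi,p_1\phi,p_2\phi$ lie in $\Sigma$; 1-cells and 2-cells are pseudonatural transformations and modifications between such triangles. There are evident 2-functors $\mathrm{dom},\mathrm{cod}:\Sigma^2\to I$ and $p_0,p_1,p_2:\Sigma^3\to\Sigma^2$. **The codescent object $\mathscr{X}_{F,\Sigma}$.** Let $(q_i,q_d)$ be the oplax bicolimit cocone of $F$ with tip $L$; $(r_d:F\mathrm{dom}(d)\to L_2)_{d\in\Sigma^2}$ that of $F\mathrm{dom}:\Sigma^2\to\mathcal{C}$; and $L_3$ the oplax bicolimit of $F\,\mathrm{dom}\,p_0:\Sigma^3\to\mathcal{C}$. Set $\mathscr{X}(0)=L$, $\mathscr{X}(1)=L_2$, $\mathscr{X}(2)=L_3$, and let the 1-cells be those induced by the following oplax cocones: - $d_0:L_2\to L$ by $(q_{\mathrm{dom}(d)})_{d\in\Sigma^2}$ with transition $q_{\phi_0}$ at $\phi:d\to d'$; write $\theta_d:d_0r_d\cong q_{\mathrm{dom}(d)}$ for the universal 2-cell; - $d_1:L_2\to L$ by $(q_{\mathrm{cod}(d)}F(d))_{d\in\Sigma^2}$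 with transition at $\phi:d\to d'$ the composite $q_{\mathrm{cod}\,d'}F(d')F(\phi_0)\cong q_{\mathrm{cod}\,d'}F(\phi_1)F(d)\Rightarrow q_{\mathrm{cod}\,d}F(d)$ of $F(\phi)$ and $q_{\phi_1}$; write $\theta'_d:d_1r_d\cong q_{\mathrm{cod}(d)}F(d)$; - $i:L\to L_2$ by $(r_{\mathrm{id}_i})_{i\in I}$, with transition at $d:i\to j$ given by $r$ at the identity square $(d,d):\mathrm{id}_i\to\mathrm{id}_j$; - $p_0,p_1:L_3\to L_2$ by $(r_{p_0\phi})_{\phi\in\Sigma^3}$ and $(r_{p_1\phi})_{\phi\in\Sigma^3}$ (note $\mathrm{dom}\,p_0=\mathrm{dom}\,p_1$); - $p_2:L_3\to L_2$ by $(r_{p_2\phi}F(p_0\phi))_{\phi\in\Sigma^3}$ (note $\mathrm{cod}\,p_0=\mathrm{dom}\,p_2$), with the evident transition 2-cells. The invertible 2-cells are those induced, through the universal property of the oplax bicolimits, by the following families: $n_0$, $n_1$ by $\theta_{\mathrm{id}_i}$, $\theta'_{\mathrm{id}_i}$; $\theta_{01}$ at $\phi$ by $d_0r_{p_0\phi}\cong q_{\mathrm{dom}\,p_0\phi}=q_{\mathrm{dom}\,p_1\phi}\cong d_0r_{p_1\phi}$; $\theta_{02}$ at $\phi$ by $d_1r_{p_0\phi}\cong q_{\mathrm{cod}\,p_0\phi}F(p_0\phi)=q_{\mathrm{dom}\,p_2\phi}F(p_0\phi)\cong d_0r_{p_2\phi}F(p_0\phi)$; $\theta_{12}$ at $\phi$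 by $d_1r_{p_1\phi}\cong q_{\mathrm{cod}\,p_1\phi}F(p_1\phi)\cong q_{\mathrm{cod}\,p_2\phi}F(p_2\phi)F(p_0\phi)\cong d_1r_{p_2\phi}F(p_0\phi)$, the middle isomorphism being given by $F(\phi)^{-1}$. *)

theory Defs
  imports "HOL-Library.Equipollence" "HOL-Library.FuncSet"
begin

section \<open>Categories and equivalences of categories\<close>

text \<open>Arrows do not carry their endpoints, so the arrow part of a functor takes
  the endpoints as additional arguments.\<close>

record ('x, 'm) cat =
  cobj :: "'x set"
  chom :: "'x \<Rightarrow> 'x \<Rightarrow> 'm set"
  cid :: "'x \<Rightarrow> 'm"
  ccomp :: "'m \<Rightarrow> 'm \<Rightarrow> 'm"

definition is_iso :: "('x, 'm) cat \<Rightarrow> 'x \<Rightarrow> 'x \<Rightarrow> 'm \<Rightarrow> bool" where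
  "is_iso A x y f \<longleftrightarrow> f \<in> chom A x y \<and>
     (\<exists>g\<in>chom A y x. ccomp A g f = cid A x \<and> ccomp A f g = cid A y)"

definition is_functor ::
  "('x, 'm) cat \<Rightarrow> ('y, 'n) cat \<Rightarrow> ('x \<Rightarrow> 'y) \<Rightarrow> ('x \<Rightarrow> 'x \<Rightarrow> 'm \<Rightarrow> 'n) \<Rightarrow> bool" where
  "is_functor A B Fo Fa \<longleftrightarrow>
     (\<forall>x\<in>cobj A. Fo x \<in> cobj B) \<and>
     (\<forall>x\<in>cobj A. \<forall>y\<in>cobj A. \<forall>f\<in>chom A x y. Fa x y f \<in> chom B (Fo x) (Fo y)) \<and>
     (\<forall>x\<in>cobj A. Fa x x (cid A x) = cid B (Fo x)) \<and>
     (\<forall>x\<in>cobj A. \<forall>y\<in>cobj A. \<forall>z\<in>cobj A. \<forall>f\<in>chom A x y. \<forall>g\<in>chom A y z.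
        Fa x z (ccomp A g f) = ccomp B (Fa y z g) (Fa x y f))"

definition is_natural_iso ::
  "('x, 'm) cat \<Rightarrow> ('y, 'n) cat \<Rightarrow> ('x \<Rightarrow> 'y) \<Rightarrow> ('x \<Rightarrow> 'x \<Rightarrow> 'm \<Rightarrow> 'n)
    \<Rightarrow> ('x \<Rightarrow> 'y) \<Rightarrow> ('x \<Rightarrow> 'x \<Rightarrow> 'm \<Rightarrow> 'n) \<Rightarrow> ('x \<Rightarrow> 'n) \<Rightarrow> bool" where
  "is_natural_iso A B Fo Fa Go Ga \<eta> \<longleftrightarrow>
     (\<forall>x\<in>cobj A. is_iso B (Fo x) (Go x) (\<eta> x)) \<and>
     (\<forall>x\<in>cobj A. \<forall>y\<in>cobj A. \<forall>f\<in>chom A x y.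
        ccomp B (Ga x y f) (\<eta> x) = ccomp B (\<eta> y) (Fa x y f))"

definition is_equivalence ::
  "('x, 'm) cat \<Rightarrow> ('y, 'n) cat \<Rightarrow> ('x \<Rightarrow> 'y) \<Rightarrow> ('x \<Rightarrow> 'x \<Rightarrow> 'm \<Rightarrow> 'n) \<Rightarrow> bool" where
  "is_equivalence A B Fo Fa \<longleftrightarrow> is_functor A B Fo Fa \<and>
     (\<exists>Go Ga. is_functor B A Go Ga \<and>
        (\<exists>\<eta>. is_natural_iso A A (\<lambda>x. x) (\<lambda>x y f. f)
               (\<lambda>x. Go (Fo x)) (\<lambda>x y f. Ga (Fo x) (Fo y) (Fa x y f)) \<eta>) \<and>
        (\<exists>\<epsilon>. is_natural_iso B B (\<lambda>x. Fo (Go x)) (\<lambda>x y f. Fa (Go x) (Go y) (Ga x y f))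
               (\<lambda>x. x) (\<lambda>x y f. f) \<epsilon>))"


section \<open>Strict 2-categories and 2-functors\<close>

record ('o, 'a, 'c) two_cat =
  Obj :: "'o set"
  One :: "'a set"
  Two :: "'c set"
  dom1 :: "'a \<Rightarrow> 'o"
  cod1 :: "'a \<Rightarrow> 'o"
  dom2 :: "'c \<Rightarrow> 'a"
  cod2 :: "'c \<Rightarrow> 'a"
  id1 :: "'o \<Rightarrow> 'a"
  id2 :: "'a \<Rightarrow> 'c"
  comp1 :: "'a \<Rightarrow> 'a \<Rightarrow> 'a"  (infixr "\<cdot>\<index>" 75)
  hcomp :: "'c \<Rightarrow> 'c \<Rightarrow> 'c"  (infixr "\<star>\<index>" 70)
  vcomp :: "'c \<Rightarrow> 'c \<Rightarrow> 'c"  (infixr "\<bullet>\<index>" 65)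

definition hom1 :: "('o, 'a, 'c) two_cat \<Rightarrow> 'o \<Rightarrow> 'o \<Rightarrow> 'a set" where
  "hom1 K X Y = {f \<in> One K. dom1 K f = X \<and> cod1 K f = Y}"

definition hom2 :: "('o, 'a, 'c) two_cat \<Rightarrow> 'a \<Rightarrow> 'a \<Rightarrow> 'c set" where
  "hom2 K f g = {\<alpha> \<in> Two K. dom2 K \<alpha> = f \<and> cod2 K \<alpha> = g}"

definition lwhisker :: "('o, 'a, 'c) two_cat \<Rightarrow> 'a \<Rightarrow> 'c \<Rightarrow> 'c"  (infixr "\<lhd>\<index>" 72) where
  "g \<lhd>\<^bsub>K\<^esub> \<alpha> = id2 K g \<star>\<^bsub>K\<^esub> \<alpha>"

definition rwhisker :: "('o, 'a, 'c) two_cat \<Rightarrow> 'c \<Rightarrow> 'a \<Rightarrow> 'c"  (infixl "\<rhd>\<index>" 73) where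
  "\<alpha> \<rhd>\<^bsub>K\<^esub> f = \<alpha> \<star>\<^bsub>K\<^esub> id2 K f"

definition inverse2 :: "('o, 'a, 'c) two_cat \<Rightarrow> 'c \<Rightarrow> 'c \<Rightarrow> bool" where
  "inverse2 K \<alpha> \<beta> \<longleftrightarrow> \<beta> \<in> hom2 K (cod2 K \<alpha>) (dom2 K \<alpha>) \<and>
     \<beta> \<bullet>\<^bsub>K\<^esub> \<alpha> = id2 K (dom2 K \<alpha>) \<and> \<alpha> \<bullet>\<^bsub>K\<^esub> \<beta> = id2 K (cod2 K \<alpha>)"

definition invertible2 :: "('o, 'a, 'c) two_cat \<Rightarrow> 'c \<Rightarrow> bool" where
  "invertible2 K \<alpha> \<longleftrightarrow> \<alpha> \<in> Two K \<and> (\<exists>\<beta>. inverse2 K \<alpha> \<beta>)"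

definition inv2 :: "('o, 'a, 'c) two_cat \<Rightarrow> 'c \<Rightarrow> 'c" where
  "inv2 K \<alpha> = (THE \<beta>. inverse2 K \<alpha> \<beta>)"

definition two_category :: "('o, 'a, 'c) two_cat \<Rightarrow> bool" where
  "two_category K \<longleftrightarrow>
     \<comment> \<open>underlying category\<close>
     (\<forall>f\<in>One K. dom1 K f \<in> Obj K \<and> cod1 K f \<in> Obj K) \<and>
     (\<forall>X\<in>Obj K. id1 K X \<in> hom1 K X X) \<and>
     (\<forall>f\<in>One K. \<forall>g\<in>One K. dom1 K g = cod1 K f \<longrightarrow>
        g \<cdot>\<^bsub>K\<^esub> f \<in> hom1 K (dom1 K f) (cod1 K g)) \<and>
     (\<forall>f\<in>One K. f \<cdot>\<^bsub>K\<^esub> id1 K (dom1 K f) = f \<and> id1 K (cod1 K f) \<cdot>\<^bsub>K\<^esub> f = f) \<and>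
     (\<forall>f\<in>One K. \<forall>g\<in>One K. \<forall>h\<in>One K. dom1 K g = cod1 K f \<longrightarrow> dom1 K h = cod1 K g \<longrightarrow>
        (h \<cdot>\<^bsub>K\<^esub> g) \<cdot>\<^bsub>K\<^esub> f = h \<cdot>\<^bsub>K\<^esub> (g \<cdot>\<^bsub>K\<^esub> f)) \<and>
     \<comment> \<open>hom-categories\<close>
     (\<forall>\<alpha>\<in>Two K. dom2 K \<alpha> \<in> One K \<and> cod2 K \<alpha> \<in> One K \<and>
        dom1 K (dom2 K \<alpha>) = dom1 K (cod2 K \<alpha>) \<and> cod1 K (dom2 K \<alpha>) = cod1 K (cod2 K \<alpha>)) \<and>
     (\<forall>f\<in>One K. id2 K f \<in> hom2 K f f) \<and>
     (\<forall>\<alpha>\<in>Two K. \<forall>\<beta>\<in>Two K. dom2 K \<beta> = cod2 K \<alpha> \<longrightarrow>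
        \<beta> \<bullet>\<^bsub>K\<^esub> \<alpha> \<in> hom2 K (dom2 K \<alpha>) (cod2 K \<beta>)) \<and>
     (\<forall>\<alpha>\<in>Two K. \<alpha> \<bullet>\<^bsub>K\<^esub> id2 K (dom2 K \<alpha>) = \<alpha> \<and> id2 K (cod2 K \<alpha>) \<bullet>\<^bsub>K\<^esub> \<alpha> = \<alpha>) \<and>
     (\<forall>\<alpha>\<in>Two K. \<forall>\<beta>\<in>Two K. \<forall>\<gamma>\<in>Two K. dom2 K \<beta> = cod2 K \<alpha> \<longrightarrow> dom2 K \<gamma> = cod2 K \<beta> \<longrightarrow>
        (\<gamma> \<bullet>\<^bsub>K\<^esub> \<beta>) \<bullet>\<^bsub>K\<^esub> \<alpha> = \<gamma> \<bullet>\<^bsub>K\<^esub> (\<beta> \<bullet>\<^bsub>K\<^esub> \<alpha>)) \<and>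
     \<comment> \<open>horizontal composition: a strictly associative and unital functor\<close>
     (\<forall>\<alpha>\<in>Two K. \<forall>\<beta>\<in>Two K. dom1 K (dom2 K \<beta>) = cod1 K (dom2 K \<alpha>) \<longrightarrow>
        \<beta> \<star>\<^bsub>K\<^esub> \<alpha> \<in> hom2 K (dom2 K \<beta> \<cdot>\<^bsub>K\<^esub> dom2 K \<alpha>) (cod2 K \<beta> \<cdot>\<^bsub>K\<^esub> cod2 K \<alpha>)) \<and>
     (\<forall>\<alpha>\<in>Two K. \<alpha> \<star>\<^bsub>K\<^esub> id2 K (id1 K (dom1 K (dom2 K \<alpha>))) = \<alpha> \<and>
        id2 K (id1 K (cod1 K (dom2 K \<alpha>))) \<star>\<^bsub>K\<^esub> \<alpha> = \<alpha>) \<and>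
     (\<forall>\<alpha>\<in>Two K. \<forall>\<beta>\<in>Two K. \<forall>\<gamma>\<in>Two K. dom1 K (dom2 K \<beta>) = cod1 K (dom2 K \<alpha>) \<longrightarrow>
        dom1 K (dom2 K \<gamma>) = cod1 K (dom2 K \<beta>) \<longrightarrow>
        (\<gamma> \<star>\<^bsub>K\<^esub> \<beta>) \<star>\<^bsub>K\<^esub> \<alpha> = \<gamma> \<star>\<^bsub>K\<^esub> (\<beta> \<star>\<^bsub>K\<^esub> \<alpha>)) \<and>
     (\<forall>f\<in>One K. \<forall>g\<in>One K. dom1 K g = cod1 K f \<longrightarrow>
        id2 K g \<star>\<^bsub>K\<^esub> id2 K f = id2 K (g \<cdot>\<^bsub>K\<^esub> f)) \<and>
     (\<forall>\<alpha>\<in>Two K. \<forall>\<alpha>'\<in>Two K. \<forall>\<beta>\<in>Two K. \<forall>\<beta>'\<in>Two K.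
        dom2 K \<alpha>' = cod2 K \<alpha> \<longrightarrow> dom2 K \<beta>' = cod2 K \<beta> \<longrightarrow>
        dom1 K (dom2 K \<beta>) = cod1 K (dom2 K \<alpha>) \<longrightarrow>
        (\<beta>' \<bullet>\<^bsub>K\<^esub> \<beta>) \<star>\<^bsub>K\<^esub> (\<alpha>' \<bullet>\<^bsub>K\<^esub> \<alpha>) = (\<beta>' \<star>\<^bsub>K\<^esub> \<alpha>') \<bullet>\<^bsub>K\<^esub> (\<beta> \<star>\<^bsub>K\<^esub> \<alpha>))"

definition hom_cat :: "('o, 'a, 'c) two_cat \<Rightarrow> 'o \<Rightarrow> 'o \<Rightarrow> ('a, 'c) cat" where
  "hom_cat K X Y = \<lparr>cobj = hom1 K X Y, chom = hom2 K, cid = id2 K, ccomp = vcomp K\<rparr>"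

record ('io, 'ia, 'ic, 'o, 'a, 'c) two_fun =
  onObj :: "'io \<Rightarrow> 'o"
  onOne :: "'ia \<Rightarrow> 'a"
  onTwo :: "'ic \<Rightarrow> 'c"

definition two_functor ::
  "('io, 'ia, 'ic) two_cat \<Rightarrow> ('o, 'a, 'c) two_cat
    \<Rightarrow> ('io, 'ia, 'ic, 'o, 'a, 'c) two_fun \<Rightarrow> bool" where
  "two_functor J K F \<longleftrightarrow>
     (\<forall>X\<in>Obj J. onObj F X \<in> Obj K) \<and>
     (\<forall>f\<in>One J. onOne F f \<in> hom1 K (onObj F (dom1 J f)) (onObj F (cod1 J f))) \<and>
     (\<forall>\<alpha>\<in>Two J. onTwo F \<alpha> \<in> hom2 K (onOne F (dom2 J \<alpha>)) (onOne F (cod2 J \<alpha>))) \<and>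
     (\<forall>X\<in>Obj J. onOne F (id1 J X) = id1 K (onObj F X)) \<and>
     (\<forall>f\<in>One J. \<forall>g\<in>One J. dom1 J g = cod1 J f \<longrightarrow>
        onOne F (g \<cdot>\<^bsub>J\<^esub> f) = onOne F g \<cdot>\<^bsub>K\<^esub> onOne F f) \<and>
     (\<forall>f\<in>One J. onTwo F (id2 J f) = id2 K (onOne F f)) \<and>
     (\<forall>\<alpha>\<in>Two J. \<forall>\<beta>\<in>Two J. dom2 J \<beta> = cod2 J \<alpha> \<longrightarrow>
        onTwo F (\<beta> \<bullet>\<^bsub>J\<^esub> \<alpha>) = onTwo F \<beta> \<bullet>\<^bsub>K\<^esub> onTwo F \<alpha>) \<and>
     (\<forall>\<alpha>\<in>Two J. \<forall>\<beta>\<in>Two J. dom1 J (dom2 J \<beta>) = cod1 J (dom2 J \<alpha>) \<longrightarrow>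
        onTwo F (\<beta> \<star>\<^bsub>J\<^esub> \<alpha>) = onTwo F \<beta> \<star>\<^bsub>K\<^esub> onTwo F \<alpha>)"

definition two_fun_comp ::
  "('jo, 'ja, 'jc, 'o, 'a, 'c) two_fun \<Rightarrow> ('io, 'ia, 'ic, 'jo, 'ja, 'jc) two_fun
    \<Rightarrow> ('io, 'ia, 'ic, 'o, 'a, 'c) two_fun"  (infixr "\<circ>\<^sub>2" 55) where
  "G \<circ>\<^sub>2 F = \<lparr>onObj = onObj G \<circ> onObj F, onOne = onOne G \<circ> onOne F, onTwo = onTwo G \<circ> onTwo F\<rparr>"


section \<open>Oplax cocones, sigma-cocones and their bicolimits\<close>

text \<open>Cocones and modifications are families indexed by the cells of the index
  2-category; they are taken to be extensional, so that equality of families is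
  equality on those cells.\<close>

record ('io, 'ia, 'a, 'c) cocone =
  leg :: "'io \<Rightarrow> 'a"
  transition :: "'ia \<Rightarrow> 'c"

definition oplax_cocone ::
  "('io, 'ia, 'ic) two_cat \<Rightarrow> ('o, 'a, 'c) two_cat \<Rightarrow> ('io, 'ia, 'ic, 'o, 'a, 'c) two_fun
    \<Rightarrow> 'o \<Rightarrow> ('io, 'ia, 'a, 'c) cocone \<Rightarrow> bool" where
  "oplax_cocone J K F B q \<longleftrightarrow>
     B \<in> Obj K \<and> leg q \<in> extensional (Obj J) \<and> transition q \<in> extensional (One J) \<and>
     (\<forall>i\<in>Obj J. leg q i \<in> hom1 K (onObj F i) B) \<and>
     (\<forall>d\<in>One J. transition q d \<in>
        hom2 K (leg q (cod1 J d) \<cdot>\<^bsub>K\<^esub> onOne F d) (leg q (dom1 J d))) \<and>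
     (\<forall>i\<in>Obj J. transition q (id1 J i) = id2 K (leg q i)) \<and>
     (\<forall>d\<in>One J. \<forall>e\<in>One J. dom1 J e = cod1 J d \<longrightarrow>
        transition q (e \<cdot>\<^bsub>J\<^esub> d) = transition q d \<bullet>\<^bsub>K\<^esub> (transition q e \<rhd>\<^bsub>K\<^esub> onOne F d)) \<and>
     (\<forall>s\<in>Two J. transition q (cod2 J s) \<bullet>\<^bsub>K\<^esub> (leg q (cod1 J (dom2 J s)) \<lhd>\<^bsub>K\<^esub> onTwo F s)
        = transition q (dom2 J s))"

definition modification ::
  "('io, 'ia, 'ic) two_cat \<Rightarrow> ('o, 'a, 'c) two_cat \<Rightarrow> ('io, 'ia, 'ic, 'o, 'a, 'c) two_fun
    \<Rightarrow> ('io, 'ia, 'a, 'c) cocone \<Rightarrow> ('io, 'ia, 'a, 'c) cocone \<Rightarrow> ('io \<Rightarrow> 'c) \<Rightarrow> bool" where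
  "modification J K F q q' m \<longleftrightarrow>
     m \<in> extensional (Obj J) \<and>
     (\<forall>i\<in>Obj J. m i \<in> hom2 K (leg q i) (leg q' i)) \<and>
     (\<forall>d\<in>One J. m (dom1 J d) \<bullet>\<^bsub>K\<^esub> transition q d
        = transition q' d \<bullet>\<^bsub>K\<^esub> (m (cod1 J d) \<rhd>\<^bsub>K\<^esub> onOne F d))"

definition oplax_cocone_cat ::
  "('io, 'ia, 'ic) two_cat \<Rightarrow> ('o, 'a, 'c) two_cat \<Rightarrow> ('io, 'ia, 'ic, 'o, 'a, 'c) two_fun
    \<Rightarrow> 'o \<Rightarrow> (('io, 'ia, 'a, 'c) cocone, 'io \<Rightarrow> 'c) cat" where
  "oplax_cocone_cat J K F B =
     \<lparr>cobj = {q. oplax_cocone J K F B q},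
      chom = (\<lambda>q q'. {m. modification J K F q q' m}),
      cid = (\<lambda>q. \<lambda>i\<in>Obj J. id2 K (leg q i)),
      ccomp = (\<lambda>m' m. \<lambda>i\<in>Obj J. m' i \<bullet>\<^bsub>K\<^esub> m i)\<rparr>"

definition sigma_cocone ::
  "('io, 'ia, 'ic) two_cat \<Rightarrow> ('o, 'a, 'c) two_cat \<Rightarrow> ('io, 'ia, 'ic, 'o, 'a, 'c) two_fun
    \<Rightarrow> 'ia set \<Rightarrow> 'o \<Rightarrow> ('io, 'ia, 'a, 'c) cocone \<Rightarrow> bool" where
  "sigma_cocone J K F \<Sigma> B q \<longleftrightarrow>
     oplax_cocone J K F B q \<and> (\<forall>d\<in>\<Sigma>. invertible2 K (transition q d))"

definition sigma_cocone_cat ::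
  "('io, 'ia, 'ic) two_cat \<Rightarrow> ('o, 'a, 'c) two_cat \<Rightarrow> ('io, 'ia, 'ic, 'o, 'a, 'c) two_fun
    \<Rightarrow> 'ia set \<Rightarrow> 'o \<Rightarrow> (('io, 'ia, 'a, 'c) cocone, 'io \<Rightarrow> 'c) cat" where
  "sigma_cocone_cat J K F \<Sigma> B =
     (oplax_cocone_cat J K F B)\<lparr>cobj := {q. sigma_cocone J K F \<Sigma> B q}\<rparr>"

definition post_cocone ::
  "('io, 'ia, 'ic) two_cat \<Rightarrow> ('o, 'a, 'c) two_cat \<Rightarrow> ('io, 'ia, 'a, 'c) cocone
    \<Rightarrow> 'a \<Rightarrow> ('io, 'ia, 'a, 'c) cocone" where
  "post_cocone J K q f =
     \<lparr>leg = \<lambda>i\<in>Obj J. f \<cdot>\<^bsub>K\<^esub> leg q i, transition = \<lambda>d\<in>One J. f \<lhd>\<^bsub>K\<^esub> transition q d\<rparr>"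

definition post_modification ::
  "('io, 'ia, 'ic) two_cat \<Rightarrow> ('o, 'a, 'c) two_cat \<Rightarrow> ('io, 'ia, 'a, 'c) cocone
    \<Rightarrow> 'c \<Rightarrow> ('io \<Rightarrow> 'c)" where
  "post_modification J K q \<alpha> = (\<lambda>i\<in>Obj J. \<alpha> \<rhd>\<^bsub>K\<^esub> leg q i)"

text \<open>The comparison functors in the following universal properties are given by
  composition with a fixed cocone, hence are (strictly) natural in the tip \<open>B\<close>.\<close>

definition oplax_bicolimit ::
  "('io, 'ia, 'ic) two_cat \<Rightarrow> ('o, 'a, 'c) two_cat \<Rightarrow> ('io, 'ia, 'ic, 'o, 'a, 'c) two_fun
    \<Rightarrow> 'o \<Rightarrow> ('io, 'ia, 'a, 'c) cocone \<Rightarrow> bool" where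
  "oplax_bicolimit J K F L q \<longleftrightarrow> oplax_cocone J K F L q \<and>
     (\<forall>B\<in>Obj K. is_equivalence (hom_cat K L B) (oplax_cocone_cat J K F B)
        (post_cocone J K q) (\<lambda>f g. post_modification J K q))"

definition sigma_bicolimit ::
  "('io, 'ia, 'ic) two_cat \<Rightarrow> ('o, 'a, 'c) two_cat \<Rightarrow> ('io, 'ia, 'ic, 'o, 'a, 'c) two_fun
    \<Rightarrow> 'ia set \<Rightarrow> 'o \<Rightarrow> ('io, 'ia, 'a, 'c) cocone \<Rightarrow> bool" where
  "sigma_bicolimit J K F \<Sigma> L q \<longleftrightarrow> sigma_cocone J K F \<Sigma> L q \<and>
     (\<forall>B\<in>Obj K. is_equivalence (hom_cat K L B) (sigma_cocone_cat J K F \<Sigma> B)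
        (post_cocone J K q) (\<lambda>f g. post_modification J K q))"

text \<open>Smallness is relative to an (infinite) type \<open>'u\<close>: a 2-category is small if its
  cells can be indexed by elements of \<open>'u\<close>. Up to isomorphism such a 2-category
  lives on \<open>'u\<close>, so having small bicolimits only needs to refer to index
  2-categories on \<open>'u\<close>.\<close>

definition small_two_cat :: "'u itself \<Rightarrow> ('o, 'a, 'c) two_cat \<Rightarrow> bool" where
  "small_two_cat (_ :: 'u itself) J \<longleftrightarrow>
     Obj J \<lesssim> (UNIV :: 'u set) \<and> One J \<lesssim> (UNIV :: 'u set) \<and> Two J \<lesssim> (UNIV :: 'u set)"

definition has_small_oplax_bicolimits :: "'u itself \<Rightarrow> ('o, 'a, 'c) two_cat \<Rightarrow> bool" where
  "has_small_oplax_bicolimits (_ :: 'u itself) K \<longleftrightarrow>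
     (\<forall>(J :: ('u, 'u, 'u) two_cat) F. two_category J \<longrightarrow> two_functor J K F \<longrightarrow>
        (\<exists>L q. oplax_bicolimit J K F L q))"

text \<open>A mediating 1-cell \<open>u\<close> out of an oplax bicolimit cocone \<open>q\<close> with tip \<open>L\<close>,
  together with its universal invertible modification from \<open>u q\<close> to \<open>q'\<close>.\<close>

definition mediates ::
  "('io, 'ia, 'ic) two_cat \<Rightarrow> ('o, 'a, 'c) two_cat \<Rightarrow> ('io, 'ia, 'ic, 'o, 'a, 'c) two_fun
    \<Rightarrow> 'o \<Rightarrow> ('io, 'ia, 'a, 'c) cocone \<Rightarrow> 'o \<Rightarrow> ('io, 'ia, 'a, 'c) cocone
    \<Rightarrow> 'a \<Rightarrow> ('io \<Rightarrow> 'c) \<Rightarrow> bool" where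
  "mediates J K F L q B q' u m \<longleftrightarrow> oplax_cocone J K F B q' \<and> u \<in> hom1 K L B \<and>
     is_iso (oplax_cocone_cat J K F B) (post_cocone J K q u) q' m"


section \<open>Codescent objects and bicoequalizers\<close>

record ('o, 'a, 'c) codescent =
  X0 :: 'o
  X1 :: 'o
  X2 :: 'o
  P0 :: 'a
  P1 :: 'a
  P2 :: 'a
  D0 :: 'a
  D1 :: 'a
  U :: 'a  \<comment> \<open>the unit \<open>i : X(0) \<rightarrow> X(1)\<close>\<close>
  N0 :: 'c
  N1 :: 'c
  T01 :: 'c
  T02 :: 'c
  T12 :: 'c

definition codescent_object :: "('o, 'a, 'c) two_cat \<Rightarrow> ('o, 'a, 'c) codescent \<Rightarrow> bool" where
  "codescent_object K X \<longleftrightarrow>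
     X0 X \<in> Obj K \<and> X1 X \<in> Obj K \<and> X2 X \<in> Obj K \<and>
     P0 X \<in> hom1 K (X2 X) (X1 X) \<and> P1 X \<in> hom1 K (X2 X) (X1 X) \<and>
     P2 X \<in> hom1 K (X2 X) (X1 X) \<and>
     D0 X \<in> hom1 K (X1 X) (X0 X) \<and> D1 X \<in> hom1 K (X1 X) (X0 X) \<and>
     U X \<in> hom1 K (X0 X) (X1 X) \<and>
     N0 X \<in> hom2 K (D0 X \<cdot>\<^bsub>K\<^esub> U X) (id1 K (X0 X)) \<and>
     N1 X \<in> hom2 K (D1 X \<cdot>\<^bsub>K\<^esub> U X) (id1 K (X0 X)) \<and>
     T01 X \<in> hom2 K (D0 X \<cdot>\<^bsub>K\<^esub> P0 X) (D0 X \<cdot>\<^bsub>K\<^esub> P1 X) \<and>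
     T02 X \<in> hom2 K (D1 X \<cdot>\<^bsub>K\<^esub> P0 X) (D0 X \<cdot>\<^bsub>K\<^esub> P2 X) \<and>
     T12 X \<in> hom2 K (D1 X \<cdot>\<^bsub>K\<^esub> P1 X) (D1 X \<cdot>\<^bsub>K\<^esub> P2 X) \<and>
     (\<forall>\<alpha>\<in>{N0 X, N1 X, T01 X, T02 X, T12 X}. invertible2 K \<alpha>)"

definition pseudocoequalizes ::
  "('o, 'a, 'c) two_cat \<Rightarrow> ('o, 'a, 'c) codescent \<Rightarrow> 'o \<Rightarrow> 'a \<times> 'c \<Rightarrow> bool" where
  "pseudocoequalizes K X B = (\<lambda>(q, \<xi>).
     B \<in> Obj K \<and> q \<in> hom1 K (X0 X) B \<and>
     \<xi> \<in> hom2 K (q \<cdot>\<^bsub>K\<^esub> D0 X) (q \<cdot>\<^bsub>K\<^esub> D1 X) \<and> invertible2 K \<xi> \<and>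
     (q \<lhd>\<^bsub>K\<^esub> N1 X) \<bullet>\<^bsub>K\<^esub> (\<xi> \<rhd>\<^bsub>K\<^esub> U X) = q \<lhd>\<^bsub>K\<^esub> N0 X \<and>
     (q \<lhd>\<^bsub>K\<^esub> T12 X) \<bullet>\<^bsub>K\<^esub> (\<xi> \<rhd>\<^bsub>K\<^esub> P1 X) \<bullet>\<^bsub>K\<^esub> (q \<lhd>\<^bsub>K\<^esub> T01 X)
       = (\<xi> \<rhd>\<^bsub>K\<^esub> P2 X) \<bullet>\<^bsub>K\<^esub> (q \<lhd>\<^bsub>K\<^esub> T02 X) \<bullet>\<^bsub>K\<^esub> (\<xi> \<rhd>\<^bsub>K\<^esub> P0 X))"

definition pseudocoeq_cat ::
  "('o, 'a, 'c) two_cat \<Rightarrow> ('o, 'a, 'c) codescent \<Rightarrow> 'o \<Rightarrow> ('a \<times> 'c, 'c) cat" where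
  "pseudocoeq_cat K X B =
     \<lparr>cobj = {p. pseudocoequalizes K X B p},
      chom = (\<lambda>(q, \<xi>) (q', \<xi>'). {\<alpha> \<in> hom2 K q q'.
                \<xi>' \<bullet>\<^bsub>K\<^esub> (\<alpha> \<rhd>\<^bsub>K\<^esub> D0 X) = (\<alpha> \<rhd>\<^bsub>K\<^esub> D1 X) \<bullet>\<^bsub>K\<^esub> \<xi>}),
      cid = (\<lambda>(q, \<xi>). id2 K q),
      ccomp = vcomp K\<rparr>"

definition bicoequalizer ::
  "('o, 'a, 'c) two_cat \<Rightarrow> ('o, 'a, 'c) codescent \<Rightarrow> 'o \<Rightarrow> 'a \<times> 'c \<Rightarrow> bool" where
  "bicoequalizer K X E = (\<lambda>(q, \<xi>). pseudocoequalizes K X E (q, \<xi>) \<and>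
     (\<forall>B\<in>Obj K. is_equivalence (hom_cat K E B) (pseudocoeq_cat K X B)
        (\<lambda>f. (f \<cdot>\<^bsub>K\<^esub> q, f \<lhd>\<^bsub>K\<^esub> \<xi>)) (\<lambda>f g \<alpha>. \<alpha> \<rhd>\<^bsub>K\<^esub> q)))"


section \<open>The indexing 2-categories of Sigma-edges and Sigma-triangles\<close>

record ('a, 'c) square =
  sq_dom :: 'a
  sq_cod :: 'a
  sq0 :: 'a
  sq1 :: 'a
  sq_cell :: 'c

record ('a, 'c) square_mod =
  sm_dom :: "('a, 'c) square"
  sm_cod :: "('a, 'c) square"
  sm0 :: 'c
  sm1 :: 'c

definition square :: "('o, 'a, 'c) two_cat \<Rightarrow> 'a set \<Rightarrow> ('a, 'c) square \<Rightarrow> bool" where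
  "square I \<Sigma> \<phi> \<longleftrightarrow>
     sq_dom \<phi> \<in> \<Sigma> \<and> sq_cod \<phi> \<in> \<Sigma> \<and>
     sq0 \<phi> \<in> hom1 I (dom1 I (sq_dom \<phi>)) (dom1 I (sq_cod \<phi>)) \<and>
     sq1 \<phi> \<in> hom1 I (cod1 I (sq_dom \<phi>)) (cod1 I (sq_cod \<phi>)) \<and>
     sq_cell \<phi> \<in> hom2 I (sq_cod \<phi> \<cdot>\<^bsub>I\<^esub> sq0 \<phi>) (sq1 \<phi> \<cdot>\<^bsub>I\<^esub> sq_dom \<phi>) \<and>
     invertible2 I (sq_cell \<phi>)"

definition square_mod :: "('o, 'a, 'c) two_cat \<Rightarrow> 'a set \<Rightarrow> ('a, 'c) square_mod \<Rightarrow> bool" where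
  "square_mod I \<Sigma> \<mu> \<longleftrightarrow>
     square I \<Sigma> (sm_dom \<mu>) \<and> square I \<Sigma> (sm_cod \<mu>) \<and>
     sq_dom (sm_dom \<mu>) = sq_dom (sm_cod \<mu>) \<and> sq_cod (sm_dom \<mu>) = sq_cod (sm_cod \<mu>) \<and>
     sm0 \<mu> \<in> hom2 I (sq0 (sm_dom \<mu>)) (sq0 (sm_cod \<mu>)) \<and>
     sm1 \<mu> \<in> hom2 I (sq1 (sm_dom \<mu>)) (sq1 (sm_cod \<mu>)) \<and>
     (sm1 \<mu> \<rhd>\<^bsub>I\<^esub> sq_dom (sm_dom \<mu>)) \<bullet>\<^bsub>I\<^esub> sq_cell (sm_dom \<mu>)
       = sq_cell (sm_cod \<mu>) \<bullet>\<^bsub>I\<^esub> (sq_cod (sm_dom \<mu>) \<lhd>\<^bsub>I\<^esub> sm0 \<mu>)"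

definition square_id :: "('o, 'a, 'c) two_cat \<Rightarrow> 'a \<Rightarrow> ('a, 'c) square" where
  "square_id I d = \<lparr>sq_dom = d, sq_cod = d, sq0 = id1 I (dom1 I d), sq1 = id1 I (cod1 I d),
     sq_cell = id2 I d\<rparr>"

definition square_comp ::
  "('o, 'a, 'c) two_cat \<Rightarrow> ('a, 'c) square \<Rightarrow> ('a, 'c) square \<Rightarrow> ('a, 'c) square" where
  "square_comp I \<psi> \<phi> = \<lparr>sq_dom = sq_dom \<phi>, sq_cod = sq_cod \<psi>,
     sq0 = sq0 \<psi> \<cdot>\<^bsub>I\<^esub> sq0 \<phi>, sq1 = sq1 \<psi> \<cdot>\<^bsub>I\<^esub> sq1 \<phi>,
     sq_cell = (sq1 \<psi> \<lhd>\<^bsub>I\<^esub> sq_cell \<phi>) \<bullet>\<^bsub>I\<^esub> (sq_cell \<psi> \<rhd>\<^bsub>I\<^esub> sq0 \<phi>)\<rparr>"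

definition Sigma2 ::
  "('o, 'a, 'c) two_cat \<Rightarrow> 'a set \<Rightarrow> ('a, ('a, 'c) square, ('a, 'c) square_mod) two_cat" where
  "Sigma2 I \<Sigma> =
     \<lparr>Obj = \<Sigma>, One = {\<phi>. square I \<Sigma> \<phi>}, Two = {\<mu>. square_mod I \<Sigma> \<mu>},
      dom1 = sq_dom, cod1 = sq_cod, dom2 = sm_dom, cod2 = sm_cod,
      id1 = square_id I,
      id2 = (\<lambda>\<phi>. \<lparr>sm_dom = \<phi>, sm_cod = \<phi>, sm0 = id2 I (sq0 \<phi>), sm1 = id2 I (sq1 \<phi>)\<rparr>),
      comp1 = square_comp I,
      hcomp = (\<lambda>\<nu> \<mu>. \<lparr>sm_dom = square_comp I (sm_dom \<nu>) (sm_dom \<mu>),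
                      sm_cod = square_comp I (sm_cod \<nu>) (sm_cod \<mu>),
                      sm0 = sm0 \<nu> \<star>\<^bsub>I\<^esub> sm0 \<mu>, sm1 = sm1 \<nu> \<star>\<^bsub>I\<^esub> sm1 \<mu>\<rparr>),
      vcomp = (\<lambda>\<nu> \<mu>. \<lparr>sm_dom = sm_dom \<mu>, sm_cod = sm_cod \<nu>,
                      sm0 = sm0 \<nu> \<bullet>\<^bsub>I\<^esub> sm0 \<mu>, sm1 = sm1 \<nu> \<bullet>\<^bsub>I\<^esub> sm1 \<mu>\<rparr>)\<rparr>"

definition Sigma2_dom ::
  "('o, 'a, 'c) two_cat
    \<Rightarrow> ('a, ('a, 'c) square, ('a, 'c) square_mod, 'o, 'a, 'c) two_fun" where
  "Sigma2_dom I = \<lparr>onObj = dom1 I, onOne = sq0, onTwo = sm0\<rparr>"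

definition Sigma2_cod ::
  "('o, 'a, 'c) two_cat
    \<Rightarrow> ('a, ('a, 'c) square, ('a, 'c) square_mod, 'o, 'a, 'c) two_fun" where
  "Sigma2_cod I = \<lparr>onObj = cod1 I, onOne = sq1, onTwo = sm1\<rparr>"

text \<open>The edges are part of the data of a triangle, since they cannot be recovered
  from the source \<open>e2 e0\<close> of its 2-cell.\<close>

record ('a, 'c) triangle =
  e0 :: 'a
  e1 :: 'a
  e2 :: 'a
  face :: 'c

text \<open>Pseudonatural transformations of triangles: components at the three vertices
  and structure 2-cells at the three edges.\<close>

record ('a, 'c) tri_trans =
  tt_dom :: "('a, 'c) triangle"
  tt_cod :: "('a, 'c) triangle"
  t0 :: 'a
  t1 :: 'a
  t2 :: 'a
  tc0 :: 'c
  tc1 :: 'c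
  tc2 :: 'c

record ('a, 'c) tri_mod =
  tm_dom :: "('a, 'c) tri_trans"
  tm_cod :: "('a, 'c) tri_trans"
  tm0 :: 'c
  tm1 :: 'c
  tm2 :: 'c

definition triangle :: "('o, 'a, 'c) two_cat \<Rightarrow> 'a set \<Rightarrow> ('a, 'c) triangle \<Rightarrow> bool" where
  "triangle I \<Sigma> T \<longleftrightarrow>
     e0 T \<in> \<Sigma> \<and> e1 T \<in> \<Sigma> \<and> e2 T \<in> \<Sigma> \<and>
     cod1 I (e0 T) = dom1 I (e2 T) \<and>
     face T \<in> hom2 I (e2 T \<cdot>\<^bsub>I\<^esub> e0 T) (e1 T) \<and> invertible2 I (face T)"

definition tri_edge0 :: "('a, 'c) tri_trans \<Rightarrow> ('a, 'c) square" where
  "tri_edge0 \<tau> = \<lparr>sq_dom = e0 (tt_dom \<tau>), sq_cod = e0 (tt_cod \<tau>),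
     sq0 = t0 \<tau>, sq1 = t1 \<tau>, sq_cell = tc0 \<tau>\<rparr>"

definition tri_edge1 :: "('a, 'c) tri_trans \<Rightarrow> ('a, 'c) square" where
  "tri_edge1 \<tau> = \<lparr>sq_dom = e1 (tt_dom \<tau>), sq_cod = e1 (tt_cod \<tau>),
     sq0 = t0 \<tau>, sq1 = t2 \<tau>, sq_cell = tc1 \<tau>\<rparr>"

definition tri_edge2 :: "('a, 'c) tri_trans \<Rightarrow> ('a, 'c) square" where
  "tri_edge2 \<tau> = \<lparr>sq_dom = e2 (tt_dom \<tau>), sq_cod = e2 (tt_cod \<tau>),
     sq0 = t1 \<tau>, sq1 = t2 \<tau>, sq_cell = tc2 \<tau>\<rparr>"

definition tri_trans :: "('o, 'a, 'c) two_cat \<Rightarrow> 'a set \<Rightarrow> ('a, 'c) tri_trans \<Rightarrow> bool" where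
  "tri_trans I \<Sigma> \<tau> \<longleftrightarrow>
     triangle I \<Sigma> (tt_dom \<tau>) \<and> triangle I \<Sigma> (tt_cod \<tau>) \<and>
     square I \<Sigma> (tri_edge0 \<tau>) \<and> square I \<Sigma> (tri_edge1 \<tau>) \<and> square I \<Sigma> (tri_edge2 \<tau>) \<and>
     (t2 \<tau> \<lhd>\<^bsub>I\<^esub> face (tt_dom \<tau>)) \<bullet>\<^bsub>I\<^esub> (tc2 \<tau> \<rhd>\<^bsub>I\<^esub> e0 (tt_dom \<tau>)) \<bullet>\<^bsub>I\<^esub> (e2 (tt_cod \<tau>) \<lhd>\<^bsub>I\<^esub> tc0 \<tau>)
       = tc1 \<tau> \<bullet>\<^bsub>I\<^esub> (face (tt_cod \<tau>) \<rhd>\<^bsub>I\<^esub> t0 \<tau>)"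

definition mod_edge0 :: "('a, 'c) tri_mod \<Rightarrow> ('a, 'c) square_mod" where
  "mod_edge0 \<mu> = \<lparr>sm_dom = tri_edge0 (tm_dom \<mu>), sm_cod = tri_edge0 (tm_cod \<mu>),
     sm0 = tm0 \<mu>, sm1 = tm1 \<mu>\<rparr>"

definition mod_edge1 :: "('a, 'c) tri_mod \<Rightarrow> ('a, 'c) square_mod" where
  "mod_edge1 \<mu> = \<lparr>sm_dom = tri_edge1 (tm_dom \<mu>), sm_cod = tri_edge1 (tm_cod \<mu>),
     sm0 = tm0 \<mu>, sm1 = tm2 \<mu>\<rparr>"

definition mod_edge2 :: "('a, 'c) tri_mod \<Rightarrow> ('a, 'c) square_mod" where
  "mod_edge2 \<mu> = \<lparr>sm_dom = tri_edge2 (tm_dom \<mu>), sm_cod = tri_edge2 (tm_cod \<mu>),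
     sm0 = tm1 \<mu>, sm1 = tm2 \<mu>\<rparr>"

text \<open>The modification axiom at an edge is the compatibility condition of
  modifications of squares.\<close>

definition tri_mod :: "('o, 'a, 'c) two_cat \<Rightarrow> 'a set \<Rightarrow> ('a, 'c) tri_mod \<Rightarrow> bool" where
  "tri_mod I \<Sigma> \<mu> \<longleftrightarrow>
     tri_trans I \<Sigma> (tm_dom \<mu>) \<and> tri_trans I \<Sigma> (tm_cod \<mu>) \<and>
     tt_dom (tm_dom \<mu>) = tt_dom (tm_cod \<mu>) \<and> tt_cod (tm_dom \<mu>) = tt_cod (tm_cod \<mu>) \<and>
     square_mod I \<Sigma> (mod_edge0 \<mu>) \<and> square_mod I \<Sigma> (mod_edge1 \<mu>) \<and> square_mod I \<Sigma> (mod_edge2 \<mu>)"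

definition tri_id :: "('o, 'a, 'c) two_cat \<Rightarrow> ('a, 'c) triangle \<Rightarrow> ('a, 'c) tri_trans" where
  "tri_id I T = \<lparr>tt_dom = T, tt_cod = T,
     t0 = id1 I (dom1 I (e0 T)), t1 = id1 I (dom1 I (e2 T)), t2 = id1 I (cod1 I (e2 T)),
     tc0 = id2 I (e0 T), tc1 = id2 I (e1 T), tc2 = id2 I (e2 T)\<rparr>"

definition tri_comp ::
  "('o, 'a, 'c) two_cat \<Rightarrow> ('a, 'c) tri_trans \<Rightarrow> ('a, 'c) tri_trans \<Rightarrow> ('a, 'c) tri_trans" where
  "tri_comp I \<upsilon> \<tau> = \<lparr>tt_dom = tt_dom \<tau>, tt_cod = tt_cod \<upsilon>,
     t0 = t0 \<upsilon> \<cdot>\<^bsub>I\<^esub> t0 \<tau>, t1 = t1 \<upsilon> \<cdot>\<^bsub>I\<^esub> t1 \<tau>, t2 = t2 \<upsilon> \<cdot>\<^bsub>I\<^esub> t2 \<tau>,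
     tc0 = sq_cell (square_comp I (tri_edge0 \<upsilon>) (tri_edge0 \<tau>)),
     tc1 = sq_cell (square_comp I (tri_edge1 \<upsilon>) (tri_edge1 \<tau>)),
     tc2 = sq_cell (square_comp I (tri_edge2 \<upsilon>) (tri_edge2 \<tau>))\<rparr>"

definition Sigma3 ::
  "('o, 'a, 'c) two_cat \<Rightarrow> 'a set
    \<Rightarrow> (('a, 'c) triangle, ('a, 'c) tri_trans, ('a, 'c) tri_mod) two_cat" where
  "Sigma3 I \<Sigma> =
     \<lparr>Obj = {T. triangle I \<Sigma> T}, One = {\<tau>. tri_trans I \<Sigma> \<tau>}, Two = {\<mu>. tri_mod I \<Sigma> \<mu>},
      dom1 = tt_dom, cod1 = tt_cod, dom2 = tm_dom, cod2 = tm_cod,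
      id1 = tri_id I,
      id2 = (\<lambda>\<tau>. \<lparr>tm_dom = \<tau>, tm_cod = \<tau>,
                  tm0 = id2 I (t0 \<tau>), tm1 = id2 I (t1 \<tau>), tm2 = id2 I (t2 \<tau>)\<rparr>),
      comp1 = tri_comp I,
      hcomp = (\<lambda>\<nu> \<mu>. \<lparr>tm_dom = tri_comp I (tm_dom \<nu>) (tm_dom \<mu>),
                      tm_cod = tri_comp I (tm_cod \<nu>) (tm_cod \<mu>),
                      tm0 = tm0 \<nu> \<star>\<^bsub>I\<^esub> tm0 \<mu>, tm1 = tm1 \<nu> \<star>\<^bsub>I\<^esub> tm1 \<mu>, tm2 = tm2 \<nu> \<star>\<^bsub>I\<^esub> tm2 \<mu>\<rparr>),
      vcomp = (\<lambda>\<nu> \<mu>. \<lparr>tm_dom = tm_dom \<mu>, tm_cod = tm_cod \<nu>,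
                      tm0 = tm0 \<nu> \<bullet>\<^bsub>I\<^esub> tm0 \<mu>, tm1 = tm1 \<nu> \<bullet>\<^bsub>I\<^esub> tm1 \<mu>, tm2 = tm2 \<nu> \<bullet>\<^bsub>I\<^esub> tm2 \<mu>\<rparr>)\<rparr>"

type_synonym ('a, 'c) Sigma32_fun =
  "(('a, 'c) triangle, ('a, 'c) tri_trans, ('a, 'c) tri_mod,
    'a, ('a, 'c) square, ('a, 'c) square_mod) two_fun"

definition Sigma3_p0 :: "('a, 'c) Sigma32_fun" where
  "Sigma3_p0 = \<lparr>onObj = e0, onOne = tri_edge0, onTwo = mod_edge0\<rparr>"

definition Sigma3_p1 :: "('a, 'c) Sigma32_fun" where
  "Sigma3_p1 = \<lparr>onObj = e1, onOne = tri_edge1, onTwo = mod_edge1\<rparr>"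

definition Sigma3_p2 :: "('a, 'c) Sigma32_fun" where
  "Sigma3_p2 = \<lparr>onObj = e2, onOne = tri_edge2, onTwo = mod_edge2\<rparr>"


section \<open>The codescent object associated to a 2-functor\<close>

text \<open>The oplax cocones inducing the 1-cells of the codescent object. Here \<open>q\<close> is an
  oplax cocone on \<open>F\<close> and \<open>r\<close> an oplax cocone on \<open>F dom\<close>.\<close>

definition d0_cocone ::
  "('io, 'ia, 'ic) two_cat \<Rightarrow> 'ia set \<Rightarrow> ('io, 'ia, 'a, 'c) cocone
    \<Rightarrow> ('ia, ('ia, 'ic) square, 'a, 'c) cocone" where
  "d0_cocone I \<Sigma> q =
     \<lparr>leg = \<lambda>d\<in>Obj (Sigma2 I \<Sigma>). leg q (onObj (Sigma2_dom I) d),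
      transition = \<lambda>\<phi>\<in>One (Sigma2 I \<Sigma>). transition q (onOne (Sigma2_dom I) \<phi>)\<rparr>"

definition d1_cocone ::
  "('io, 'ia, 'ic) two_cat \<Rightarrow> ('o, 'a, 'c) two_cat \<Rightarrow> ('io, 'ia, 'ic, 'o, 'a, 'c) two_fun
    \<Rightarrow> 'ia set \<Rightarrow> ('io, 'ia, 'a, 'c) cocone \<Rightarrow> ('ia, ('ia, 'ic) square, 'a, 'c) cocone" where
  "d1_cocone I C F \<Sigma> q =
     \<lparr>leg = \<lambda>d\<in>Obj (Sigma2 I \<Sigma>). leg q (onObj (Sigma2_cod I) d) \<cdot>\<^bsub>C\<^esub> onOne F d,
      transition = \<lambda>\<phi>\<in>One (Sigma2 I \<Sigma>).
        (transition q (onOne (Sigma2_cod I) \<phi>) \<rhd>\<^bsub>C\<^esub> onOne F (sq_dom \<phi>)) \<bullet>\<^bsub>C\<^esub>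
        (leg q (onObj (Sigma2_cod I) (sq_cod \<phi>)) \<lhd>\<^bsub>C\<^esub> onTwo F (sq_cell \<phi>))\<rparr>"

definition i_cocone ::
  "('io, 'ia, 'ic) two_cat \<Rightarrow> ('ia, ('ia, 'ic) square, 'a, 'c) cocone
    \<Rightarrow> ('io, 'ia, 'a, 'c) cocone" where
  "i_cocone I r =
     \<lparr>leg = \<lambda>i\<in>Obj I. leg r (id1 I i),
      transition = \<lambda>d\<in>One I. transition r
        \<lparr>sq_dom = id1 I (dom1 I d), sq_cod = id1 I (cod1 I d),
         sq0 = d, sq1 = d, sq_cell = id2 I d\<rparr>\<rparr>"

definition p01_cocone ::
  "('io, 'ia, 'ic) two_cat \<Rightarrow> 'ia set \<Rightarrow> ('ia, 'ic) Sigma32_fun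
    \<Rightarrow> ('ia, ('ia, 'ic) square, 'a, 'c) cocone
    \<Rightarrow> (('ia, 'ic) triangle, ('ia, 'ic) tri_trans, 'a, 'c) cocone" where
  "p01_cocone I \<Sigma> p r =
     \<lparr>leg = \<lambda>T\<in>Obj (Sigma3 I \<Sigma>). leg r (onObj p T),
      transition = \<lambda>\<tau>\<in>One (Sigma3 I \<Sigma>). transition r (onOne p \<tau>)\<rparr>"

definition p2_cocone ::
  "('io, 'ia, 'ic) two_cat \<Rightarrow> ('o, 'a, 'c) two_cat \<Rightarrow> ('io, 'ia, 'ic, 'o, 'a, 'c) two_fun
    \<Rightarrow> 'ia set \<Rightarrow> ('ia, ('ia, 'ic) square, 'a, 'c) cocone
    \<Rightarrow> (('ia, 'ic) triangle, ('ia, 'ic) tri_trans, 'a, 'c) cocone" where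
  "p2_cocone I C F \<Sigma> r =
     \<lparr>leg = \<lambda>T\<in>Obj (Sigma3 I \<Sigma>). leg r (onObj Sigma3_p2 T) \<cdot>\<^bsub>C\<^esub> onOne F (onObj Sigma3_p0 T),
      transition = \<lambda>\<tau>\<in>One (Sigma3 I \<Sigma>).
        (transition r (onOne Sigma3_p2 \<tau>) \<rhd>\<^bsub>C\<^esub> onOne F (e0 (tt_dom \<tau>))) \<bullet>\<^bsub>C\<^esub>
        (leg r (e2 (tt_cod \<tau>)) \<lhd>\<^bsub>C\<^esub> onTwo F (tc0 \<tau>))\<rparr>"

text \<open>The codescent object is determined only up to the choice of the three oplax
  bicolimits and of the mediating 1-cells with their universal 2-cells, so being
  the associated codescent object is rendered as a predicate; the oplax bicolimit
  cocone \<open>q\<close> of \<open>F\<close> with tip \<open>X0 X\<close> is kept as a parameter. The 2-cells of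
  \<open>X\<close> are specified by their whiskerings with the bicolimit cocones, the universal
  invertible 2-cells \<open>\<theta> d : d_0 r_d \<cong> q_{dom d}\<close>, \<open>\<theta>' d : d_1 r_d \<cong> q_{cod d} F d\<close>,
  \<open>\<kappa> i : i q_i \<cong> r_{id_i}\<close>, \<open>\<rho>_k T : p_k s_T \<cong> ...\<close> being moved to the side
  of the equations where no inverse is needed.\<close>

definition associated_codescent ::
  "('io, 'ia, 'ic) two_cat \<Rightarrow> ('o, 'a, 'c) two_cat \<Rightarrow> ('io, 'ia, 'ic, 'o, 'a, 'c) two_fun
    \<Rightarrow> 'ia set \<Rightarrow> ('io, 'ia, 'a, 'c) cocone \<Rightarrow> ('o, 'a, 'c) codescent \<Rightarrow> bool" where
  "associated_codescent I C F \<Sigma> q X \<longleftrightarrow> codescent_object C X \<and>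
     oplax_bicolimit I C F (X0 X) q \<and>
     (\<exists>r s \<theta> \<theta>' \<kappa> \<rho>0 \<rho>1 \<rho>2.
        oplax_bicolimit (Sigma2 I \<Sigma>) C (F \<circ>\<^sub>2 Sigma2_dom I) (X1 X) r \<and>
        oplax_bicolimit (Sigma3 I \<Sigma>) C (F \<circ>\<^sub>2 Sigma2_dom I \<circ>\<^sub>2 Sigma3_p0) (X2 X) s \<and>
        mediates (Sigma2 I \<Sigma>) C (F \<circ>\<^sub>2 Sigma2_dom I) (X1 X) r
          (X0 X) (d0_cocone I \<Sigma> q) (D0 X) \<theta> \<and>
        mediates (Sigma2 I \<Sigma>) C (F \<circ>\<^sub>2 Sigma2_dom I) (X1 X) r
          (X0 X) (d1_cocone I C F \<Sigma> q) (D1 X) \<theta>' \<and>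
        mediates I C F (X0 X) q (X1 X) (i_cocone I r) (U X) \<kappa> \<and>
        mediates (Sigma3 I \<Sigma>) C (F \<circ>\<^sub>2 Sigma2_dom I \<circ>\<^sub>2 Sigma3_p0) (X2 X) s
          (X1 X) (p01_cocone I \<Sigma> Sigma3_p0 r) (P0 X) \<rho>0 \<and>
        mediates (Sigma3 I \<Sigma>) C (F \<circ>\<^sub>2 Sigma2_dom I \<circ>\<^sub>2 Sigma3_p0) (X2 X) s
          (X1 X) (p01_cocone I \<Sigma> Sigma3_p1 r) (P1 X) \<rho>1 \<and>
        mediates (Sigma3 I \<Sigma>) C (F \<circ>\<^sub>2 Sigma2_dom I \<circ>\<^sub>2 Sigma3_p0) (X2 X) s
          (X1 X) (p2_cocone I C F \<Sigma> r) (P2 X) \<rho>2 \<and>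
        (\<forall>i\<in>Obj I. N0 X \<rhd>\<^bsub>C\<^esub> leg q i = \<theta> (id1 I i) \<bullet>\<^bsub>C\<^esub> (D0 X \<lhd>\<^bsub>C\<^esub> \<kappa> i)) \<and>
        (\<forall>i\<in>Obj I. N1 X \<rhd>\<^bsub>C\<^esub> leg q i = \<theta>' (id1 I i) \<bullet>\<^bsub>C\<^esub> (D1 X \<lhd>\<^bsub>C\<^esub> \<kappa> i)) \<and>
        (\<forall>T\<in>Obj (Sigma3 I \<Sigma>).
           \<theta> (e1 T) \<bullet>\<^bsub>C\<^esub> (D0 X \<lhd>\<^bsub>C\<^esub> \<rho>1 T) \<bullet>\<^bsub>C\<^esub> (T01 X \<rhd>\<^bsub>C\<^esub> leg s T)
             = \<theta> (e0 T) \<bullet>\<^bsub>C\<^esub> (D0 X \<lhd>\<^bsub>C\<^esub> \<rho>0 T)) \<and>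
        (\<forall>T\<in>Obj (Sigma3 I \<Sigma>).
           (\<theta> (e2 T) \<rhd>\<^bsub>C\<^esub> onOne F (e0 T)) \<bullet>\<^bsub>C\<^esub> (D0 X \<lhd>\<^bsub>C\<^esub> \<rho>2 T) \<bullet>\<^bsub>C\<^esub> (T02 X \<rhd>\<^bsub>C\<^esub> leg s T)
             = \<theta>' (e0 T) \<bullet>\<^bsub>C\<^esub> (D1 X \<lhd>\<^bsub>C\<^esub> \<rho>0 T)) \<and>
        (\<forall>T\<in>Obj (Sigma3 I \<Sigma>).
           (\<theta>' (e2 T) \<rhd>\<^bsub>C\<^esub> onOne F (e0 T)) \<bullet>\<^bsub>C\<^esub> (D1 X \<lhd>\<^bsub>C\<^esub> \<rho>2 T) \<bullet>\<^bsub>C\<^esub> (T12 X \<rhd>\<^bsub>C\<^esub> leg s T)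
             = (leg q (cod1 I (e1 T)) \<lhd>\<^bsub>C\<^esub> inv2 C (onTwo F (face T)))
               \<bullet>\<^bsub>C\<^esub> \<theta>' (e1 T) \<bullet>\<^bsub>C\<^esub> (D1 X \<lhd>\<^bsub>C\<^esub> \<rho>1 T)))"

end

theory Submission
  imports Defs
begin

text \<open>A pair \<open>(h, \<xi>)\<close> with \<open>\<xi> : h d_0 \<Rightarrow> h d_1\<close> amounts to a family of 2-cells
  \<open>\<xi>_d : h q_{dom d} \<Rightarrow> h q_{cod d} F d\<close>, natural in the pseudosquares of \<open>\<Sigma>^2\<close>. The unit
  condition says \<open>\<xi>_{id} = 1\<close>, and then naturality at the squares \<open>d \<rightarrow> id_{cod d}\<close> and
  \<open>id_{dom d} \<rightarrow> d\<close> forces \<open>\<xi>_d\<close> to be inverse to \<open>h q_d\<close>. Conversely, when all \<open>h q_d\<close> with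
  \<open>d \<in> \<Sigma>\<close> are invertible, their inverses form a pseudocoequalizing pair, the cocycle condition
  being the compatibility of \<open>q\<close> with the composition of the edges and with the 2-cell of a
  triangle. So \<open>\<xi>\<close> is uniquely determined by \<open>h\<close>, every 2-cell \<open>h \<Rightarrow> h'\<close> is a morphism of pseudocoequalizing pairs, and
  these pairs form the full subcategory of \<open>C[L, B]\<close> corresponding to the \<open>\<sigma>\<close>-cocones.\<close>

section \<open>Categories and fully faithful functors\<close>

text \<open>All universal properties here hold up to isomorphism only, and this shapes two choices.
  Equivalences are handled as faithful, full and essentially surjective functors: the comparison
  with \<open>post_cocone I C q c\<close> factors strictly as whiskering with \<open>c\<close>
  followed by composition with \<open>q\<close>, so faithfulness and fullness are combined factor by
  factor, and only the lifting of a given \<sigma>-cocone has to carry isomorphisms along. Moreover,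
  D0 r_d is merely isomorphic to q_(dom d), so the family \<xi>_d of the overview is \<xi> whiskered
  with r_d and conjugated by the universal cells \<theta> and \<theta>' (\<open>component\<close>).
  Equations between 2-cells leaving X0, X1 or X2 are tested on the legs of q, r or s respectively,
  where the formulas characterizing N0, N1, T01, T02 and T12 apply; the universal cells that remain
  at the ends are invertible and get cancelled. The squares between \<open>d\<close> and identities
  are available because identities belong to \<Sigma>.\<close>

definition is_category :: "('x, 'm) cat \<Rightarrow> bool" where
  "is_category A \<longleftrightarrow>
     (\<forall>x\<in>cobj A. cid A x \<in> chom A x x) \<and>
     (\<forall>x\<in>cobj A. \<forall>y\<in>cobj A. \<forall>z\<in>cobj A. \<forall>f\<in>chom A x y. \<forall>g\<in>chom A y z.
        ccomp A g f \<in> chom A x z) \<and>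
     (\<forall>x\<in>cobj A. \<forall>y\<in>cobj A. \<forall>f\<in>chom A x y.
        ccomp A f (cid A x) = f \<and> ccomp A (cid A y) f = f) \<and>
     (\<forall>w\<in>cobj A. \<forall>x\<in>cobj A. \<forall>y\<in>cobj A. \<forall>z\<in>cobj A.
        \<forall>f\<in>chom A w x. \<forall>g\<in>chom A x y. \<forall>h\<in>chom A y z.
        ccomp A (ccomp A h g) f = ccomp A h (ccomp A g f))"

lemma is_categoryD:
  assumes "is_category A"
  shows "x \<in> cobj A \<Longrightarrow> cid A x \<in> chom A x x"
    and "\<lbrakk>f \<in> chom A x y; g \<in> chom A y z; x \<in> cobj A; y \<in> cobj A; z \<in> cobj A\<rbrakk>
      \<Longrightarrow> ccomp A g f \<in> chom A x z"
    and "\<lbrakk>f \<in> chom A x y; x \<in> cobj A; y \<in> cobj A\<rbrakk> \<Longrightarrow> ccomp A f (cid A x) = f"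
    and "\<lbrakk>f \<in> chom A x y; x \<in> cobj A; y \<in> cobj A\<rbrakk> \<Longrightarrow> ccomp A (cid A y) f = f"
    and "\<lbrakk>f \<in> chom A w x; g \<in> chom A x y; h \<in> chom A y z;
        w \<in> cobj A; x \<in> cobj A; y \<in> cobj A; z \<in> cobj A\<rbrakk>
      \<Longrightarrow> ccomp A (ccomp A h g) f = ccomp A h (ccomp A g f)"
  using assms by (simp_all add: is_category_def)

text \<open>Shrinking \<open>cobj\<close> only restricts the quantifiers in the axioms. It is needed
  for \<sigma>-cocones inside oplax cocones.\<close>

lemma is_category_full_subcategory:
  assumes "is_category A" "S \<subseteq> cobj A"
  shows "is_category (A\<lparr>cobj := S\<rparr>)"
proof -
  have "x \<in> S \<Longrightarrow> x \<in> cobj A" for x using assms(2) by blast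
  then show ?thesis using is_categoryD[OF assms(1)] by (simp add: is_category_def)
qed

lemma is_iso_left_cancel:
  assumes A: "is_category A" and i: "is_iso A y z i"
    and f: "f \<in> chom A x y" and g: "g \<in> chom A x y"
    and eq: "ccomp A i f = ccomp A i g"
    and o: "x \<in> cobj A" "y \<in> cobj A" "z \<in> cobj A"
  shows "f = g"
proof -
  obtain j where j: "j \<in> chom A z y" "ccomp A j i = cid A y" and i': "i \<in> chom A y z"
    using i unfolding is_iso_def by blast
  have "f = ccomp A (ccomp A j i) f" using A f j o by (simp add: is_categoryD)
  also have "\<dots> = ccomp A (ccomp A j i) g"
    using is_categoryD(5)[OF A f i' j(1)] is_categoryD(5)[OF A g i' j(1)] eq o by simp
  also have "\<dots> = g" using A g j o by (simp add: is_categoryD)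
  finally show ?thesis .
qed

lemma is_iso_right_cancel:
  assumes A: "is_category A" and i: "is_iso A x y i"
    and f: "f \<in> chom A y z" and g: "g \<in> chom A y z"
    and eq: "ccomp A f i = ccomp A g i"
    and o: "x \<in> cobj A" "y \<in> cobj A" "z \<in> cobj A"
  shows "f = g"
proof -
  obtain j where j: "j \<in> chom A y x" "ccomp A i j = cid A y" and i': "i \<in> chom A x y"
    using i unfolding is_iso_def by blast
  have "f = ccomp A f (ccomp A i j)" using A f j o by (simp add: is_categoryD)
  also have "\<dots> = ccomp A g (ccomp A i j)"
    using is_categoryD(5)[OF A j(1) i' f] is_categoryD(5)[OF A j(1) i' g] eq o by simp
  also have "\<dots> = g" using A g j o by (simp add: is_categoryD)
  finally show ?thesis .
qed

lemma is_iso_comp: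
  assumes A: "is_category A" and f: "is_iso A x y f" and g: "is_iso A y z g"
    and o: "x \<in> cobj A" "y \<in> cobj A" "z \<in> cobj A"
  shows "is_iso A x z (ccomp A g f)"
proof -
  obtain f' where f': "f' \<in> chom A y x" "ccomp A f' f = cid A x" "ccomp A f f' = cid A y"
    and fh: "f \<in> chom A x y" using f unfolding is_iso_def by blast
  obtain g' where g': "g' \<in> chom A z y" "ccomp A g' g = cid A y" "ccomp A g g' = cid A z"
    and gh: "g \<in> chom A y z" using g unfolding is_iso_def by blast
  have gf: "ccomp A g f \<in> chom A x z" and fg': "ccomp A f' g' \<in> chom A z x"
    using is_categoryD(2)[OF A] fh gh f'(1) g'(1) o by blast+
  have "ccomp A (ccomp A f' g') (ccomp A g f) = ccomp A f' (ccomp A (ccomp A g' g) f)"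
    using is_categoryD(5)[OF A gf g'(1) f'(1)] is_categoryD(5)[OF A fh gh g'(1)] o by simp
  then have 1: "ccomp A (ccomp A f' g') (ccomp A g f) = cid A x"
    using f' g' is_categoryD(4)[OF A fh] o by simp
  have "ccomp A (ccomp A g f) (ccomp A f' g') = ccomp A g (ccomp A (ccomp A f f') g')"
    using is_categoryD(5)[OF A fg' fh gh] is_categoryD(5)[OF A g'(1) f'(1) fh] o by simp
  then have 2: "ccomp A (ccomp A g f) (ccomp A f' g') = cid A z"
    using f' g' is_categoryD(4)[OF A g'(1)] o by simp
  show ?thesis unfolding is_iso_def using gf fg' 1 2 by blast
qed

lemma is_functorD:
  assumes "is_functor A B Fo Fa"
  shows "x \<in> cobj A \<Longrightarrow> Fo x \<in> cobj B"
    and "\<lbrakk>f \<in> chom A x y; x \<in> cobj A; y \<in> cobj A\<rbrakk> \<Longrightarrow> Fa x y f \<in> chom B (Fo x) (Fo y)"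
    and "x \<in> cobj A \<Longrightarrow> Fa x x (cid A x) = cid B (Fo x)"
    and "\<lbrakk>f \<in> chom A x y; g \<in> chom A y z; x \<in> cobj A; y \<in> cobj A; z \<in> cobj A\<rbrakk>
      \<Longrightarrow> Fa x z (ccomp A g f) = ccomp B (Fa y z g) (Fa x y f)"
  using assms by (simp_all add: is_functor_def)

lemma is_iso_functor:
  assumes "is_functor A B Fo Fa" "is_iso A x y f" "x \<in> cobj A" "y \<in> cobj A"
  shows "is_iso B (Fo x) (Fo y) (Fa x y f)"
proof -
  obtain g where g: "g \<in> chom A y x" "ccomp A g f = cid A x" "ccomp A f g = cid A y"
    and f: "f \<in> chom A x y" using assms(2) unfolding is_iso_def by blast
  have "Fa x y f \<in> chom B (Fo x) (Fo y)" "Fa y x g \<in> chom B (Fo y) (Fo x)"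
    "ccomp B (Fa y x g) (Fa x y f) = Fa x x (ccomp A g f)"
    "ccomp B (Fa x y f) (Fa y x g) = Fa y y (ccomp A f g)"
    "Fa x x (cid A x) = cid B (Fo x)" "Fa y y (cid A y) = cid B (Fo y)"
    using is_functorD[OF assms(1)] assms(3,4) f g(1) by simp_all
  then show ?thesis unfolding is_iso_def using g by auto
qed

section \<open>Equivalences versus fully faithful, essentially surjective functors\<close>

definition faithful ::
  "('x, 'm) cat \<Rightarrow> ('x \<Rightarrow> 'x \<Rightarrow> 'm \<Rightarrow> 'n) \<Rightarrow> bool" where
  "faithful A Fa \<longleftrightarrow> (\<forall>x\<in>cobj A. \<forall>y\<in>cobj A. inj_on (Fa x y) (chom A x y))"

definition full ::
  "('x, 'm) cat \<Rightarrow> ('y, 'n) cat \<Rightarrow> ('x \<Rightarrow> 'y) \<Rightarrow> ('x \<Rightarrow> 'x \<Rightarrow> 'm \<Rightarrow> 'n) \<Rightarrow> bool" where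
  "full A B Fo Fa \<longleftrightarrow>
     (\<forall>x\<in>cobj A. \<forall>y\<in>cobj A. chom B (Fo x) (Fo y) \<subseteq> Fa x y ` chom A x y)"

definition essentially_surjective ::
  "('x, 'm) cat \<Rightarrow> ('y, 'n) cat \<Rightarrow> ('x \<Rightarrow> 'y) \<Rightarrow> bool" where
  "essentially_surjective A B Fo \<longleftrightarrow> (\<forall>y\<in>cobj B. \<exists>x\<in>cobj A. \<exists>f. is_iso B (Fo x) y f)"

lemma fullE:
  assumes "full A B Fo Fa" "x \<in> cobj A" "y \<in> cobj A" "g \<in> chom B (Fo x) (Fo y)"
  obtains f where "f \<in> chom A x y" "Fa x y f = g"
  using assms unfolding full_def by blast

lemma equivalence_imp_functor: "is_equivalence A B Fo Fa \<Longrightarrow> is_functor A B Fo Fa"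
  by (simp add: is_equivalence_def)

lemma equivalence_imp_essentially_surjective:
  assumes "is_equivalence A B Fo Fa"
  shows "essentially_surjective A B Fo"
proof -
  obtain Go Ga where G: "is_functor B A Go Ga"
    and e: "\<exists>\<epsilon>. is_natural_iso B B (\<lambda>x. Fo (Go x)) (\<lambda>x y f. Fa (Go x) (Go y) (Ga x y f))
               (\<lambda>x. x) (\<lambda>x y f. f) \<epsilon>"
    using assms unfolding is_equivalence_def by blast
  show ?thesis unfolding essentially_surjective_def
  proof
    fix y assume y: "y \<in> cobj B"
    have "Go y \<in> cobj A" using G y unfolding is_functor_def by blast
    then show "\<exists>x\<in>cobj A. \<exists>f. is_iso B (Fo x) y f"
      using e y unfolding is_natural_iso_def by blast
  qed
qed

text \<open>Naturality of \<eta> expresses \<eta>_y f through the image of f under F, and the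
  isomorphism \<eta>_y cancels on the left.\<close>

lemma faithful_of_retraction:
  assumes A: "is_category A" and F: "is_functor A B Fo Fa" and G: "is_functor B A Go Ga"
    and eta: "is_natural_iso A A (\<lambda>x. x) (\<lambda>x y f. f)
               (\<lambda>x. Go (Fo x)) (\<lambda>x y f. Ga (Fo x) (Fo y) (Fa x y f)) \<eta>"
  shows "faithful A Fa"
  unfolding faithful_def
proof (intro ballI inj_onI)
  fix x y f g
  assume o: "x \<in> cobj A" "y \<in> cobj A" and fg: "f \<in> chom A x y" "g \<in> chom A x y"
    and eq: "Fa x y f = Fa x y g"
  have "Go (Fo y) \<in> cobj A" using F G o unfolding is_functor_def by blast
  moreover have "is_iso A y (Go (Fo y)) (\<eta> y)" "ccomp A (\<eta> y) f = ccomp A (\<eta> y) g"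
    using eta o fg eq unfolding is_natural_iso_def by metis+
  ultimately show "f = g" using is_iso_left_cancel[OF A _ fg] o by blast
qed

text \<open>Dual argument with the counit: f \<epsilon>_x is determined by the image of f under G,
  and \<epsilon>_x cancels on the right. Faithfulness of the quasi-inverse is the key to fullness of
  F.\<close>

lemma faithful_of_section:
  assumes B: "is_category B" and F: "is_functor A B Fo Fa" and G: "is_functor B A Go Ga"
    and eps: "is_natural_iso B B (\<lambda>x. Fo (Go x)) (\<lambda>x y f. Fa (Go x) (Go y) (Ga x y f))
               (\<lambda>x. x) (\<lambda>x y f. f) \<epsilon>"
  shows "faithful B Ga"
  unfolding faithful_def
proof (intro ballI inj_onI)
  fix x y f g
  assume o: "x \<in> cobj B" "y \<in> cobj B" and fg: "f \<in> chom B x y" "g \<in> chom B x y"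
    and eq: "Ga x y f = Ga x y g"
  have "Fo (Go x) \<in> cobj B" using F G o unfolding is_functor_def by blast
  moreover have "is_iso B (Fo (Go x)) x (\<epsilon> x)" "ccomp B f (\<epsilon> x) = ccomp B g (\<epsilon> x)"
    using eps o fg eq unfolding is_natural_iso_def by metis+
  ultimately show "f = g" using is_iso_right_cancel[OF B _ fg] o by blast
qed

lemma equivalence_imp_faithful:
  assumes "is_category A" "is_equivalence A B Fo Fa"
  shows "faithful A Fa"
proof -
  obtain Go Ga \<eta> where "is_functor A B Fo Fa" "is_functor B A Go Ga"
    "is_natural_iso A A (\<lambda>x. x) (\<lambda>x y f. f)
       (\<lambda>x. Go (Fo x)) (\<lambda>x y f. Ga (Fo x) (Fo y) (Fa x y f)) \<eta>"
    using assms(2) unfolding is_equivalence_def by blast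
  then show ?thesis by (rule faithful_of_retraction[OF assms(1)])
qed

lemma equivalence_imp_full:
  assumes A: "is_category A" and B: "is_category B" and eqv: "is_equivalence A B Fo Fa"
  shows "full A B Fo Fa"
proof -
  obtain Go Ga \<eta> \<epsilon> where F: "is_functor A B Fo Fa" and G: "is_functor B A Go Ga"
    and eta: "is_natural_iso A A (\<lambda>x. x) (\<lambda>x y f. f)
               (\<lambda>x. Go (Fo x)) (\<lambda>x y f. Ga (Fo x) (Fo y) (Fa x y f)) \<eta>"
    and eps: "is_natural_iso B B (\<lambda>x. Fo (Go x)) (\<lambda>x y f. Fa (Go x) (Go y) (Ga x y f))
               (\<lambda>x. x) (\<lambda>x y f. f) \<epsilon>"
    using eqv unfolding is_equivalence_def by blast
  have faith: "faithful B Ga" by (rule faithful_of_section[OF B F G eps])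
  show ?thesis unfolding full_def
  proof (intro ballI subsetI)
    fix x y g assume o: "x \<in> cobj A" "y \<in> cobj A" and g: "g \<in> chom B (Fo x) (Fo y)"
    have o': "Fo x \<in> cobj B" "Fo y \<in> cobj B" "Go (Fo x) \<in> cobj A" "Go (Fo y) \<in> cobj A"
      using F G o unfolding is_functor_def by blast+
    have ix: "is_iso A x (Go (Fo x)) (\<eta> x)" and iy: "is_iso A y (Go (Fo y)) (\<eta> y)"
      using eta o unfolding is_natural_iso_def by blast+
    obtain j where j: "j \<in> chom A (Go (Fo y)) y" "ccomp A (\<eta> y) j = cid A (Go (Fo y))"
      using iy unfolding is_iso_def by blast
    have ex: "\<eta> x \<in> chom A x (Go (Fo x))" and ey: "\<eta> y \<in> chom A y (Go (Fo y))"
      using ix iy unfolding is_iso_def by blast+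
    have Gg: "Ga (Fo x) (Fo y) g \<in> chom A (Go (Fo x)) (Go (Fo y))"
      using G g o' unfolding is_functor_def by blast
    \<comment> \<open>The only candidate for a preimage of g: naturality of \<eta> forces \<eta>_y f
      = G(g) \<eta>_x. It follows that G F f = G g, and faithfulness of G gives F f = g.\<close>
    define f where "f = ccomp A j (ccomp A (Ga (Fo x) (Fo y) g) (\<eta> x))"
    have Ge: "ccomp A (Ga (Fo x) (Fo y) g) (\<eta> x) \<in> chom A x (Go (Fo y))"
      using is_categoryD(2)[OF A ex Gg] o o' by blast
    have f: "f \<in> chom A x y"
      unfolding f_def using is_categoryD(2)[OF A Ge j(1)] o o' by blast
    have Ff: "Fa x y f \<in> chom B (Fo x) (Fo y)" using F f o unfolding is_functor_def by blast
    have GFf: "Ga (Fo x) (Fo y) (Fa x y f) \<in> chom A (Go (Fo x)) (Go (Fo y))"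
      using G Ff o' unfolding is_functor_def by blast
    have "ccomp A (Ga (Fo x) (Fo y) (Fa x y f)) (\<eta> x) = ccomp A (\<eta> y) f"
      using eta o f unfolding is_natural_iso_def by blast
    also have "\<dots> = ccomp A (ccomp A (\<eta> y) j) (ccomp A (Ga (Fo x) (Fo y) g) (\<eta> x))"
      unfolding f_def using is_categoryD(5)[OF A Ge j(1) ey] o o' by simp
    also have "\<dots> = ccomp A (Ga (Fo x) (Fo y) g) (\<eta> x)"
      using j(2) is_categoryD(4)[OF A Ge] o o' by simp
    finally have "Ga (Fo x) (Fo y) (Fa x y f) = Ga (Fo x) (Fo y) g"
      using is_iso_right_cancel[OF A ix GFf Gg] o o' by blast
    then have "Fa x y f = g"
      using faith o' Ff g unfolding faithful_def inj_on_def by blast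
    then show "g \<in> Fa x y ` chom A x y" using f by blast
  qed
qed

text \<open>A quasi-inverse is chosen from essential surjectivity, together with isomorphisms e_y :
  F G y -> y. No triangle identities have to be arranged, since \<open>is_equivalence\<close> asks
  only for the two natural isomorphisms.\<close>

lemma equivalenceI:
  assumes A: "is_category A" and B: "is_category B" and F: "is_functor A B Fo Fa"
    and faith: "faithful A Fa" and ful: "full A B Fo Fa"
    and es: "essentially_surjective A B Fo"
  shows "is_equivalence A B Fo Fa"
proof -
  obtain Go e where G0: "\<And>y. y \<in> cobj B \<Longrightarrow> Go y \<in> cobj A"
    and e: "\<And>y. y \<in> cobj B \<Longrightarrow> is_iso B (Fo (Go y)) y (e y)"
    using es unfolding essentially_surjective_def by metis
  have Fo: "Fo x \<in> cobj B" if "x \<in> cobj A" for x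
    using F that unfolding is_functor_def by blast
  have Fa: "Fa x y f \<in> chom B (Fo x) (Fo y)"
    if "f \<in> chom A x y" "x \<in> cobj A" "y \<in> cobj A" for x y f
    using F that unfolding is_functor_def by blast
  have Fcomp: "Fa x z (ccomp A g f) = ccomp B (Fa y z g) (Fa x y f)"
    if "f \<in> chom A x y" "g \<in> chom A y z" "x \<in> cobj A" "y \<in> cobj A" "z \<in> cobj A" for x y z f g
    using F that unfolding is_functor_def by blast
  have Fid: "Fa x x (cid A x) = cid B (Fo x)" if "x \<in> cobj A" for x
    using F that unfolding is_functor_def by blast
  have inj: "f = g" if "Fa x y f = Fa x y g" "f \<in> chom A x y" "g \<in> chom A x y"
      "x \<in> cobj A" "y \<in> cobj A" for x y f g
    using faith that unfolding faithful_def inj_on_def by blast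
  have eh: "e y \<in> chom B (Fo (Go y)) y" if "y \<in> cobj B" for y
    using e[OF that] unfolding is_iso_def by blast
  have lift: "\<exists>f\<in>chom A (Go y) (Go z). ccomp B (e z) (Fa (Go y) (Go z) f) = ccomp B g (e y)"
    if g: "g \<in> chom B y z" and o: "y \<in> cobj B" "z \<in> cobj B" for y z g
  proof -
    have oF: "Fo (Go y) \<in> cobj B" "Fo (Go z) \<in> cobj B" using G0 o Fo by blast+
    obtain j where j: "j \<in> chom B z (Fo (Go z))" "ccomp B (e z) j = cid B z"
      using e[OF o(2)] unfolding is_iso_def by blast
    have ge: "ccomp B g (e y) \<in> chom B (Fo (Go y)) z"
      using is_categoryD(2)[OF B eh[OF o(1)] g] o oF by blast
    then have "ccomp B j (ccomp B g (e y)) \<in> chom B (Fo (Go y)) (Fo (Go z))"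
      using is_categoryD(2)[OF B ge j(1)] o oF by blast
    then obtain f where f: "f \<in> chom A (Go y) (Go z)"
      and eq: "Fa (Go y) (Go z) f = ccomp B j (ccomp B g (e y))"
      using fullE[OF ful G0[OF o(1)] G0[OF o(2)]] by metis
    have "ccomp B (e z) (Fa (Go y) (Go z) f) = ccomp B (ccomp B (e z) j) (ccomp B g (e y))"
      unfolding eq using is_categoryD(5)[OF B ge j(1) eh[OF o(2)]] o oF by simp
    also have "\<dots> = ccomp B g (e y)" using j(2) is_categoryD(4)[OF B ge] o oF by simp
    finally show ?thesis using f by blast
  qed
  \<comment> \<open>The defining equation is the naturality square of \<open>e\<close>, so
    \<open>e\<close> will be the counit. Cancelling \<open>e z\<close> and using faithfulness, it
    has a unique solution, and this uniqueness yields functoriality of G.\<close>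
  define Ga where "Ga y z g = (SOME f. f \<in> chom A (Go y) (Go z) \<and>
      ccomp B (e z) (Fa (Go y) (Go z) f) = ccomp B g (e y))" for y z g
  have Ga: "Ga y z g \<in> chom A (Go y) (Go z)"
    and Ga_eq: "ccomp B (e z) (Fa (Go y) (Go z) (Ga y z g)) = ccomp B g (e y)"
    if "g \<in> chom B y z" "y \<in> cobj B" "z \<in> cobj B" for y z g
    using lift[OF that] someI_ex[of "\<lambda>f. f \<in> chom A (Go y) (Go z) \<and>
      ccomp B (e z) (Fa (Go y) (Go z) f) = ccomp B g (e y)"]
    unfolding Ga_def by blast+
  have Ga_unique: "f = Ga y z g"
    if f: "f \<in> chom A (Go y) (Go z)" and g: "g \<in> chom B y z" and o: "y \<in> cobj B" "z \<in> cobj B"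
      and eq: "ccomp B (e z) (Fa (Go y) (Go z) f) = ccomp B g (e y)" for y z f g
    using is_iso_left_cancel[OF B e[OF o(2)] Fa[OF f] Fa[OF Ga[OF g o]]] eq Ga_eq[OF g o]
      inj[OF _ f Ga[OF g o]] G0 o Fo by simp
  have Gid: "Ga y y (cid B y) = cid A (Go y)" if o: "y \<in> cobj B" for y
  proof (rule Ga_unique[symmetric])
    show "ccomp B (e y) (Fa (Go y) (Go y) (cid A (Go y))) = ccomp B (cid B y) (e y)"
      using is_categoryD(3,4)[OF B eh[OF o]] Fid o G0 Fo by simp
  qed (use is_categoryD(1)[OF A] is_categoryD(1)[OF B] o G0 in blast)+
  have Gcomp: "Ga x z (ccomp B g f) = ccomp A (Ga y z g) (Ga x y f)"
    if f: "f \<in> chom B x y" and g: "g \<in> chom B y z"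
      and o: "x \<in> cobj B" "y \<in> cobj B" "z \<in> cobj B" for x y z f g
  proof (rule Ga_unique[symmetric])
    note h = Ga[OF f o(1,2)] Ga[OF g o(2,3)]
    note Fh = Fa[OF h(1) G0[OF o(1)] G0[OF o(2)]] Fa[OF h(2) G0[OF o(2)] G0[OF o(3)]]
    note oG = G0[OF o(1)] G0[OF o(2)] G0[OF o(3)]
    note oF = Fo[OF oG(1)] Fo[OF oG(2)] Fo[OF oG(3)]
    show "ccomp A (Ga y z g) (Ga x y f) \<in> chom A (Go x) (Go z)"
      using is_categoryD(2)[OF A h oG] .
    show "ccomp B g f \<in> chom B x z" using is_categoryD(2)[OF B f g o] .
    have "ccomp B (e z) (Fa (Go x) (Go z) (ccomp A (Ga y z g) (Ga x y f)))
        = ccomp B (ccomp B (e z) (Fa (Go y) (Go z) (Ga y z g))) (Fa (Go x) (Go y) (Ga x y f))"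
      using Fcomp[OF h oG] is_categoryD(5)[OF B Fh eh[OF o(3)]] oF o by simp
    also have "\<dots> = ccomp B g (ccomp B (e y) (Fa (Go x) (Go y) (Ga x y f)))"
      using Ga_eq[OF g o(2,3)] is_categoryD(5)[OF B Fh(1) eh[OF o(2)] g] oF o by simp
    also have "\<dots> = ccomp B (ccomp B g f) (e x)"
      using Ga_eq[OF f o(1,2)] is_categoryD(5)[OF B eh[OF o(1)] f g] oF o by simp
    finally show "ccomp B (e z) (Fa (Go x) (Go z) (ccomp A (Ga y z g) (Ga x y f)))
        = ccomp B (ccomp B g f) (e x)" .
  qed (use o in blast)+
  have G: "is_functor B A Go Ga"
    unfolding is_functor_def using G0 Ga Gid Gcomp by blast
  have eps: "is_natural_iso B B (\<lambda>x. Fo (Go x)) (\<lambda>x y f. Fa (Go x) (Go y) (Ga x y f))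
               (\<lambda>x. x) (\<lambda>x y f. f) e"
    unfolding is_natural_iso_def using e Ga_eq by simp
  \<comment> \<open>The unit at x is the preimage under F of the inverse of e_(F x). Its inverse is
    a preimage of e_(F x) itself; the two composites are identities because F is faithful.\<close>
  have "\<exists>n. is_iso A x (Go (Fo x)) n \<and>
      ccomp B (e (Fo x)) (Fa x (Go (Fo x)) n) = cid B (Fo x)" if o: "x \<in> cobj A" for x
  proof -
    note oG = G0[OF Fo[OF o]]
    obtain j where j: "j \<in> chom B (Fo x) (Fo (Go (Fo x)))"
      "ccomp B (e (Fo x)) j = cid B (Fo x)" "ccomp B j (e (Fo x)) = cid B (Fo (Go (Fo x)))"
      using e[OF Fo[OF o]] unfolding is_iso_def by blast
    obtain n where n: "n \<in> chom A x (Go (Fo x))" "Fa x (Go (Fo x)) n = j"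
      using fullE[OF ful o oG j(1)] by blast
    obtain k where k: "k \<in> chom A (Go (Fo x)) x" "Fa (Go (Fo x)) x k = e (Fo x)"
      using fullE[OF ful oG o eh[OF Fo[OF o]]] by blast
    have "ccomp A k n = cid A x"
      by (rule inj[OF _ is_categoryD(2)[OF A n(1) k(1)] is_categoryD(1)[OF A]])
        (use o oG Fcomp[OF n(1) k(1)] n k j Fid in auto)
    moreover have "ccomp A n k = cid A (Go (Fo x))"
      by (rule inj[OF _ is_categoryD(2)[OF A k(1) n(1)] is_categoryD(1)[OF A]])
        (use o oG Fcomp[OF k(1) n(1)] n k j Fid in auto)
    ultimately show ?thesis using n k j unfolding is_iso_def by blast
  qed
  then obtain n where n: "\<And>x. x \<in> cobj A \<Longrightarrow> is_iso A x (Go (Fo x)) (n x)"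
    and en: "\<And>x. x \<in> cobj A \<Longrightarrow> ccomp B (e (Fo x)) (Fa x (Go (Fo x)) (n x)) = cid B (Fo x)"
    by metis
  have nh: "n x \<in> chom A x (Go (Fo x))" if "x \<in> cobj A" for x
    using n[OF that] unfolding is_iso_def by blast
  \<comment> \<open>Naturality of the unit is checked after applying F and composing with e_(F y):
    both sides become F f, and both operations can be undone.\<close>
  have "ccomp A (Ga (Fo x) (Fo y) (Fa x y f)) (n x) = ccomp A (n y) f"
    if f: "f \<in> chom A x y" and o: "x \<in> cobj A" "y \<in> cobj A" for x y f
  proof -
    note oF = Fo[OF o(1)] Fo[OF o(2)]
    note oG = G0[OF oF(1)] G0[OF oF(2)]
    note Ff = Fa[OF f o]
    note GF = Ga[OF Ff oF]
    note ey = eh[OF oF(2)] and ex = eh[OF oF(1)]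
    note nx = nh[OF o(1)] and ny = nh[OF o(2)]
    have l: "ccomp A (Ga (Fo x) (Fo y) (Fa x y f)) (n x) \<in> chom A x (Go (Fo y))"
      using is_categoryD(2)[OF A nx GF] o oG by blast
    have r: "ccomp A (n y) f \<in> chom A x (Go (Fo y))"
      using is_categoryD(2)[OF A f ny] o oG by blast
    have "ccomp B (e (Fo y)) (Fa x (Go (Fo y)) (ccomp A (Ga (Fo x) (Fo y) (Fa x y f)) (n x)))
        = ccomp B (ccomp B (Fa x y f) (e (Fo x))) (Fa x (Go (Fo x)) (n x))"
      using Fcomp[OF nx GF] Ga_eq[OF Ff oF] o oG oF Fo[OF oG(1)] Fo[OF oG(2)]
        is_categoryD(5)[OF B Fa[OF nx] Fa[OF GF] ey] by simp
    also have "\<dots> = Fa x y f"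
      using is_categoryD(5)[OF B Fa[OF nx] ex Ff] en[OF o(1)] is_categoryD(3)[OF B Ff]
        o oF oG Fo[OF oG(1)] by simp
    also have "\<dots> = ccomp B (e (Fo y)) (Fa x (Go (Fo y)) (ccomp A (n y) f))"
      using Fcomp[OF f ny] is_categoryD(5)[OF B Ff Fa[OF ny] ey] en[OF o(2)]
        is_categoryD(4)[OF B Ff] o oF oG Fo[OF oG(2)] by simp
    finally have "Fa x (Go (Fo y)) (ccomp A (Ga (Fo x) (Fo y) (Fa x y f)) (n x))
        = Fa x (Go (Fo y)) (ccomp A (n y) f)"
      using is_iso_left_cancel[OF B e[OF oF(2)] Fa[OF l] Fa[OF r]] o oG oF Fo[OF oG(2)] by blast
    then show ?thesis using inj[OF _ l r] o oG by blast
  qed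
  then have eta: "is_natural_iso A A (\<lambda>x. x) (\<lambda>x y f. f)
               (\<lambda>x. Go (Fo x)) (\<lambda>x y f. Ga (Fo x) (Fo y) (Fa x y f)) n"
    unfolding is_natural_iso_def using n by blast
  show ?thesis unfolding is_equivalence_def using F G eta eps by blast
qed

section \<open>Calculus of 2-cells\<close>

lemma hom1_iff: "f \<in> hom1 K X Y \<longleftrightarrow> f \<in> One K \<and> dom1 K f = X \<and> cod1 K f = Y"
  by (simp add: hom1_def)

lemma hom2_iff: "\<alpha> \<in> hom2 K f g \<longleftrightarrow> \<alpha> \<in> Two K \<and> dom2 K \<alpha> = f \<and> cod2 K \<alpha> = g"
  by (simp add: hom2_def)

locale strict_two_category =
  fixes K :: "('o, 'a, 'c) two_cat" (structure)
  assumes two_cat: "two_category K"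
begin

lemma dom1_in_Obj [simp]: "f \<in> One K \<Longrightarrow> dom1 K f \<in> Obj K"
  and cod1_in_Obj [simp]: "f \<in> One K \<Longrightarrow> cod1 K f \<in> Obj K"
  using two_cat by (simp_all add: two_category_def)

lemma id1_simps [simp]:
  assumes "X \<in> Obj K"
  shows "id1 K X \<in> One K" "dom1 K (id1 K X) = X" "cod1 K (id1 K X) = X"
proof -
  have "id1 K X \<in> hom1 K X X" using assms two_cat by (simp add: two_category_def)
  then show "id1 K X \<in> One K" "dom1 K (id1 K X) = X" "cod1 K (id1 K X) = X"
    by (simp_all add: hom1_iff)
qed

lemma comp1_simps [simp]:
  assumes "f \<in> One K" "g \<in> One K" "dom1 K g = cod1 K f"
  shows "g \<cdot> f \<in> One K" "dom1 K (g \<cdot> f) = dom1 K f" "cod1 K (g \<cdot> f) = cod1 K g"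
proof -
  have "g \<cdot> f \<in> hom1 K (dom1 K f) (cod1 K g)"
    using assms two_cat by (simp add: two_category_def)
  then show "g \<cdot> f \<in> One K" "dom1 K (g \<cdot> f) = dom1 K f" "cod1 K (g \<cdot> f) = cod1 K g"
    by (simp_all add: hom1_iff)
qed

lemma comp1_id [simp]: "\<lbrakk>f \<in> One K; dom1 K f = X\<rbrakk> \<Longrightarrow> f \<cdot> id1 K X = f"
  and id_comp1 [simp]: "\<lbrakk>f \<in> One K; cod1 K f = X\<rbrakk> \<Longrightarrow> id1 K X \<cdot> f = f"
  using two_cat by (auto simp: two_category_def)

lemma comp1_assoc [simp]:
  "\<lbrakk>f \<in> One K; g \<in> One K; h \<in> One K; dom1 K g = cod1 K f; dom1 K h = cod1 K g\<rbrakk>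
    \<Longrightarrow> (h \<cdot> g) \<cdot> f = h \<cdot> (g \<cdot> f)"
  using two_cat by (simp add: two_category_def)

lemma Two_simps [simp]:
  assumes "\<alpha> \<in> Two K"
  shows "dom2 K \<alpha> \<in> One K" "cod2 K \<alpha> \<in> One K"
    "dom1 K (cod2 K \<alpha>) = dom1 K (dom2 K \<alpha>)" "cod1 K (cod2 K \<alpha>) = cod1 K (dom2 K \<alpha>)"
  using assms two_cat by (simp_all add: two_category_def)

lemma hom2_parallel:
  assumes "\<alpha> \<in> hom2 K f g"
  shows "f \<in> One K" "g \<in> One K" "dom1 K g = dom1 K f" "cod1 K g = cod1 K f"
  using assms Two_simps[of \<alpha>] by (auto simp: hom2_iff simp del: Two_simps)

lemma id2_simps [simp]:
  assumes "f \<in> One K"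
  shows "id2 K f \<in> Two K" "dom2 K (id2 K f) = f" "cod2 K (id2 K f) = f"
proof -
  have "id2 K f \<in> hom2 K f f" using assms two_cat by (simp add: two_category_def)
  then show "id2 K f \<in> Two K" "dom2 K (id2 K f) = f" "cod2 K (id2 K f) = f"
    by (simp_all add: hom2_iff)
qed

lemma vcomp_simps [simp]:
  assumes "\<alpha> \<in> Two K" "\<beta> \<in> Two K" "dom2 K \<beta> = cod2 K \<alpha>"
  shows "\<beta> \<bullet> \<alpha> \<in> Two K" "dom2 K (\<beta> \<bullet> \<alpha>) = dom2 K \<alpha>" "cod2 K (\<beta> \<bullet> \<alpha>) = cod2 K \<beta>"
proof -
  have "\<beta> \<bullet> \<alpha> \<in> hom2 K (dom2 K \<alpha>) (cod2 K \<beta>)"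
    using assms two_cat by (simp add: two_category_def)
  then show "\<beta> \<bullet> \<alpha> \<in> Two K" "dom2 K (\<beta> \<bullet> \<alpha>) = dom2 K \<alpha>" "cod2 K (\<beta> \<bullet> \<alpha>) = cod2 K \<beta>"
    by (simp_all add: hom2_iff)
qed

lemma vcomp_id [simp]: "\<lbrakk>\<alpha> \<in> Two K; dom2 K \<alpha> = f\<rbrakk> \<Longrightarrow> \<alpha> \<bullet> id2 K f = \<alpha>"
  and id_vcomp [simp]: "\<lbrakk>\<alpha> \<in> Two K; cod2 K \<alpha> = f\<rbrakk> \<Longrightarrow> id2 K f \<bullet> \<alpha> = \<alpha>"
  using two_cat by (auto simp: two_category_def)

lemma vcomp_assoc [simp]:
  "\<lbrakk>\<alpha> \<in> Two K; \<beta> \<in> Two K; \<gamma> \<in> Two K; dom2 K \<beta> = cod2 K \<alpha>; dom2 K \<gamma> = cod2 K \<beta>\<rbrakk>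
    \<Longrightarrow> (\<gamma> \<bullet> \<beta>) \<bullet> \<alpha> = \<gamma> \<bullet> (\<beta> \<bullet> \<alpha>)"
  using two_cat by (simp add: two_category_def)

lemma hcomp_simps:
  assumes "\<alpha> \<in> Two K" "\<beta> \<in> Two K" "dom1 K (dom2 K \<beta>) = cod1 K (dom2 K \<alpha>)"
  shows "\<beta> \<star> \<alpha> \<in> Two K" "dom2 K (\<beta> \<star> \<alpha>) = dom2 K \<beta> \<cdot> dom2 K \<alpha>"
    "cod2 K (\<beta> \<star> \<alpha>) = cod2 K \<beta> \<cdot> cod2 K \<alpha>"
proof -
  have "\<beta> \<star> \<alpha> \<in> hom2 K (dom2 K \<beta> \<cdot> dom2 K \<alpha>) (cod2 K \<beta> \<cdot> cod2 K \<alpha>)"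
    using assms two_cat by (simp add: two_category_def)
  then show "\<beta> \<star> \<alpha> \<in> Two K" "dom2 K (\<beta> \<star> \<alpha>) = dom2 K \<beta> \<cdot> dom2 K \<alpha>"
    "cod2 K (\<beta> \<star> \<alpha>) = cod2 K \<beta> \<cdot> cod2 K \<alpha>"
    by (simp_all add: hom2_iff)
qed

lemma hcomp_assoc:
  "\<lbrakk>\<alpha> \<in> Two K; \<beta> \<in> Two K; \<gamma> \<in> Two K; dom1 K (dom2 K \<beta>) = cod1 K (dom2 K \<alpha>);
    dom1 K (dom2 K \<gamma>) = cod1 K (dom2 K \<beta>)\<rbrakk> \<Longrightarrow> (\<gamma> \<star> \<beta>) \<star> \<alpha> = \<gamma> \<star> (\<beta> \<star> \<alpha>)"
  using two_cat by (simp add: two_category_def)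

lemma hcomp_id2:
  "\<lbrakk>f \<in> One K; g \<in> One K; dom1 K g = cod1 K f\<rbrakk> \<Longrightarrow> id2 K g \<star> id2 K f = id2 K (g \<cdot> f)"
  using two_cat by (simp add: two_category_def)

lemma interchange:
  "\<lbrakk>\<alpha> \<in> Two K; \<alpha>' \<in> Two K; \<beta> \<in> Two K; \<beta>' \<in> Two K; dom2 K \<alpha>' = cod2 K \<alpha>;
    dom2 K \<beta>' = cod2 K \<beta>; dom1 K (dom2 K \<beta>) = cod1 K (dom2 K \<alpha>)\<rbrakk>
    \<Longrightarrow> (\<beta>' \<bullet> \<beta>) \<star> (\<alpha>' \<bullet> \<alpha>) = (\<beta>' \<star> \<alpha>') \<bullet> (\<beta> \<star> \<alpha>)"
  using two_cat by (simp add: two_category_def)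

lemma lwhisker_simps [simp]:
  assumes "g \<in> One K" "\<alpha> \<in> Two K" "dom1 K g = cod1 K (dom2 K \<alpha>)"
  shows "g \<lhd> \<alpha> \<in> Two K" "dom2 K (g \<lhd> \<alpha>) = g \<cdot> dom2 K \<alpha>" "cod2 K (g \<lhd> \<alpha>) = g \<cdot> cod2 K \<alpha>"
  using assms hcomp_simps[of \<alpha> "id2 K g"] by (simp_all add: lwhisker_def)

lemma rwhisker_simps [simp]:
  assumes "f \<in> One K" "\<alpha> \<in> Two K" "dom1 K (dom2 K \<alpha>) = cod1 K f"
  shows "\<alpha> \<rhd> f \<in> Two K" "dom2 K (\<alpha> \<rhd> f) = dom2 K \<alpha> \<cdot> f" "cod2 K (\<alpha> \<rhd> f) = cod2 K \<alpha> \<cdot> f"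
  using assms hcomp_simps[of "id2 K f" \<alpha>] by (simp_all add: rwhisker_def)

text \<open>The simp rules for whiskering fix a normal form: whiskers are distributed over vertical
  composites, split along composite 1-cells, and left whiskers stand outside right ones. Together
  with right-nested composition this settles every rearrangement except interchange.\<close>

lemma lwhisker_vcomp [simp]:
  "\<lbrakk>g \<in> One K; \<alpha> \<in> Two K; \<beta> \<in> Two K; dom2 K \<beta> = cod2 K \<alpha>; dom1 K g = cod1 K (dom2 K \<alpha>)\<rbrakk>
    \<Longrightarrow> g \<lhd> (\<beta> \<bullet> \<alpha>) = (g \<lhd> \<beta>) \<bullet> (g \<lhd> \<alpha>)"
  using interchange[of \<alpha> \<beta> "id2 K g" "id2 K g"] by (simp add: lwhisker_def)

lemma rwhisker_vcomp [simp]: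
  "\<lbrakk>f \<in> One K; \<alpha> \<in> Two K; \<beta> \<in> Two K; dom2 K \<beta> = cod2 K \<alpha>; dom1 K (dom2 K \<alpha>) = cod1 K f\<rbrakk>
    \<Longrightarrow> (\<beta> \<bullet> \<alpha>) \<rhd> f = (\<beta> \<rhd> f) \<bullet> (\<alpha> \<rhd> f)"
  using interchange[of "id2 K f" "id2 K f" \<alpha> \<beta>] by (simp add: rwhisker_def)

lemma lwhisker_id2 [simp]:
  "\<lbrakk>f \<in> One K; g \<in> One K; dom1 K g = cod1 K f\<rbrakk> \<Longrightarrow> g \<lhd> id2 K f = id2 K (g \<cdot> f)"
  by (simp add: lwhisker_def hcomp_id2)

lemma rwhisker_id2 [simp]:
  "\<lbrakk>f \<in> One K; g \<in> One K; dom1 K g = cod1 K f\<rbrakk> \<Longrightarrow> id2 K g \<rhd> f = id2 K (g \<cdot> f)"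
  by (simp add: rwhisker_def hcomp_id2)

lemma id1_lwhisker [simp]: "\<lbrakk>\<alpha> \<in> Two K; cod1 K (dom2 K \<alpha>) = X\<rbrakk> \<Longrightarrow> id1 K X \<lhd> \<alpha> = \<alpha>"
  and rwhisker_id1 [simp]: "\<lbrakk>\<alpha> \<in> Two K; dom1 K (dom2 K \<alpha>) = X\<rbrakk> \<Longrightarrow> \<alpha> \<rhd> id1 K X = \<alpha>"
  using two_cat by (auto simp: two_category_def lwhisker_def rwhisker_def)

lemma comp1_lwhisker [simp]:
  "\<lbrakk>g \<in> One K; h \<in> One K; \<alpha> \<in> Two K; dom1 K g = cod1 K (dom2 K \<alpha>); dom1 K h = cod1 K g\<rbrakk>
    \<Longrightarrow> (h \<cdot> g) \<lhd> \<alpha> = h \<lhd> g \<lhd> \<alpha>"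
  using hcomp_assoc[of \<alpha> "id2 K g" "id2 K h"] by (simp add: lwhisker_def hcomp_id2)

lemma rwhisker_comp1 [simp]:
  "\<lbrakk>f \<in> One K; g \<in> One K; \<alpha> \<in> Two K; dom1 K g = cod1 K f; dom1 K (dom2 K \<alpha>) = cod1 K g\<rbrakk>
    \<Longrightarrow> \<alpha> \<rhd> (g \<cdot> f) = \<alpha> \<rhd> g \<rhd> f"
  using hcomp_assoc[of "id2 K f" "id2 K g" \<alpha>] by (simp add: rwhisker_def hcomp_id2)

lemma lwhisker_rwhisker [simp]:
  "\<lbrakk>f \<in> One K; g \<in> One K; \<alpha> \<in> Two K; dom1 K g = cod1 K (dom2 K \<alpha>);
    dom1 K (dom2 K \<alpha>) = cod1 K f\<rbrakk> \<Longrightarrow> (g \<lhd> \<alpha>) \<rhd> f = g \<lhd> (\<alpha> \<rhd> f)"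
  using hcomp_assoc[of "id2 K f" \<alpha> "id2 K g"] by (simp add: lwhisker_def rwhisker_def)

text \<open>Both sides are the horizontal composite of \<beta> and \<alpha>, by interchange with
  identities inserted on one side or the other. Neither side is preferable as a normal form, so this
  law is instantiated by hand wherever a 2-cell moves across another.\<close>

lemma whisker_exchange:
  assumes "\<alpha> \<in> hom2 K f f'" "\<beta> \<in> hom2 K g g'" "dom1 K g = cod1 K f"
  shows "(\<beta> \<rhd> f') \<bullet> (g \<lhd> \<alpha>) = (g' \<lhd> \<alpha>) \<bullet> (\<beta> \<rhd> f)"
proof -
  note p = hom2_parallel[OF assms(1)] hom2_parallel[OF assms(2)]
  have "(\<beta> \<rhd> f') \<bullet> (g \<lhd> \<alpha>) = \<beta> \<star> \<alpha>"
    using interchange[of \<alpha> "id2 K f'" "id2 K g" \<beta>] assms p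
    by (simp add: rwhisker_def lwhisker_def hom2_iff)
  also have "\<dots> = (g' \<lhd> \<alpha>) \<bullet> (\<beta> \<rhd> f)"
    using interchange[of "id2 K f" \<alpha> \<beta> "id2 K g'"] assms p
    by (simp add: rwhisker_def lwhisker_def hom2_iff)
  finally show ?thesis .
qed

section \<open>Invertible 2-cells and cancellation\<close>

lemma inverse2_sym: "\<lbrakk>\<alpha> \<in> Two K; inverse2 K \<alpha> \<beta>\<rbrakk> \<Longrightarrow> inverse2 K \<beta> \<alpha>"
  by (simp add: inverse2_def hom2_iff)

text \<open>Besides justifying the description in \<open>inv2\<close>, this proves identities later
  on: the cocycle condition arises by comparing two inverses of one and the same 2-cell.\<close>

lemma inverse2_unique:
  assumes "\<alpha> \<in> Two K" "inverse2 K \<alpha> \<beta>" "inverse2 K \<alpha> \<gamma>"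
  shows "\<beta> = \<gamma>"
proof -
  have "\<gamma> = \<gamma> \<bullet> (\<alpha> \<bullet> \<beta>)" using assms by (auto simp: inverse2_def hom2_iff)
  also have "\<dots> = (\<gamma> \<bullet> \<alpha>) \<bullet> \<beta>"
    using assms by (intro vcomp_assoc[symmetric]) (auto simp: inverse2_def hom2_iff)
  also have "\<dots> = \<beta>" using assms by (auto simp: inverse2_def hom2_iff)
  finally show ?thesis by simp
qed

lemma inverse2_imp_invertible2: "\<lbrakk>\<alpha> \<in> Two K; inverse2 K \<alpha> \<beta>\<rbrakk> \<Longrightarrow> invertible2 K \<alpha>"
  by (auto simp: invertible2_def)

lemma inverse2_inv2:
  assumes "invertible2 K \<alpha>"
  shows "inverse2 K \<alpha> (inv2 K \<alpha>)"
proof -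
  obtain \<beta> where "\<alpha> \<in> Two K" "inverse2 K \<alpha> \<beta>" using assms unfolding invertible2_def by blast
  then show ?thesis unfolding inv2_def
    by (intro theI[of "inverse2 K \<alpha>"] inverse2_unique)
qed

lemma inv2_simps [simp]:
  assumes "invertible2 K \<alpha>"
  shows "inv2 K \<alpha> \<in> Two K" "dom2 K (inv2 K \<alpha>) = cod2 K \<alpha>" "cod2 K (inv2 K \<alpha>) = dom2 K \<alpha>"
    "inv2 K \<alpha> \<bullet> \<alpha> = id2 K (dom2 K \<alpha>)" "\<alpha> \<bullet> inv2 K \<alpha> = id2 K (cod2 K \<alpha>)"
  using inverse2_inv2[OF assms] by (auto simp: inverse2_def hom2_iff)

lemma invertible2_in_Two: "invertible2 K \<alpha> \<Longrightarrow> \<alpha> \<in> Two K"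
  by (simp add: invertible2_def)

lemma invertible2_inv2: "invertible2 K \<alpha> \<Longrightarrow> invertible2 K (inv2 K \<alpha>)"
  by (rule inverse2_imp_invertible2[OF _ inverse2_sym[OF _ inverse2_inv2]])
    (auto simp: invertible2_in_Two)

text \<open>Whiskering is functorial on hom-categories. The distribution law is needed against its
  simp orientation here, hence its removal from the simpset.\<close>

lemma inverse2_lwhisker:
  assumes "\<alpha> \<in> Two K" "inverse2 K \<alpha> \<beta>" "g \<in> One K" "dom1 K g = cod1 K (dom2 K \<alpha>)"
  shows "inverse2 K (g \<lhd> \<alpha>) (g \<lhd> \<beta>)"
  using assms lwhisker_vcomp[of g \<alpha> \<beta>] lwhisker_vcomp[of g \<beta> \<alpha>]
  by (simp add: inverse2_def hom2_iff del: lwhisker_vcomp)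

lemma inverse2_rwhisker:
  assumes "\<alpha> \<in> Two K" "inverse2 K \<alpha> \<beta>" "f \<in> One K" "dom1 K (dom2 K \<alpha>) = cod1 K f"
  shows "inverse2 K (\<alpha> \<rhd> f) (\<beta> \<rhd> f)"
  using assms rwhisker_vcomp[of f \<alpha> \<beta>] rwhisker_vcomp[of f \<beta> \<alpha>]
  by (simp add: inverse2_def hom2_iff del: rwhisker_vcomp)

lemma inverse2_vcomp:
  assumes "\<alpha> \<in> Two K" "inverse2 K \<alpha> \<alpha>'" "\<beta> \<in> Two K" "inverse2 K \<beta> \<beta>'" "dom2 K \<beta> = cod2 K \<alpha>"
  shows "inverse2 K (\<beta> \<bullet> \<alpha>) (\<alpha>' \<bullet> \<beta>')"
proof -
  have t: "\<alpha>' \<in> Two K" "\<beta>' \<in> Two K" "dom2 K \<alpha>' = cod2 K \<alpha>" "cod2 K \<alpha>' = dom2 K \<alpha>"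
    "dom2 K \<beta>' = cod2 K \<beta>" "cod2 K \<beta>' = dom2 K \<beta>"
    and e: "\<alpha>' \<bullet> \<alpha> = id2 K (dom2 K \<alpha>)" "\<alpha> \<bullet> \<alpha>' = id2 K (cod2 K \<alpha>)"
      "\<beta>' \<bullet> \<beta> = id2 K (dom2 K \<beta>)" "\<beta> \<bullet> \<beta>' = id2 K (cod2 K \<beta>)"
    using assms by (auto simp: inverse2_def hom2_iff)
  have "(\<alpha>' \<bullet> \<beta>') \<bullet> (\<beta> \<bullet> \<alpha>) = \<alpha>' \<bullet> (\<beta>' \<bullet> \<beta>) \<bullet> \<alpha>" using assms t by simp
  moreover have "(\<beta> \<bullet> \<alpha>) \<bullet> (\<alpha>' \<bullet> \<beta>') = \<beta> \<bullet> (\<alpha> \<bullet> \<alpha>') \<bullet> \<beta>'" using assms t by simp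
  ultimately show ?thesis using assms t e by (simp add: inverse2_def hom2_iff del: vcomp_assoc)
qed

lemma invertible2_lwhisker:
  "\<lbrakk>invertible2 K \<alpha>; g \<in> One K; dom1 K g = cod1 K (dom2 K \<alpha>)\<rbrakk> \<Longrightarrow> invertible2 K (g \<lhd> \<alpha>)"
  unfolding invertible2_def using inverse2_lwhisker by auto

lemma invertible2_rwhisker:
  "\<lbrakk>invertible2 K \<alpha>; f \<in> One K; dom1 K (dom2 K \<alpha>) = cod1 K f\<rbrakk> \<Longrightarrow> invertible2 K (\<alpha> \<rhd> f)"
  unfolding invertible2_def using inverse2_rwhisker by auto

lemma invertible2_vcomp:
  "\<lbrakk>invertible2 K \<alpha>; invertible2 K \<beta>; dom2 K \<beta> = cod2 K \<alpha>\<rbrakk> \<Longrightarrow> invertible2 K (\<beta> \<bullet> \<alpha>)"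
  by (rule inverse2_imp_invertible2[OF _ inverse2_vcomp[OF _ inverse2_inv2 _ inverse2_inv2]])
    (auto simp: invertible2_in_Two)

lemma vcomp_left_cancel:
  assumes "invertible2 K \<gamma>" "\<alpha> \<in> Two K" "\<beta> \<in> Two K" "cod2 K \<alpha> = dom2 K \<gamma>" "cod2 K \<beta> = dom2 K \<gamma>"
    "\<gamma> \<bullet> \<alpha> = \<gamma> \<bullet> \<beta>"
  shows "\<alpha> = \<beta>"
proof -
  note i = invertible2_in_Two[OF assms(1)]
  have "\<alpha> = (inv2 K \<gamma> \<bullet> \<gamma>) \<bullet> \<alpha>" using assms i by (simp del: vcomp_assoc)
  also have "\<dots> = (inv2 K \<gamma> \<bullet> \<gamma>) \<bullet> \<beta>"
    using assms i vcomp_assoc[of \<alpha> \<gamma> "inv2 K \<gamma>"] vcomp_assoc[of \<beta> \<gamma> "inv2 K \<gamma>"]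
    by (simp del: vcomp_assoc)
  also have "\<dots> = \<beta>" using assms i by (simp del: vcomp_assoc)
  finally show ?thesis .
qed

lemma vcomp_right_cancel:
  assumes "invertible2 K \<gamma>" "\<alpha> \<in> Two K" "\<beta> \<in> Two K" "dom2 K \<alpha> = cod2 K \<gamma>" "dom2 K \<beta> = cod2 K \<gamma>"
    "\<alpha> \<bullet> \<gamma> = \<beta> \<bullet> \<gamma>"
  shows "\<alpha> = \<beta>"
proof -
  note i = invertible2_in_Two[OF assms(1)]
  have "\<alpha> = (\<alpha> \<bullet> \<gamma>) \<bullet> inv2 K \<gamma>" using assms(1-5) i by simp
  also have "\<dots> = (\<beta> \<bullet> \<gamma>) \<bullet> inv2 K \<gamma>" using assms by simp
  also have "\<dots> = \<beta>" using assms(1-5) i by simp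
  finally show ?thesis .
qed

lemma is_category_hom_cat:
  "is_category (hom_cat K X Y)"
  unfolding is_category_def hom_cat_def by (simp add: hom1_iff hom2_iff)

end

section \<open>Oplax cocones and modifications\<close>

text \<open>Only this much of the index 2-category matters for the calculus of
  modifications, so that the 2-category axioms of the index 2-categories of
  squares and triangles never have to be verified.\<close>

locale cocone_index = strict_two_category K
  for J :: "('io, 'ia, 'ic) two_cat" and K :: "('o, 'a, 'c) two_cat" (structure)
    and F :: "('io, 'ia, 'ic, 'o, 'a, 'c) two_fun" +
  assumes index_dom: "d \<in> One J \<Longrightarrow> dom1 J d \<in> Obj J"
    and index_cod: "d \<in> One J \<Longrightarrow> cod1 J d \<in> Obj J"
    and index_onOne: "d \<in> One J \<Longrightarrow> onOne F d \<in> hom1 K (onObj F (dom1 J d)) (onObj F (cod1 J d))"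
begin

lemma index_simps [simp]:
  assumes "d \<in> One J"
  shows "dom1 J d \<in> Obj J" "cod1 J d \<in> Obj J" "onOne F d \<in> One K"
    "dom1 K (onOne F d) = onObj F (dom1 J d)" "cod1 K (onOne F d) = onObj F (cod1 J d)"
  using assms index_dom index_cod index_onOne by (simp_all add: hom1_iff)

text \<open>The typing part of \<open>oplax_cocone\<close>, without the coherence laws. The calculus
  of modifications only uses the endpoints of legs and transitions, and these conditions pass to
  \<open>post_cocone\<close> by typing alone.\<close>

definition cocone_data :: "'o \<Rightarrow> ('io, 'ia, 'a, 'c) cocone \<Rightarrow> bool" where
  "cocone_data B q \<longleftrightarrow> (\<forall>i\<in>Obj J. leg q i \<in> hom1 K (onObj F i) B) \<and>
     (\<forall>d\<in>One J. transition q d \<in>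
        hom2 K (leg q (cod1 J d) \<cdot> onOne F d) (leg q (dom1 J d)))"

lemma cocone_dataD:
  assumes "cocone_data B q"
  shows "i \<in> Obj J \<Longrightarrow> leg q i \<in> One K" "i \<in> Obj J \<Longrightarrow> dom1 K (leg q i) = onObj F i"
    "i \<in> Obj J \<Longrightarrow> cod1 K (leg q i) = B"
    "d \<in> One J \<Longrightarrow> transition q d \<in> Two K"
    "d \<in> One J \<Longrightarrow> dom2 K (transition q d) = leg q (cod1 J d) \<cdot> onOne F d"
    "d \<in> One J \<Longrightarrow> cod2 K (transition q d) = leg q (dom1 J d)"
  using assms by (simp_all add: cocone_data_def hom1_iff hom2_iff)

lemma oplax_cocone_data: "oplax_cocone J K F B q \<Longrightarrow> cocone_data B q"
  by (simp add: oplax_cocone_def cocone_data_def)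

lemma modificationD:
  assumes "modification J K F q q' m"
  shows "i \<in> Obj J \<Longrightarrow> m i \<in> Two K" "i \<in> Obj J \<Longrightarrow> dom2 K (m i) = leg q i"
    "i \<in> Obj J \<Longrightarrow> cod2 K (m i) = leg q' i"
    "d \<in> One J \<Longrightarrow> m (dom1 J d) \<bullet> transition q d
        = transition q' d \<bullet> (m (cod1 J d) \<rhd> onOne F d)"
    "m \<in> extensional (Obj J)"
  using assms by (simp_all add: modification_def hom2_iff)

lemma modificationI:
  assumes "\<And>i. i \<in> Obj J \<Longrightarrow> m i \<in> hom2 K (leg q i) (leg q' i)"
    and "\<And>d. d \<in> One J \<Longrightarrow> m (dom1 J d) \<bullet> transition q d
        = transition q' d \<bullet> (m (cod1 J d) \<rhd> onOne F d)"
  shows "modification J K F q q' (\<lambda>i\<in>Obj J. m i)"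
  using assms by (simp add: modification_def)

lemma modification_id:
  assumes "cocone_data B q"
  shows "modification J K F q q (\<lambda>i\<in>Obj J. id2 K (leg q i))"
  by (rule modificationI) (simp_all add: hom2_iff cocone_dataD[OF assms])

lemma modification_comp:
  assumes p: "cocone_data B p" and q: "cocone_data B q" and r: "cocone_data B r"
    and m: "modification J K F p q m" and n: "modification J K F q r n"
  shows "modification J K F p r (\<lambda>i\<in>Obj J. n i \<bullet> m i)"
proof (rule modificationI)
  note [simp] = cocone_dataD[OF p] cocone_dataD[OF q] cocone_dataD[OF r]
    modificationD(1-3)[OF m] modificationD(1-3)[OF n]
  show "n i \<bullet> m i \<in> hom2 K (leg p i) (leg r i)" if "i \<in> Obj J" for i
    using that by (simp add: hom2_iff)
  fix d assume d: "d \<in> One J"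
  have "(n (dom1 J d) \<bullet> m (dom1 J d)) \<bullet> transition p d
      = (n (dom1 J d) \<bullet> transition q d) \<bullet> (m (cod1 J d) \<rhd> onOne F d)"
    using d by (simp add: modificationD(4)[OF m])
  also have "\<dots> = transition r d \<bullet> ((n (cod1 J d) \<bullet> m (cod1 J d)) \<rhd> onOne F d)"
    unfolding modificationD(4)[OF n d] using d by simp
  finally show "(n (dom1 J d) \<bullet> m (dom1 J d)) \<bullet> transition p d
      = transition r d \<bullet> ((n (cod1 J d) \<bullet> m (cod1 J d)) \<rhd> onOne F d)" .
qed

text \<open>The compatibility square at \<open>d\<close> is conjugated by the inverses at both ends.
  Hence invertibility of modifications is a pointwise matter; this provides both the inverses of the
  universal cells and the family inverse to the transitions.\<close>

lemma modification_inverse: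
  assumes p: "cocone_data B p" and q: "cocone_data B q"
    and m: "modification J K F p q m" and inv: "\<And>i. i \<in> Obj J \<Longrightarrow> inverse2 K (m i) (n i)"
  shows "modification J K F q p (\<lambda>i\<in>Obj J. n i)"
proof (rule modificationI)
  note [simp] = cocone_dataD[OF p] cocone_dataD[OF q] modificationD(1-3)[OF m]
  have n: "n i \<in> Two K" "dom2 K (n i) = leg q i" "cod2 K (n i) = leg p i"
    "n i \<bullet> m i = id2 K (leg p i)" "m i \<bullet> n i = id2 K (leg q i)" if "i \<in> Obj J" for i
    using inv[OF that] that by (simp_all add: inverse2_def hom2_iff)
  note [simp] = n(1-3)
  show "n i \<in> hom2 K (leg q i) (leg p i)" if "i \<in> Obj J" for i
    using that by (simp add: hom2_iff)
  fix d assume d: "d \<in> One J"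
  \<comment> \<open>Inserted on the right below, this identity makes room for the compatibility of
    \<open>m\<close>, after which \<open>n\<close> and \<open>m\<close> cancel on the left.\<close>
  have w: "(m (cod1 J d) \<rhd> onOne F d) \<bullet> (n (cod1 J d) \<rhd> onOne F d)
      = id2 K (leg q (cod1 J d) \<cdot> onOne F d)"
    using d n(5)[of "cod1 J d"] rwhisker_vcomp[of "onOne F d" "n (cod1 J d)" "m (cod1 J d)"]
    by (simp del: rwhisker_vcomp)
  have "n (dom1 J d) \<bullet> transition q d = n (dom1 J d) \<bullet> transition q d
      \<bullet> ((m (cod1 J d) \<rhd> onOne F d) \<bullet> (n (cod1 J d) \<rhd> onOne F d))"
    unfolding w using d by simp
  also have "\<dots> = n (dom1 J d) \<bullet> (transition q d \<bullet> (m (cod1 J d) \<rhd> onOne F d))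
      \<bullet> (n (cod1 J d) \<rhd> onOne F d)"
    using d by simp
  also have "\<dots> = (n (dom1 J d) \<bullet> m (dom1 J d)) \<bullet> transition p d \<bullet> (n (cod1 J d) \<rhd> onOne F d)"
    unfolding modificationD(4)[OF m d, symmetric] using d by simp
  also have "\<dots> = transition p d \<bullet> (n (cod1 J d) \<rhd> onOne F d)"
    unfolding n(4)[OF index_dom[OF d]] using d by simp
  finally show "n (dom1 J d) \<bullet> transition q d = transition p d \<bullet> (n (cod1 J d) \<rhd> onOne F d)" .
qed

text \<open>Modifications are extensional, so the unit and associativity laws are equalities of
  functions and not merely equalities on \<open>Obj J\<close>.\<close>

lemma is_category_oplax_cocone_cat: "is_category (oplax_cocone_cat J K F B)"
  unfolding is_category_def
proof (intro conjI ballI)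
  let ?A = "oplax_cocone_cat J K F B"
  fix p assume "p \<in> cobj ?A"
  then have p: "cocone_data B p" by (simp add: oplax_cocone_cat_def oplax_cocone_data)
  show "cid ?A p \<in> chom ?A p p" using modification_id[OF p] by (simp add: oplax_cocone_cat_def)
  fix q assume "q \<in> cobj ?A"
  then have q: "cocone_data B q" by (simp add: oplax_cocone_cat_def oplax_cocone_data)
  {
    fix m assume "m \<in> chom ?A p q"
    then have m: "modification J K F p q m" by (simp add: oplax_cocone_cat_def)
    show "ccomp ?A m (cid ?A p) = m"
      by (rule extensionalityI[of _ "Obj J"])
        (use modificationD[OF m] in \<open>simp_all add: oplax_cocone_cat_def\<close>)
    show "ccomp ?A (cid ?A q) m = m"
      by (rule extensionalityI[of _ "Obj J"])
        (use modificationD[OF m] in \<open>simp_all add: oplax_cocone_cat_def\<close>)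
  }
  fix r assume "r \<in> cobj ?A"
  then have r: "cocone_data B r" by (simp add: oplax_cocone_cat_def oplax_cocone_data)
  fix m assume "m \<in> chom ?A p q"
  then have m: "modification J K F p q m" by (simp add: oplax_cocone_cat_def)
  {
    fix n assume "n \<in> chom ?A q r"
    then have n: "modification J K F q r n" by (simp add: oplax_cocone_cat_def)
    show "ccomp ?A n m \<in> chom ?A p r"
      using modification_comp[OF p q r m n] by (simp add: oplax_cocone_cat_def)
  }
  fix s n k assume "n \<in> chom ?A q r" "k \<in> chom ?A r s"
  then have n: "modification J K F q r n" and k: "modification J K F r s k"
    by (simp_all add: oplax_cocone_cat_def)
  show "ccomp ?A (ccomp ?A k n) m = ccomp ?A k (ccomp ?A n m)"
    by (rule extensionalityI[of _ "Obj J"])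
      (use modificationD(1-3)[OF m] modificationD(1-3)[OF n] modificationD(1-3)[OF k]
        in \<open>simp_all add: oplax_cocone_cat_def\<close>)
qed

text \<open>Evaluating the two composites with an inverse modification at \<open>i\<close> gives a
  pointwise inverse, the converse of \<open>modification_inverse\<close>.\<close>

lemma is_iso_inverse2:
  assumes "is_iso (oplax_cocone_cat J K F B) p q m" and i: "i \<in> Obj J"
  shows "inverse2 K (m i) (inv2 K (m i))" "invertible2 K (m i)"
proof -
  obtain n where m: "modification J K F p q m" and n: "modification J K F q p n"
    and 1: "(\<lambda>i\<in>Obj J. n i \<bullet> m i) = (\<lambda>i\<in>Obj J. id2 K (leg p i))"
    and 2: "(\<lambda>i\<in>Obj J. m i \<bullet> n i) = (\<lambda>i\<in>Obj J. id2 K (leg q i))"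
    using assms(1) by (auto simp: is_iso_def oplax_cocone_cat_def)
  have "n i \<bullet> m i = id2 K (leg p i)" "m i \<bullet> n i = id2 K (leg q i)"
    using i fun_cong[OF 1, of i] fun_cong[OF 2, of i] by simp_all
  then have "inverse2 K (m i) (n i)"
    using modificationD(1-3)[OF m i] modificationD(1-3)[OF n i]
    by (simp add: inverse2_def hom2_iff)
  then show "invertible2 K (m i)"
    using modificationD(1)[OF m i] by (rule inverse2_imp_invertible2[rotated])
  then show "inverse2 K (m i) (inv2 K (m i))" by (rule inverse2_inv2)
qed

lemma is_iso_modification:
  "is_iso (oplax_cocone_cat J K F B) p q m \<Longrightarrow> modification J K F p q m"
  by (simp add: is_iso_def oplax_cocone_cat_def)

lemma is_iso_inverse_modification:
  assumes "cocone_data B p" "cocone_data B q" "is_iso (oplax_cocone_cat J K F B) p q m"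
  shows "modification J K F q p (\<lambda>i\<in>Obj J. inv2 K (m i))"
  by (rule modification_inverse[OF assms(1,2) is_iso_modification[OF assms(3)]])
    (rule is_iso_inverse2(1)[OF assms(3)])

lemma cocone_data_post_cocone:
  assumes "cocone_data L q" "f \<in> hom1 K L B"
  shows "cocone_data B (post_cocone J K q f)"
  using assms(2) cocone_dataD[OF assms(1)]
  by (simp add: cocone_data_def post_cocone_def hom1_iff hom2_iff)

text \<open>Strictness of the 2-category makes this an equality, so modifications between cocones
  postcomposed in stages can be composed without coherence cells.\<close>

lemma post_cocone_comp:
  assumes q: "cocone_data L q" and f: "f \<in> hom1 K L B" and g: "g \<in> hom1 K B D"
  shows "post_cocone J K (post_cocone J K q f) g = post_cocone J K q (g \<cdot> f)"
  unfolding post_cocone_def using f g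
  by (auto simp: hom1_iff cocone_dataD[OF q] intro!: restrict_ext)

lemma modification_post_cocone:
  assumes p: "cocone_data L p" and q: "cocone_data L q" and f: "f \<in> hom1 K L B"
    and m: "modification J K F p q m"
  shows "modification J K F (post_cocone J K p f) (post_cocone J K q f) (\<lambda>i\<in>Obj J. f \<lhd> m i)"
proof (rule modificationI)
  note [simp] = cocone_dataD[OF p] cocone_dataD[OF q] modificationD(1-3)[OF m]
  have [simp]: "f \<in> One K" "dom1 K f = L" using f by (simp_all add: hom1_iff)
  show "f \<lhd> m i \<in> hom2 K (leg (post_cocone J K p f) i) (leg (post_cocone J K q f) i)"
    if "i \<in> Obj J" for i using that by (simp add: post_cocone_def hom2_iff)
  fix d assume d: "d \<in> One J"
  have "f \<lhd> (m (dom1 J d) \<bullet> transition p d) = f \<lhd> (transition q d \<bullet> (m (cod1 J d) \<rhd> onOne F d))"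
    using modificationD(4)[OF m d] by simp
  then show "(f \<lhd> m (dom1 J d)) \<bullet> transition (post_cocone J K p f) d
      = transition (post_cocone J K q f) d \<bullet> ((f \<lhd> m (cod1 J d)) \<rhd> onOne F d)"
    using d by (simp add: post_cocone_def)
qed

text \<open>Compatibility at \<open>d\<close> is the exchange of \<alpha> with the transition 2-cell
  at \<open>d\<close>.\<close>

lemma modification_post_modification:
  assumes q: "cocone_data L q" and f: "f \<in> hom1 K L B" and \<alpha>: "\<alpha> \<in> hom2 K f g"
  shows "modification J K F (post_cocone J K q f) (post_cocone J K q g) (post_modification J K q \<alpha>)"
  unfolding post_modification_def
proof (rule modificationI)
  note [simp] = cocone_dataD[OF q]
  note p = hom2_parallel[OF \<alpha>]
  have [simp]: "f \<in> One K" "dom1 K f = L" "g \<in> One K" "dom1 K g = L"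
    "\<alpha> \<in> Two K" "dom2 K \<alpha> = f" "cod2 K \<alpha> = g"
    using f \<alpha> p by (simp_all add: hom1_iff hom2_iff)
  show "\<alpha> \<rhd> leg q i \<in> hom2 K (leg (post_cocone J K q f) i) (leg (post_cocone J K q g) i)"
    if "i \<in> Obj J" for i using that by (simp add: post_cocone_def hom2_iff)
  fix d assume d: "d \<in> One J"
  have "(\<alpha> \<rhd> leg q (dom1 J d)) \<bullet> (f \<lhd> transition q d)
      = (g \<lhd> transition q d) \<bullet> (\<alpha> \<rhd> (leg q (cod1 J d) \<cdot> onOne F d))"
    using d by (intro whisker_exchange) (simp_all add: hom2_iff)
  then show "(\<alpha> \<rhd> leg q (dom1 J d)) \<bullet> transition (post_cocone J K q f) d
      = transition (post_cocone J K q g) d \<bullet> ((\<alpha> \<rhd> leg q (cod1 J d)) \<rhd> onOne F d)"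
    using d by (simp add: post_cocone_def)
qed

section \<open>Consequences of the universal property of an oplax bicolimit\<close>

context
  fixes L q
  assumes bicolim: "oplax_bicolimit J K F L q"
begin

lemma bicolimit_cocone: "cocone_data L q"
  using bicolim oplax_cocone_data unfolding oplax_bicolimit_def by blast

lemma bicolimit_equivalence:
  "B \<in> Obj K \<Longrightarrow> is_equivalence (hom_cat K L B) (oplax_cocone_cat J K F B)
     (post_cocone J K q) (\<lambda>f g. post_modification J K q)"
  using bicolim by (simp add: oplax_bicolimit_def)

lemma bicolimit_post_cocone:
  assumes "f \<in> hom1 K L B"
  shows "oplax_cocone J K F B (post_cocone J K q f)"
proof -
  have "B \<in> Obj K" using assms by (auto simp: hom1_iff)
  then have "is_functor (hom_cat K L B) (oplax_cocone_cat J K F B)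
     (post_cocone J K q) (\<lambda>f g. post_modification J K q)"
    using bicolimit_equivalence equivalence_imp_functor by blast
  then show ?thesis
    using assms is_functorD(1)[of _ _ _ _ f] by (fastforce simp: hom_cat_def oplax_cocone_cat_def)
qed

text \<open>Faithfulness of the comparison functor, read pointwise. This is the principle by which
  equations between 2-cells out of a bicolimit are checked leg by leg.\<close>

lemma bicolimit_faithful:
  assumes f: "f \<in> hom1 K L B" and \<alpha>: "\<alpha> \<in> hom2 K f g" and \<beta>: "\<beta> \<in> hom2 K f g"
    and eq: "\<And>i. i \<in> Obj J \<Longrightarrow> \<alpha> \<rhd> leg q i = \<beta> \<rhd> leg q i"
  shows "\<alpha> = \<beta>"
proof -
  have o: "B \<in> Obj K" "g \<in> hom1 K L B" using f hom2_parallel[OF \<alpha>] by (auto simp: hom1_iff)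
  have "faithful (hom_cat K L B) (\<lambda>f g. post_modification J K q)"
    using equivalence_imp_faithful[OF is_category_hom_cat bicolimit_equivalence[OF o(1)]] .
  moreover have "post_modification J K q \<alpha> = post_modification J K q \<beta>"
    unfolding post_modification_def using eq by (rule restrict_ext)
  ultimately show ?thesis
    using f o \<alpha> \<beta> unfolding faithful_def inj_on_def by (simp add: hom_cat_def)
qed

lemma bicolimit_full:
  assumes f: "f \<in> hom1 K L B" and g: "g \<in> hom1 K L B"
    and m: "modification J K F (post_cocone J K q f) (post_cocone J K q g) m"
  obtains \<alpha> where "\<alpha> \<in> hom2 K f g" "post_modification J K q \<alpha> = m"
proof -
  have o: "B \<in> Obj K" using f by (auto simp: hom1_iff)
  have "full (hom_cat K L B) (oplax_cocone_cat J K F B)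
     (post_cocone J K q) (\<lambda>f g. post_modification J K q)"
    using equivalence_imp_full[OF is_category_hom_cat is_category_oplax_cocone_cat
        bicolimit_equivalence[OF o]] .
  then show ?thesis
    by (rule fullE[of _ _ _ _ f g m]) (use f g m that in \<open>simp_all add: hom_cat_def oplax_cocone_cat_def\<close>)
qed

lemma bicolimit_mediating:
  assumes "oplax_cocone J K F B w"
  obtains f m where "f \<in> hom1 K L B" "is_iso (oplax_cocone_cat J K F B) (post_cocone J K q f) w m"
proof -
  have "B \<in> Obj K" using assms by (simp add: oplax_cocone_def)
  then have "essentially_surjective (hom_cat K L B) (oplax_cocone_cat J K F B) (post_cocone J K q)"
    using bicolimit_equivalence equivalence_imp_essentially_surjective by blast
  then show ?thesis using assms that
    unfolding essentially_surjective_def by (auto simp: hom_cat_def oplax_cocone_cat_def)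
qed

text \<open>The inverses on the legs form a modification, which fullness lifts to a 2-cell \<beta>;
  faithfulness shows that \<beta> is inverse to \<alpha>.\<close>

lemma bicolimit_invertible:
  assumes f: "f \<in> hom1 K L B" and \<alpha>: "\<alpha> \<in> hom2 K f g"
    and inv: "\<And>i. i \<in> Obj J \<Longrightarrow> invertible2 K (\<alpha> \<rhd> leg q i)"
  shows "invertible2 K \<alpha>"
proof -
  note [simp] = cocone_dataD[OF bicolimit_cocone]
  have g: "g \<in> hom1 K L B" using f hom2_parallel[OF \<alpha>] by (simp add: hom1_iff)
  have [simp]: "f \<in> One K" "dom1 K f = L" "g \<in> One K" "dom1 K g = L"
    "\<alpha> \<in> Two K" "dom2 K \<alpha> = f" "cod2 K \<alpha> = g"
    using f g \<alpha> by (simp_all add: hom1_iff hom2_iff)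
  have "modification J K F (post_cocone J K q g) (post_cocone J K q f)
      (\<lambda>i\<in>Obj J. inv2 K (\<alpha> \<rhd> leg q i))"
    by (rule modification_inverse[OF cocone_data_post_cocone[OF bicolimit_cocone f]
          cocone_data_post_cocone[OF bicolimit_cocone g]
          modification_post_modification[OF bicolimit_cocone f \<alpha>]])
      (simp add: post_modification_def inverse2_inv2 inv)
  then obtain \<beta> where \<beta>: "\<beta> \<in> hom2 K g f"
    and "post_modification J K q \<beta> = (\<lambda>i\<in>Obj J. inv2 K (\<alpha> \<rhd> leg q i))"
    by (rule bicolimit_full[OF g f])
  then have eq: "\<beta> \<rhd> leg q i = inv2 K (\<alpha> \<rhd> leg q i)" if "i \<in> Obj J" for i
    using that by (metis post_modification_def restrict_apply')
  have [simp]: "\<beta> \<in> Two K" "dom2 K \<beta> = g" "cod2 K \<beta> = f" using \<beta> by (simp_all add: hom2_iff)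
  have "\<beta> \<bullet> \<alpha> = id2 K f"
    by (rule bicolimit_faithful[OF f]) (simp_all add: hom2_iff eq inv)
  moreover have "\<alpha> \<bullet> \<beta> = id2 K g"
    by (rule bicolimit_faithful[OF g]) (simp_all add: hom2_iff eq inv)
  ultimately show ?thesis
    by (intro inverse2_imp_invertible2[of _ \<beta>]) (simp_all add: inverse2_def hom2_iff)
qed

end

end

section \<open>Strict 2-functors and their action on invertible 2-cells\<close>

locale two_functor_between = strict_two_category C + I: strict_two_category I
  for I :: "('io, 'ia, 'ic) two_cat" and C :: "('o, 'a, 'c) two_cat" (structure) +
  fixes F :: "('io, 'ia, 'ic, 'o, 'a, 'c) two_fun"
  assumes two_functor: "two_functor I C F"
begin

lemma functor_simps [simp]:
  shows "i \<in> Obj I \<Longrightarrow> onObj F i \<in> Obj C"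
    and "f \<in> One I \<Longrightarrow> onOne F f \<in> One C"
    and "f \<in> One I \<Longrightarrow> dom1 C (onOne F f) = onObj F (dom1 I f)"
    and "f \<in> One I \<Longrightarrow> cod1 C (onOne F f) = onObj F (cod1 I f)"
    and "\<alpha> \<in> Two I \<Longrightarrow> onTwo F \<alpha> \<in> Two C"
    and "\<alpha> \<in> Two I \<Longrightarrow> dom2 C (onTwo F \<alpha>) = onOne F (dom2 I \<alpha>)"
    and "\<alpha> \<in> Two I \<Longrightarrow> cod2 C (onTwo F \<alpha>) = onOne F (cod2 I \<alpha>)"
    and "i \<in> Obj I \<Longrightarrow> onOne F (id1 I i) = id1 C (onObj F i)"
    and "\<lbrakk>f \<in> One I; g \<in> One I; dom1 I g = cod1 I f\<rbrakk>
      \<Longrightarrow> onOne F (g \<cdot>\<^bsub>I\<^esub> f) = onOne F g \<cdot> onOne F f"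
    and "f \<in> One I \<Longrightarrow> onTwo F (id2 I f) = id2 C (onOne F f)"
  using two_functor by (simp_all add: two_functor_def hom1_iff hom2_iff)

lemma functor_invertible2:
  assumes "invertible2 I \<alpha>"
  shows "invertible2 C (onTwo F \<alpha>)"
proof -
  obtain \<beta> where \<alpha>: "\<alpha> \<in> Two I" and \<beta>: "\<beta> \<in> Two I" "dom2 I \<beta> = cod2 I \<alpha>" "cod2 I \<beta> = dom2 I \<alpha>"
    and inv: "\<beta> \<bullet>\<^bsub>I\<^esub> \<alpha> = id2 I (dom2 I \<alpha>)" "\<alpha> \<bullet>\<^bsub>I\<^esub> \<beta> = id2 I (cod2 I \<alpha>)"
    using assms by (auto simp: invertible2_def inverse2_def hom2_iff)
  have "onTwo F (\<beta> \<bullet>\<^bsub>I\<^esub> \<alpha>) = onTwo F \<beta> \<bullet> onTwo F \<alpha>" "onTwo F (\<alpha> \<bullet>\<^bsub>I\<^esub> \<beta>) = onTwo F \<alpha> \<bullet> onTwo F \<beta>"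
    using two_functor \<alpha> \<beta> by (simp_all add: two_functor_def)
  then have "inverse2 C (onTwo F \<alpha>) (onTwo F \<beta>)"
    using \<alpha> \<beta> inv by (simp add: inverse2_def hom2_iff)
  then show ?thesis using \<alpha> by (intro inverse2_imp_invertible2) simp_all
qed

sublocale base: cocone_index I C F
  by unfold_locales (simp_all add: hom1_iff)

end

section \<open>The codescent object of a 2-functor\<close>

text \<open>The witnesses of the existential in \<open>associated_codescent\<close> become
  parameters, so that the bicolimit cocones and universal 2-cells have fixed names in all later
  arguments.\<close>

locale sigma_codescent = two_functor_between I C F
  for I :: "('io, 'ia, 'ic) two_cat" and C :: "('o, 'a, 'c) two_cat" (structure)
    and F :: "('io, 'ia, 'ic, 'o, 'a, 'c) two_fun" +
  fixes \<Sigma> :: "'ia set" and q :: "('io, 'ia, 'a, 'c) cocone" and X :: "('o, 'a, 'c) codescent"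
    and r :: "('ia, ('ia, 'ic) square, 'a, 'c) cocone"
    and s :: "(('ia, 'ic) triangle, ('ia, 'ic) tri_trans, 'a, 'c) cocone"
    and \<theta> \<theta>' :: "'ia \<Rightarrow> 'c" and \<kappa> :: "'io \<Rightarrow> 'c"
    and \<rho>0 \<rho>1 \<rho>2 :: "('ia, 'ic) triangle \<Rightarrow> 'c"
  assumes Sigma_One: "\<Sigma> \<subseteq> One I"
    and Sigma_id: "\<forall>i\<in>Obj I. id1 I i \<in> \<Sigma>"
    and codescent: "codescent_object C X"
    and q_bicolimit: "oplax_bicolimit I C F (X0 X) q"
    and r_bicolimit: "oplax_bicolimit (Sigma2 I \<Sigma>) C (F \<circ>\<^sub>2 Sigma2_dom I) (X1 X) r"
    and s_bicolimit: "oplax_bicolimit (Sigma3 I \<Sigma>) C (F \<circ>\<^sub>2 Sigma2_dom I \<circ>\<^sub>2 Sigma3_p0) (X2 X) s"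
    and D0_mediates: "mediates (Sigma2 I \<Sigma>) C (F \<circ>\<^sub>2 Sigma2_dom I) (X1 X) r
          (X0 X) (d0_cocone I \<Sigma> q) (D0 X) \<theta>"
    and D1_mediates: "mediates (Sigma2 I \<Sigma>) C (F \<circ>\<^sub>2 Sigma2_dom I) (X1 X) r
          (X0 X) (d1_cocone I C F \<Sigma> q) (D1 X) \<theta>'"
    and U_mediates: "mediates I C F (X0 X) q (X1 X) (i_cocone I r) (U X) \<kappa>"
    and P0_mediates: "mediates (Sigma3 I \<Sigma>) C (F \<circ>\<^sub>2 Sigma2_dom I \<circ>\<^sub>2 Sigma3_p0) (X2 X) s
          (X1 X) (p01_cocone I \<Sigma> Sigma3_p0 r) (P0 X) \<rho>0"
    and P1_mediates: "mediates (Sigma3 I \<Sigma>) C (F \<circ>\<^sub>2 Sigma2_dom I \<circ>\<^sub>2 Sigma3_p0) (X2 X) s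
          (X1 X) (p01_cocone I \<Sigma> Sigma3_p1 r) (P1 X) \<rho>1"
    and P2_mediates: "mediates (Sigma3 I \<Sigma>) C (F \<circ>\<^sub>2 Sigma2_dom I \<circ>\<^sub>2 Sigma3_p0) (X2 X) s
          (X1 X) (p2_cocone I C F \<Sigma> r) (P2 X) \<rho>2"
    and N0_eq: "\<forall>i\<in>Obj I. N0 X \<rhd> leg q i = \<theta> (id1 I i) \<bullet> (D0 X \<lhd> \<kappa> i)"
    and N1_eq: "\<forall>i\<in>Obj I. N1 X \<rhd> leg q i = \<theta>' (id1 I i) \<bullet> (D1 X \<lhd> \<kappa> i)"
    and T01_eq: "\<forall>T\<in>Obj (Sigma3 I \<Sigma>).
           \<theta> (e1 T) \<bullet> (D0 X \<lhd> \<rho>1 T) \<bullet> (T01 X \<rhd> leg s T) = \<theta> (e0 T) \<bullet> (D0 X \<lhd> \<rho>0 T)"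
    and T02_eq: "\<forall>T\<in>Obj (Sigma3 I \<Sigma>).
           (\<theta> (e2 T) \<rhd> onOne F (e0 T)) \<bullet> (D0 X \<lhd> \<rho>2 T) \<bullet> (T02 X \<rhd> leg s T)
             = \<theta>' (e0 T) \<bullet> (D1 X \<lhd> \<rho>0 T)"
    and T12_eq: "\<forall>T\<in>Obj (Sigma3 I \<Sigma>).
           (\<theta>' (e2 T) \<rhd> onOne F (e0 T)) \<bullet> (D1 X \<lhd> \<rho>2 T) \<bullet> (T12 X \<rhd> leg s T)
             = (leg q (cod1 I (e1 T)) \<lhd> inv2 C (onTwo F (face T))) \<bullet> \<theta>' (e1 T) \<bullet> (D1 X \<lhd> \<rho>1 T)"
begin

lemma Sigma_simps [simp]: "d \<in> \<Sigma> \<Longrightarrow> d \<in> One I" "i \<in> Obj I \<Longrightarrow> id1 I i \<in> \<Sigma>"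
  using Sigma_One Sigma_id by auto

lemma squareD:
  assumes "square I \<Sigma> \<phi>"
  shows "sq_dom \<phi> \<in> \<Sigma>" "sq_cod \<phi> \<in> \<Sigma>" "sq0 \<phi> \<in> One I" "sq1 \<phi> \<in> One I" "sq_cell \<phi> \<in> Two I"
    "dom1 I (sq0 \<phi>) = dom1 I (sq_dom \<phi>)" "cod1 I (sq0 \<phi>) = dom1 I (sq_cod \<phi>)"
    "dom1 I (sq1 \<phi>) = cod1 I (sq_dom \<phi>)" "cod1 I (sq1 \<phi>) = cod1 I (sq_cod \<phi>)"
    "dom2 I (sq_cell \<phi>) = sq_cod \<phi> \<cdot>\<^bsub>I\<^esub> sq0 \<phi>" "cod2 I (sq_cell \<phi>) = sq1 \<phi> \<cdot>\<^bsub>I\<^esub> sq_dom \<phi>"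
  using assms by (simp_all add: square_def hom1_iff hom2_iff)

lemma triangleD:
  assumes "triangle I \<Sigma> T"
  shows "e0 T \<in> \<Sigma>" "e1 T \<in> \<Sigma>" "e2 T \<in> \<Sigma>" "dom1 I (e2 T) = cod1 I (e0 T)"
    "dom1 I (e1 T) = dom1 I (e0 T)" "cod1 I (e2 T) = cod1 I (e1 T)"
    "face T \<in> Two I" "dom2 I (face T) = e2 T \<cdot>\<^bsub>I\<^esub> e0 T" "cod2 I (face T) = e1 T"
    "invertible2 I (face T)"
proof -
  show e: "e0 T \<in> \<Sigma>" "e1 T \<in> \<Sigma>" "e2 T \<in> \<Sigma>" "dom1 I (e2 T) = cod1 I (e0 T)"
    "face T \<in> Two I" "dom2 I (face T) = e2 T \<cdot>\<^bsub>I\<^esub> e0 T" "cod2 I (face T) = e1 T"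
    "invertible2 I (face T)"
    using assms by (simp_all add: triangle_def hom2_iff)
  show "dom1 I (e1 T) = dom1 I (e0 T)" "cod1 I (e2 T) = cod1 I (e1 T)"
    using I.hom2_parallel[of "face T" "e2 T \<cdot>\<^bsub>I\<^esub> e0 T" "e1 T"] e by (simp_all add: hom2_iff)
qed

lemma Sigma2_sel [simp]:
  "Obj (Sigma2 I \<Sigma>) = \<Sigma>" "\<phi> \<in> One (Sigma2 I \<Sigma>) \<longleftrightarrow> square I \<Sigma> \<phi>"
  "dom1 (Sigma2 I \<Sigma>) = sq_dom" "cod1 (Sigma2 I \<Sigma>) = sq_cod"
  by (simp_all add: Sigma2_def)

lemma Sigma3_sel [simp]:
  "T \<in> Obj (Sigma3 I \<Sigma>) \<longleftrightarrow> triangle I \<Sigma> T" "\<tau> \<in> One (Sigma3 I \<Sigma>) \<longleftrightarrow> tri_trans I \<Sigma> \<tau>"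
  "dom1 (Sigma3 I \<Sigma>) = tt_dom" "cod1 (Sigma3 I \<Sigma>) = tt_cod"
  by (simp_all add: Sigma3_def)

lemma edge_functor_sel [simp]:
  "onObj (Sigma2_dom I) = dom1 I" "onOne (Sigma2_dom I) = sq0"
  "onObj (Sigma2_cod I) = cod1 I" "onOne (Sigma2_cod I) = sq1"
  by (simp_all add: Sigma2_dom_def Sigma2_cod_def)

lemma index_functor_sel [simp]:
  "onObj (F \<circ>\<^sub>2 Sigma2_dom I) d = onObj F (dom1 I d)"
  "onOne (F \<circ>\<^sub>2 Sigma2_dom I) \<phi> = onOne F (sq0 \<phi>)"
  "onObj (F \<circ>\<^sub>2 Sigma2_dom I \<circ>\<^sub>2 Sigma3_p0) T = onObj F (dom1 I (e0 T))"
  "onOne (F \<circ>\<^sub>2 Sigma2_dom I \<circ>\<^sub>2 Sigma3_p0) \<tau> = onOne F (t0 \<tau>)"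
  by (simp_all add: two_fun_comp_def Sigma3_p0_def tri_edge0_def)

sublocale edges: cocone_index "Sigma2 I \<Sigma>" C "F \<circ>\<^sub>2 Sigma2_dom I"
  by unfold_locales (simp_all add: squareD hom1_iff)

sublocale triangles: cocone_index "Sigma3 I \<Sigma>" C "F \<circ>\<^sub>2 Sigma2_dom I \<circ>\<^sub>2 Sigma3_p0"
proof unfold_locales
  fix \<tau> assume "\<tau> \<in> One (Sigma3 I \<Sigma>)"
  then have "triangle I \<Sigma> (tt_dom \<tau>)" "triangle I \<Sigma> (tt_cod \<tau>)" "square I \<Sigma> (tri_edge0 \<tau>)"
    by (simp_all add: tri_trans_def)
  then show "dom1 (Sigma3 I \<Sigma>) \<tau> \<in> Obj (Sigma3 I \<Sigma>)" "cod1 (Sigma3 I \<Sigma>) \<tau> \<in> Obj (Sigma3 I \<Sigma>)"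
    "onOne (F \<circ>\<^sub>2 Sigma2_dom I \<circ>\<^sub>2 Sigma3_p0) \<tau> \<in> hom1 C
      (onObj (F \<circ>\<^sub>2 Sigma2_dom I \<circ>\<^sub>2 Sigma3_p0) (dom1 (Sigma3 I \<Sigma>) \<tau>))
      (onObj (F \<circ>\<^sub>2 Sigma2_dom I \<circ>\<^sub>2 Sigma3_p0) (cod1 (Sigma3 I \<Sigma>) \<tau>))"
    using squareD[of "tri_edge0 \<tau>"] by (simp_all add: hom1_iff tri_edge0_def)
qed

lemma q_data: "base.cocone_data (X0 X) q"
  by (rule base.bicolimit_cocone[OF q_bicolimit])

lemma r_data: "edges.cocone_data (X1 X) r"
  by (rule edges.bicolimit_cocone[OF r_bicolimit])

lemma s_data: "triangles.cocone_data (X2 X) s"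
  by (rule triangles.bicolimit_cocone[OF s_bicolimit])

lemmas q_simps [simp] = base.cocone_dataD[OF q_data]

lemma q_oplax [simp]:
  "i \<in> Obj I \<Longrightarrow> transition q (id1 I i) = id2 C (leg q i)"
  "\<lbrakk>d \<in> One I; e \<in> One I; dom1 I e = cod1 I d\<rbrakk>
    \<Longrightarrow> transition q (e \<cdot>\<^bsub>I\<^esub> d) = transition q d \<bullet> (transition q e \<rhd> onOne F d)"
  and q_oplax_2cell:
  "\<alpha> \<in> Two I \<Longrightarrow> transition q (cod2 I \<alpha>) \<bullet> (leg q (cod1 I (dom2 I \<alpha>)) \<lhd> onTwo F \<alpha>)
     = transition q (dom2 I \<alpha>)"
  using q_bicolimit by (simp_all add: oplax_bicolimit_def oplax_cocone_def)

lemma r_simps [simp]: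
  "d \<in> \<Sigma> \<Longrightarrow> leg r d \<in> One C" "d \<in> \<Sigma> \<Longrightarrow> dom1 C (leg r d) = onObj F (dom1 I d)"
  "d \<in> \<Sigma> \<Longrightarrow> cod1 C (leg r d) = X1 X"
  using edges.cocone_dataD[OF r_data] by simp_all

lemma s_simps [simp]:
  "triangle I \<Sigma> T \<Longrightarrow> leg s T \<in> One C"
  "triangle I \<Sigma> T \<Longrightarrow> dom1 C (leg s T) = onObj F (dom1 I (e0 T))"
  "triangle I \<Sigma> T \<Longrightarrow> cod1 C (leg s T) = X2 X"
  using triangles.cocone_dataD[OF s_data] by simp_all

lemma codescent_Obj [simp]: "X0 X \<in> Obj C" "X1 X \<in> Obj C" "X2 X \<in> Obj C"
  using codescent by (simp_all add: codescent_object_def)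

lemma codescent_One [simp]:
  "P0 X \<in> One C" "dom1 C (P0 X) = X2 X" "cod1 C (P0 X) = X1 X"
  "P1 X \<in> One C" "dom1 C (P1 X) = X2 X" "cod1 C (P1 X) = X1 X"
  "P2 X \<in> One C" "dom1 C (P2 X) = X2 X" "cod1 C (P2 X) = X1 X"
  "D0 X \<in> One C" "dom1 C (D0 X) = X1 X" "cod1 C (D0 X) = X0 X"
  "D1 X \<in> One C" "dom1 C (D1 X) = X1 X" "cod1 C (D1 X) = X0 X"
  "U X \<in> One C" "dom1 C (U X) = X0 X" "cod1 C (U X) = X1 X"
  using codescent by (simp_all add: codescent_object_def hom1_iff)

lemma codescent_Two [simp]:
  "N0 X \<in> Two C" "dom2 C (N0 X) = D0 X \<cdot> U X" "cod2 C (N0 X) = id1 C (X0 X)"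
  "N1 X \<in> Two C" "dom2 C (N1 X) = D1 X \<cdot> U X" "cod2 C (N1 X) = id1 C (X0 X)"
  "T01 X \<in> Two C" "dom2 C (T01 X) = D0 X \<cdot> P0 X" "cod2 C (T01 X) = D0 X \<cdot> P1 X"
  "T02 X \<in> Two C" "dom2 C (T02 X) = D1 X \<cdot> P0 X" "cod2 C (T02 X) = D0 X \<cdot> P2 X"
  "T12 X \<in> Two C" "dom2 C (T12 X) = D1 X \<cdot> P1 X" "cod2 C (T12 X) = D1 X \<cdot> P2 X"
  "invertible2 C (N0 X)"
  using codescent by (simp_all add: codescent_object_def hom2_iff)

lemma theta_iso: "is_iso (oplax_cocone_cat (Sigma2 I \<Sigma>) C (F \<circ>\<^sub>2 Sigma2_dom I) (X0 X))
    (post_cocone (Sigma2 I \<Sigma>) C r (D0 X)) (d0_cocone I \<Sigma> q) \<theta>"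
  using D0_mediates by (simp add: mediates_def)

lemma theta'_iso: "is_iso (oplax_cocone_cat (Sigma2 I \<Sigma>) C (F \<circ>\<^sub>2 Sigma2_dom I) (X0 X))
    (post_cocone (Sigma2 I \<Sigma>) C r (D1 X)) (d1_cocone I C F \<Sigma> q) \<theta>'"
  using D1_mediates by (simp add: mediates_def)

lemma theta_simps [simp]:
  assumes "d \<in> \<Sigma>"
  shows "\<theta> d \<in> Two C" "dom2 C (\<theta> d) = D0 X \<cdot> leg r d" "cod2 C (\<theta> d) = leg q (dom1 I d)"
    "invertible2 C (\<theta> d)"
  using edges.modificationD(1-3)[OF edges.is_iso_modification[OF theta_iso], of d]
    edges.is_iso_inverse2(2)[OF theta_iso, of d] assms
  by (simp_all add: post_cocone_def d0_cocone_def)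

lemma theta'_simps [simp]:
  assumes "d \<in> \<Sigma>"
  shows "\<theta>' d \<in> Two C" "dom2 C (\<theta>' d) = D1 X \<cdot> leg r d"
    "cod2 C (\<theta>' d) = leg q (cod1 I d) \<cdot> onOne F d" "invertible2 C (\<theta>' d)"
  using edges.modificationD(1-3)[OF edges.is_iso_modification[OF theta'_iso], of d]
    edges.is_iso_inverse2(2)[OF theta'_iso, of d] assms
  by (simp_all add: post_cocone_def d1_cocone_def)

lemma kappa_simps [simp]:
  assumes "i \<in> Obj I"
  shows "\<kappa> i \<in> Two C" "dom2 C (\<kappa> i) = U X \<cdot> leg q i" "cod2 C (\<kappa> i) = leg r (id1 I i)"
proof -
  have "modification I C F (post_cocone I C q (U X)) (i_cocone I r) \<kappa>"
    using U_mediates base.is_iso_modification unfolding mediates_def by blast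
  then show "\<kappa> i \<in> Two C" "dom2 C (\<kappa> i) = U X \<cdot> leg q i" "cod2 C (\<kappa> i) = leg r (id1 I i)"
    using base.modificationD(1-3)[of _ _ \<kappa> i] assms
    by (simp_all add: post_cocone_def i_cocone_def)
qed

lemma rho_simps [simp]:
  assumes "triangle I \<Sigma> T"
  shows "\<rho>0 T \<in> Two C" "dom2 C (\<rho>0 T) = P0 X \<cdot> leg s T" "cod2 C (\<rho>0 T) = leg r (e0 T)"
    "\<rho>1 T \<in> Two C" "dom2 C (\<rho>1 T) = P1 X \<cdot> leg s T" "cod2 C (\<rho>1 T) = leg r (e1 T)"
    "\<rho>2 T \<in> Two C" "dom2 C (\<rho>2 T) = P2 X \<cdot> leg s T"
    "cod2 C (\<rho>2 T) = leg r (e2 T) \<cdot> onOne F (e0 T)" "invertible2 C (\<rho>2 T)"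
proof -
  let ?A = "oplax_cocone_cat (Sigma3 I \<Sigma>) C (F \<circ>\<^sub>2 Sigma2_dom I \<circ>\<^sub>2 Sigma3_p0) (X1 X)"
  have 0: "is_iso ?A (post_cocone (Sigma3 I \<Sigma>) C s (P0 X)) (p01_cocone I \<Sigma> Sigma3_p0 r) \<rho>0"
    and 1: "is_iso ?A (post_cocone (Sigma3 I \<Sigma>) C s (P1 X)) (p01_cocone I \<Sigma> Sigma3_p1 r) \<rho>1"
    and 2: "is_iso ?A (post_cocone (Sigma3 I \<Sigma>) C s (P2 X)) (p2_cocone I C F \<Sigma> r) \<rho>2"
    using P0_mediates P1_mediates P2_mediates by (simp_all add: mediates_def)
  show "\<rho>0 T \<in> Two C" "dom2 C (\<rho>0 T) = P0 X \<cdot> leg s T" "cod2 C (\<rho>0 T) = leg r (e0 T)"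
    using triangles.modificationD(1-3)[OF triangles.is_iso_modification[OF 0], of T] assms
    by (simp_all add: post_cocone_def p01_cocone_def Sigma3_p0_def)
  show "\<rho>1 T \<in> Two C" "dom2 C (\<rho>1 T) = P1 X \<cdot> leg s T" "cod2 C (\<rho>1 T) = leg r (e1 T)"
    using triangles.modificationD(1-3)[OF triangles.is_iso_modification[OF 1], of T] assms
    by (simp_all add: post_cocone_def p01_cocone_def Sigma3_p1_def)
  show "\<rho>2 T \<in> Two C" "dom2 C (\<rho>2 T) = P2 X \<cdot> leg s T"
    "cod2 C (\<rho>2 T) = leg r (e2 T) \<cdot> onOne F (e0 T)" "invertible2 C (\<rho>2 T)"
    using triangles.modificationD(1-3)[OF triangles.is_iso_modification[OF 2], of T]
      triangles.is_iso_inverse2(2)[OF 2, of T] assms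
    by (simp_all add: post_cocone_def p2_cocone_def Sigma3_p0_def Sigma3_p2_def)
qed

lemma D_hom: "D0 X \<in> hom1 C (X1 X) (X0 X)" "D1 X \<in> hom1 C (X1 X) (X0 X)"
  by (simp_all add: hom1_iff)

lemma d0_data: "edges.cocone_data (X0 X) (d0_cocone I \<Sigma> q)"
  using D0_mediates unfolding mediates_def by (blast intro: edges.oplax_cocone_data)

lemma d1_data: "edges.cocone_data (X0 X) (d1_cocone I C F \<Sigma> q)"
  using D1_mediates unfolding mediates_def by (blast intro: edges.oplax_cocone_data)

lemmas rD0_data = edges.cocone_data_post_cocone[OF r_data D_hom(1)]

lemmas rD1_data = edges.cocone_data_post_cocone[OF r_data D_hom(2)]

end

section \<open>The components of a pair (h, \<xi>)\<close>

context sigma_codescent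
begin

text \<open>This is \<xi>_d of the overview. The whiskered cell \<open>\<xi> \<rhd> leg r d\<close>
  runs between h D0 r_d and h D1 r_d; conjugation by the universal cells replaces these by h q_(dom
  d) and h q_(cod d) F d.\<close>

definition component :: "'a \<Rightarrow> 'c \<Rightarrow> 'ia \<Rightarrow> 'c" where
  "component h \<xi> d = (h \<lhd> \<theta>' d) \<bullet> (\<xi> \<rhd> leg r d) \<bullet> (h \<lhd> inv2 C (\<theta> d))"

context
  fixes B h \<xi>
  assumes h: "h \<in> hom1 C (X0 X) B" and \<xi>: "\<xi> \<in> hom2 C (h \<cdot> D0 X) (h \<cdot> D1 X)"
begin

lemma pair_simps [simp]:
  "h \<in> One C" "dom1 C h = X0 X" "cod1 C h = B"
  "\<xi> \<in> Two C" "dom2 C \<xi> = h \<cdot> D0 X" "cod2 C \<xi> = h \<cdot> D1 X"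
  using h \<xi> by (simp_all add: hom1_iff hom2_iff)

lemma component_simps [simp]:
  assumes "d \<in> \<Sigma>"
  shows "component h \<xi> d \<in> Two C" "dom2 C (component h \<xi> d) = h \<cdot> leg q (dom1 I d)"
    "cod2 C (component h \<xi> d) = h \<cdot> leg q (cod1 I d) \<cdot> onOne F d"
  using assms by (simp_all add: component_def)

text \<open>The definition with the inverse of \<theta> cleared. The diagram chases below pass
  between \<xi> and its components in this form.\<close>

lemma component_theta:
  assumes d: "d \<in> \<Sigma>"
  shows "component h \<xi> d \<bullet> (h \<lhd> \<theta> d) = (h \<lhd> \<theta>' d) \<bullet> (\<xi> \<rhd> leg r d)"
proof -
  have "(h \<lhd> inv2 C (\<theta> d)) \<bullet> (h \<lhd> \<theta> d) = id2 C (h \<cdot> D0 X \<cdot> leg r d)"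
    using d lwhisker_vcomp[of h "\<theta> d" "inv2 C (\<theta> d)"] by (simp del: lwhisker_vcomp)
  then show ?thesis using d by (simp add: component_def)
qed

text \<open>The three factors of \<open>component\<close> are each modifications on the edges: the
  inverse of \<theta> under h, \<xi> whiskered with the legs of r, and \<theta>' under h.\<close>

lemma component_modification:
  "modification (Sigma2 I \<Sigma>) C (F \<circ>\<^sub>2 Sigma2_dom I)
     (post_cocone (Sigma2 I \<Sigma>) C (d0_cocone I \<Sigma> q) h)
     (post_cocone (Sigma2 I \<Sigma>) C (d1_cocone I C F \<Sigma> q) h) (\<lambda>d\<in>\<Sigma>. component h \<xi> d)"
proof -
  let ?post = "post_cocone (Sigma2 I \<Sigma>) C" and ?mod = "modification (Sigma2 I \<Sigma>) C (F \<circ>\<^sub>2 Sigma2_dom I)"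
  have hD: "h \<cdot> D0 X \<in> hom1 C (X1 X) B" "h \<cdot> D1 X \<in> hom1 C (X1 X) B" by (simp_all add: hom1_iff)
  have m0: "?mod (?post (d0_cocone I \<Sigma> q) h) (?post r (h \<cdot> D0 X)) (\<lambda>d\<in>\<Sigma>. h \<lhd> inv2 C (\<theta> d))"
    using edges.modification_post_cocone[OF d0_data rD0_data h
        edges.is_iso_inverse_modification[OF rD0_data d0_data theta_iso]]
    unfolding edges.post_cocone_comp[OF r_data D_hom(1) h]
    by (simp cong: restrict_cong)
  have m1: "?mod (?post r (h \<cdot> D0 X)) (?post r (h \<cdot> D1 X)) (\<lambda>d\<in>\<Sigma>. \<xi> \<rhd> leg r d)"
    using edges.modification_post_modification[OF r_data hD(1) \<xi>]
    by (simp add: post_modification_def)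
  have m2: "?mod (?post r (h \<cdot> D1 X)) (?post (d1_cocone I C F \<Sigma> q) h) (\<lambda>d\<in>\<Sigma>. h \<lhd> \<theta>' d)"
    using edges.modification_post_cocone[OF rD1_data d1_data h edges.is_iso_modification[OF theta'_iso]]
    unfolding edges.post_cocone_comp[OF r_data D_hom(2) h] by simp
  note p0 = edges.cocone_data_post_cocone[OF d0_data h] and p1 = edges.cocone_data_post_cocone[OF d1_data h]
    and p2 = edges.cocone_data_post_cocone[OF r_data hD(1)]
    and p3 = edges.cocone_data_post_cocone[OF r_data hD(2)]
  show ?thesis
    using edges.modification_comp[OF p0 p2 p1 m0 edges.modification_comp[OF p2 p3 p1 m1 m2]]
    by (simp add: component_def cong: restrict_cong)
qed

lemma component_natural:
  assumes "square I \<Sigma> \<phi>"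
  shows "component h \<xi> (sq_dom \<phi>) \<bullet> (h \<lhd> transition q (sq0 \<phi>))
    = (h \<lhd> ((transition q (sq1 \<phi>) \<rhd> onOne F (sq_dom \<phi>)) \<bullet>
        (leg q (cod1 I (sq_cod \<phi>)) \<lhd> onTwo F (sq_cell \<phi>))))
      \<bullet> (component h \<xi> (sq_cod \<phi>) \<rhd> onOne F (sq0 \<phi>))"
  using edges.modificationD(4)[OF component_modification, of \<phi>] assms squareD[OF assms]
  by (simp add: post_cocone_def d0_cocone_def d1_cocone_def
      del: lwhisker_vcomp)

text \<open>On the leg at i, N1 is \<theta>' after D1 \<kappa>. Exchanging \<kappa> with \<xi> turns
  D1 \<kappa> into D0 \<kappa>, and \<open>component_theta\<close> trades \<theta>' for \<theta>,
  which reassembles N0.\<close>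

lemma N1_whisker:
  assumes i: "i \<in> Obj I"
  shows "((h \<lhd> N1 X) \<bullet> (\<xi> \<rhd> U X)) \<rhd> leg q i
    = component h \<xi> (id1 I i) \<bullet> ((h \<lhd> N0 X) \<rhd> leg q i)"
proof -
  have ex: "(\<xi> \<rhd> leg r (id1 I i)) \<bullet> (h \<lhd> D0 X \<lhd> \<kappa> i) = (h \<lhd> D1 X \<lhd> \<kappa> i) \<bullet> (\<xi> \<rhd> U X \<rhd> leg q i)"
    using whisker_exchange[of "\<kappa> i" "U X \<cdot> leg q i" "leg r (id1 I i)" \<xi> "h \<cdot> D0 X" "h \<cdot> D1 X"] i
    by (simp add: hom2_iff)
  have "((h \<lhd> N1 X) \<bullet> (\<xi> \<rhd> U X)) \<rhd> leg q i
      = (h \<lhd> (N1 X \<rhd> leg q i)) \<bullet> (\<xi> \<rhd> U X \<rhd> leg q i)"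
    using i by simp
  also have "\<dots> = (h \<lhd> \<theta>' (id1 I i)) \<bullet> (h \<lhd> D1 X \<lhd> \<kappa> i) \<bullet> (\<xi> \<rhd> U X \<rhd> leg q i)"
    using i by (simp add: N1_eq)
  also have "\<dots> = ((h \<lhd> \<theta>' (id1 I i)) \<bullet> (\<xi> \<rhd> leg r (id1 I i))) \<bullet> (h \<lhd> D0 X \<lhd> \<kappa> i)"
    unfolding ex[symmetric] using i by simp
  also have "\<dots> = component h \<xi> (id1 I i) \<bullet> (h \<lhd> (N0 X \<rhd> leg q i))"
    unfolding component_theta[OF Sigma_simps(2)[OF i], symmetric] using i by (simp add: N0_eq)
  finally show ?thesis using i by simp
qed

text \<open>N0 is invertible and cancels from \<open>N1_whisker\<close>. Both directions matter: a
  pair satisfying the unit law has trivial components at identities, and trivial components yield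
  the unit law.\<close>

lemma component_id_iff:
  assumes i: "i \<in> Obj I"
  shows "((h \<lhd> N1 X) \<bullet> (\<xi> \<rhd> U X)) \<rhd> leg q i = (h \<lhd> N0 X) \<rhd> leg q i
    \<longleftrightarrow> component h \<xi> (id1 I i) = id2 C (h \<cdot> leg q i)"
proof -
  have inv: "invertible2 C ((h \<lhd> N0 X) \<rhd> leg q i)"
    by (intro invertible2_rwhisker invertible2_lwhisker) (use i in simp_all)
  have "component h \<xi> (id1 I i) = id2 C (h \<cdot> leg q i)"
    if "component h \<xi> (id1 I i) \<bullet> ((h \<lhd> N0 X) \<rhd> leg q i)
      = id2 C (h \<cdot> leg q i) \<bullet> ((h \<lhd> N0 X) \<rhd> leg q i)"
    by (rule vcomp_right_cancel[OF inv _ _ _ _ that]) (use i in simp_all)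
  moreover have "id2 C (h \<cdot> leg q i) \<bullet> ((h \<lhd> N0 X) \<rhd> leg q i) = (h \<lhd> N0 X) \<rhd> leg q i"
    using i by simp
  ultimately show ?thesis unfolding N1_whisker[OF i] by metis
qed

text \<open>The two squares relating an edge \<open>d\<close> to the identities at its ends express
  that \<open>component h \<xi> d\<close> is a left and a right inverse of the whiskered
  transition 2-cell at \<open>d\<close>.\<close>

lemma component_inverse:
  assumes id: "\<And>i. i \<in> Obj I \<Longrightarrow> component h \<xi> (id1 I i) = id2 C (h \<cdot> leg q i)" and d: "d \<in> \<Sigma>"
  shows "inverse2 C (h \<lhd> transition q d) (component h \<xi> d)"
proof -
  let ?i = "dom1 I d" and ?j = "cod1 I d"
  let ?to = "\<lparr>sq_dom = d, sq_cod = id1 I ?j, sq0 = d, sq1 = id1 I ?j, sq_cell = id2 I d\<rparr>"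
  let ?from = "\<lparr>sq_dom = id1 I ?i, sq_cod = d, sq0 = id1 I ?i, sq1 = d, sq_cell = id2 I d\<rparr>"
  have inv: "invertible2 I (id2 I d)"
    by (rule I.inverse2_imp_invertible2[of _ "id2 I d"]) (use d in \<open>simp_all add: inverse2_def hom2_iff\<close>)
  have to: "square I \<Sigma> ?to" and "from": "square I \<Sigma> ?from"
    using d inv by (simp_all add: square_def hom1_iff hom2_iff)
  \<comment> \<open>At \<open>?to\<close> the right-hand side of naturality consists of transitions,
    2-cells and components at identities, so it collapses. At \<open>?from\<close> the left-hand
    side collapses instead, leaving the other composite.\<close>
  have "component h \<xi> d \<bullet> (h \<lhd> transition q d) = id2 C (h \<cdot> leg q ?j \<cdot> onOne F d)"
    using component_natural[OF to] d by (simp add: id)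
  moreover have "(h \<lhd> transition q d) \<bullet> component h \<xi> d = id2 C (h \<cdot> leg q ?i)"
    using component_natural[OF "from"] d by (simp add: id)
  ultimately show ?thesis using d by (simp add: inverse2_def hom2_iff)
qed

text \<open>One side of the cocycle equation at the triangle T, followed by the universal cells at
  its target. The formula for T12 introduces \<theta>' and \<rho>1 at the edge \<open>e1 T\<close>,
  exchange moves \<rho>1 across \<xi>, and the formula for T01 returns to
  \<open>e0 T\<close>.\<close>

lemma pseudocoequalizes_left:
  assumes T: "triangle I \<Sigma> T"
  shows "((h \<lhd> (\<theta>' (e2 T) \<rhd> onOne F (e0 T))) \<bullet> (h \<lhd> D1 X \<lhd> \<rho>2 T))
      \<bullet> (((h \<lhd> T12 X) \<bullet> (\<xi> \<rhd> P1 X) \<bullet> (h \<lhd> T01 X)) \<rhd> leg s T)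
    = ((h \<lhd> leg q (cod1 I (e1 T)) \<lhd> inv2 C (onTwo F (face T))) \<bullet> component h \<xi> (e1 T))
      \<bullet> ((h \<lhd> \<theta> (e0 T)) \<bullet> (h \<lhd> D0 X \<lhd> \<rho>0 T))"
proof -
  note [simp] = triangleD[OF T] functor_invertible2
  have T': "T \<in> Obj (Sigma3 I \<Sigma>)" using T by simp
  have 12: "(h \<lhd> (\<theta>' (e2 T) \<rhd> onOne F (e0 T))) \<bullet> (h \<lhd> D1 X \<lhd> \<rho>2 T) \<bullet> (h \<lhd> (T12 X \<rhd> leg s T))
      = (h \<lhd> leg q (cod1 I (e1 T)) \<lhd> inv2 C (onTwo F (face T))) \<bullet> (h \<lhd> \<theta>' (e1 T)) \<bullet> (h \<lhd> D1 X \<lhd> \<rho>1 T)"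
    using arg_cong[OF bspec[OF T12_eq T'], of "\<lambda>\<alpha>. h \<lhd> \<alpha>"] T by simp
  have 01: "(h \<lhd> \<theta> (e1 T)) \<bullet> (h \<lhd> D0 X \<lhd> \<rho>1 T) \<bullet> (h \<lhd> (T01 X \<rhd> leg s T))
      = (h \<lhd> \<theta> (e0 T)) \<bullet> (h \<lhd> D0 X \<lhd> \<rho>0 T)"
    using arg_cong[OF bspec[OF T01_eq T'], of "\<lambda>\<alpha>. h \<lhd> \<alpha>"] T by simp
  have ex: "(\<xi> \<rhd> leg r (e1 T)) \<bullet> (h \<lhd> D0 X \<lhd> \<rho>1 T) = (h \<lhd> D1 X \<lhd> \<rho>1 T) \<bullet> (\<xi> \<rhd> P1 X \<rhd> leg s T)"
    using whisker_exchange[of "\<rho>1 T" "P1 X \<cdot> leg s T" "leg r (e1 T)" \<xi> "h \<cdot> D0 X" "h \<cdot> D1 X"] T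
    by (simp add: hom2_iff)
  let ?f = "h \<lhd> leg q (cod1 I (e1 T)) \<lhd> inv2 C (onTwo F (face T))"
  let ?t = "h \<lhd> (T01 X \<rhd> leg s T)"
  have "((h \<lhd> (\<theta>' (e2 T) \<rhd> onOne F (e0 T))) \<bullet> (h \<lhd> D1 X \<lhd> \<rho>2 T))
      \<bullet> (((h \<lhd> T12 X) \<bullet> (\<xi> \<rhd> P1 X) \<bullet> (h \<lhd> T01 X)) \<rhd> leg s T)
    = ((h \<lhd> (\<theta>' (e2 T) \<rhd> onOne F (e0 T))) \<bullet> (h \<lhd> D1 X \<lhd> \<rho>2 T) \<bullet> (h \<lhd> (T12 X \<rhd> leg s T)))
      \<bullet> (\<xi> \<rhd> P1 X \<rhd> leg s T) \<bullet> ?t"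
    using T by simp
  also have "\<dots> = ?f \<bullet> (h \<lhd> \<theta>' (e1 T)) \<bullet> ((h \<lhd> D1 X \<lhd> \<rho>1 T) \<bullet> (\<xi> \<rhd> P1 X \<rhd> leg s T)) \<bullet> ?t"
    unfolding 12 using T by simp
  also have "\<dots> = ?f \<bullet> ((h \<lhd> \<theta>' (e1 T)) \<bullet> (\<xi> \<rhd> leg r (e1 T))) \<bullet> (h \<lhd> D0 X \<lhd> \<rho>1 T) \<bullet> ?t"
    unfolding ex[symmetric] using T by simp
  also have "\<dots> = ?f \<bullet> component h \<xi> (e1 T) \<bullet> ((h \<lhd> \<theta> (e1 T)) \<bullet> (h \<lhd> D0 X \<lhd> \<rho>1 T) \<bullet> ?t)"
    unfolding component_theta[OF triangleD(2)[OF T], symmetric] using T by simp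
  finally show ?thesis unfolding 01 using T by simp
qed

text \<open>The other side, with the same cells added in front and the same cells left at the end.
  Comparing with \<open>pseudocoequalizes_left\<close> thus reduces the cocycle equation at T to
  F(face)^-1 after \<xi>_(e1) being \<xi>_(e2) F(e0) after \<xi>_(e0), with the evident
  whiskerings.\<close>

lemma pseudocoequalizes_right:
  assumes T: "triangle I \<Sigma> T"
  shows "((h \<lhd> (\<theta>' (e2 T) \<rhd> onOne F (e0 T))) \<bullet> (h \<lhd> D1 X \<lhd> \<rho>2 T))
      \<bullet> (((\<xi> \<rhd> P2 X) \<bullet> (h \<lhd> T02 X) \<bullet> (\<xi> \<rhd> P0 X)) \<rhd> leg s T)
    = ((component h \<xi> (e2 T) \<rhd> onOne F (e0 T)) \<bullet> component h \<xi> (e0 T))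
      \<bullet> ((h \<lhd> \<theta> (e0 T)) \<bullet> (h \<lhd> D0 X \<lhd> \<rho>0 T))"
proof -
  note [simp] = triangleD[OF T]
  have T': "T \<in> Obj (Sigma3 I \<Sigma>)" using T by simp
  have 02: "(h \<lhd> (\<theta> (e2 T) \<rhd> onOne F (e0 T))) \<bullet> (h \<lhd> D0 X \<lhd> \<rho>2 T) \<bullet> (h \<lhd> (T02 X \<rhd> leg s T))
      = (h \<lhd> \<theta>' (e0 T)) \<bullet> (h \<lhd> D1 X \<lhd> \<rho>0 T)"
    using arg_cong[OF bspec[OF T02_eq T'], of "\<lambda>\<alpha>. h \<lhd> \<alpha>"] T by simp
  have ex2: "(\<xi> \<rhd> leg r (e2 T) \<rhd> onOne F (e0 T)) \<bullet> (h \<lhd> D0 X \<lhd> \<rho>2 T)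
      = (h \<lhd> D1 X \<lhd> \<rho>2 T) \<bullet> (\<xi> \<rhd> P2 X \<rhd> leg s T)"
    using whisker_exchange[of "\<rho>2 T" "P2 X \<cdot> leg s T" "leg r (e2 T) \<cdot> onOne F (e0 T)" \<xi>
        "h \<cdot> D0 X" "h \<cdot> D1 X"] T
    by (simp add: hom2_iff)
  have ex0: "(\<xi> \<rhd> leg r (e0 T)) \<bullet> (h \<lhd> D0 X \<lhd> \<rho>0 T) = (h \<lhd> D1 X \<lhd> \<rho>0 T) \<bullet> (\<xi> \<rhd> P0 X \<rhd> leg s T)"
    using whisker_exchange[of "\<rho>0 T" "P0 X \<cdot> leg s T" "leg r (e0 T)" \<xi> "h \<cdot> D0 X" "h \<cdot> D1 X"] T
    by (simp add: hom2_iff)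
  have c2: "(component h \<xi> (e2 T) \<rhd> onOne F (e0 T)) \<bullet> (h \<lhd> (\<theta> (e2 T) \<rhd> onOne F (e0 T)))
      = (h \<lhd> (\<theta>' (e2 T) \<rhd> onOne F (e0 T))) \<bullet> (\<xi> \<rhd> leg r (e2 T) \<rhd> onOne F (e0 T))"
    using arg_cong[OF component_theta[OF triangleD(3)[OF T]], of "\<lambda>\<alpha>. \<alpha> \<rhd> onOne F (e0 T)"] T
    by simp
  let ?t = "h \<lhd> (T02 X \<rhd> leg s T)" and ?x = "\<xi> \<rhd> P0 X \<rhd> leg s T"
  let ?c2 = "component h \<xi> (e2 T) \<rhd> onOne F (e0 T)"
  have "((h \<lhd> (\<theta>' (e2 T) \<rhd> onOne F (e0 T))) \<bullet> (h \<lhd> D1 X \<lhd> \<rho>2 T))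
      \<bullet> (((\<xi> \<rhd> P2 X) \<bullet> (h \<lhd> T02 X) \<bullet> (\<xi> \<rhd> P0 X)) \<rhd> leg s T)
    = (h \<lhd> (\<theta>' (e2 T) \<rhd> onOne F (e0 T))) \<bullet> ((h \<lhd> D1 X \<lhd> \<rho>2 T) \<bullet> (\<xi> \<rhd> P2 X \<rhd> leg s T)) \<bullet> ?t \<bullet> ?x"
    using T by simp
  also have "\<dots> = ((h \<lhd> (\<theta>' (e2 T) \<rhd> onOne F (e0 T))) \<bullet> (\<xi> \<rhd> leg r (e2 T) \<rhd> onOne F (e0 T)))
      \<bullet> (h \<lhd> D0 X \<lhd> \<rho>2 T) \<bullet> ?t \<bullet> ?x"
    unfolding ex2[symmetric] using T by simp
  also have "\<dots> = ?c2 \<bullet> ((h \<lhd> (\<theta> (e2 T) \<rhd> onOne F (e0 T))) \<bullet> (h \<lhd> D0 X \<lhd> \<rho>2 T) \<bullet> ?t) \<bullet> ?x"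
    unfolding c2[symmetric] using T by simp
  also have "\<dots> = ?c2 \<bullet> (h \<lhd> \<theta>' (e0 T)) \<bullet> ((h \<lhd> D1 X \<lhd> \<rho>0 T) \<bullet> ?x)"
    unfolding 02 using T by simp
  also have "\<dots> = ?c2 \<bullet> ((h \<lhd> \<theta>' (e0 T)) \<bullet> (\<xi> \<rhd> leg r (e0 T))) \<bullet> (h \<lhd> D0 X \<lhd> \<rho>0 T)"
    unfolding ex0[symmetric] using T by simp
  finally show ?thesis
    unfolding component_theta[OF triangleD(1)[OF T], symmetric] using T by simp
qed

lemma pseudocoequalizesI:
  assumes inv: "\<And>d. d \<in> \<Sigma> \<Longrightarrow> inverse2 C (h \<lhd> transition q d) (component h \<xi> d)"
  shows "pseudocoequalizes C X B (h, \<xi>)"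
proof -
  have inv_xi: "invertible2 C \<xi>"
  proof (rule edges.bicolimit_invertible[OF r_bicolimit, of "h \<cdot> D0 X" B])
    fix d assume "d \<in> Obj (Sigma2 I \<Sigma>)"
    then have d: "d \<in> \<Sigma>" by simp
    have "invertible2 C (component h \<xi> d)"
      by (rule inverse2_imp_invertible2[OF _ inverse2_sym[OF _ inv[OF d]]]) (use d in simp_all)
    then have "invertible2 C (component h \<xi> d \<bullet> (h \<lhd> \<theta> d))"
      using d by (intro invertible2_vcomp invertible2_lwhisker) simp_all
    then have c: "invertible2 C ((h \<lhd> \<theta>' d) \<bullet> (\<xi> \<rhd> leg r d))"
      unfolding component_theta[OF d] .
    have i': "invertible2 C (h \<lhd> \<theta>' d)" using d by (intro invertible2_lwhisker) simp_all
    \<comment> \<open>The universal cell \<theta>' is stripped off on the left, so that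
      invertibility of the component becomes invertibility of the whiskered \<xi>.\<close>
    have "invertible2 C (inv2 C (h \<lhd> \<theta>' d) \<bullet> (h \<lhd> \<theta>' d) \<bullet> (\<xi> \<rhd> leg r d))"
      by (rule invertible2_vcomp[OF c invertible2_inv2[OF i']]) (use d i' in simp_all)
    moreover have "inv2 C (h \<lhd> \<theta>' d) \<bullet> (h \<lhd> \<theta>' d) \<bullet> (\<xi> \<rhd> leg r d) = \<xi> \<rhd> leg r d"
      using d i' vcomp_assoc[of "\<xi> \<rhd> leg r d" "h \<lhd> \<theta>' d" "inv2 C (h \<lhd> \<theta>' d)"]
      by (simp del: vcomp_assoc)
    ultimately show "invertible2 C (\<xi> \<rhd> leg r d)" by simp
  qed (use \<xi> in \<open>simp_all add: hom1_iff\<close>)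
  have unit: "(h \<lhd> N1 X) \<bullet> (\<xi> \<rhd> U X) = h \<lhd> N0 X"
  proof (rule base.bicolimit_faithful[OF q_bicolimit])
    fix i assume i: "i \<in> Obj I"
    \<comment> \<open>The transition of q at an identity is an identity, and an identity has only
      itself as inverse; hence the component is trivial.\<close>
    have "inverse2 C (id2 C (h \<cdot> leg q i)) (component h \<xi> (id1 I i))"
      using inv[of "id1 I i"] i by simp
    moreover have "inverse2 C (id2 C (h \<cdot> leg q i)) (id2 C (h \<cdot> leg q i))"
      using i by (simp add: inverse2_def hom2_iff)
    ultimately have "component h \<xi> (id1 I i) = id2 C (h \<cdot> leg q i)"
      using i by (intro inverse2_unique) simp_all
    then show "((h \<lhd> N1 X) \<bullet> (\<xi> \<rhd> U X)) \<rhd> leg q i = (h \<lhd> N0 X) \<rhd> leg q i"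
      using component_id_iff[OF i] by simp
  qed (simp_all add: hom1_iff hom2_iff)
  have cocycle: "(h \<lhd> T12 X) \<bullet> (\<xi> \<rhd> P1 X) \<bullet> (h \<lhd> T01 X) = (\<xi> \<rhd> P2 X) \<bullet> (h \<lhd> T02 X) \<bullet> (\<xi> \<rhd> P0 X)"
  proof (rule triangles.bicolimit_faithful[OF s_bicolimit])
    fix T assume "T \<in> Obj (Sigma3 I \<Sigma>)"
    then have T: "triangle I \<Sigma> T" by simp
    note [simp] = triangleD[OF T] functor_invertible2
    let ?L = "(h \<lhd> T12 X) \<bullet> (\<xi> \<rhd> P1 X) \<bullet> (h \<lhd> T01 X)"
    let ?R = "(\<xi> \<rhd> P2 X) \<bullet> (h \<lhd> T02 X) \<bullet> (\<xi> \<rhd> P0 X)"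
    let ?q = "leg q (cod1 I (e1 T))"
    \<comment> \<open>Compatibility of q with the 2-cell \<open>face T\<close>, whose source
      \<open>e2 T\<close> after \<open>e0 T\<close> is expanded by compatibility with composition.
      Under h, the inverses of the two sides are the two sides of the cocycle condition for
      components.\<close>
    have "transition q (e1 T) \<bullet> (?q \<lhd> onTwo F (face T))
        = transition q (e0 T) \<bullet> (transition q (e2 T) \<rhd> onOne F (e0 T))"
      using q_oplax_2cell[of "face T"] by simp
    from arg_cong[OF this, of "\<lambda>\<alpha>. h \<lhd> \<alpha>"]
    have eq: "(h \<lhd> transition q (e1 T)) \<bullet> (h \<lhd> ?q \<lhd> onTwo F (face T))
        = (h \<lhd> transition q (e0 T)) \<bullet> (h \<lhd> (transition q (e2 T) \<rhd> onOne F (e0 T)))"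
      by simp
    have "inverse2 C (?q \<lhd> onTwo F (face T)) (?q \<lhd> inv2 C (onTwo F (face T)))"
      by (rule inverse2_lwhisker[OF _ inverse2_inv2]) simp_all
    then have f: "inverse2 C (h \<lhd> ?q \<lhd> onTwo F (face T)) (h \<lhd> ?q \<lhd> inv2 C (onTwo F (face T)))"
      by (rule inverse2_lwhisker[rotated]) simp_all
    have L: "inverse2 C ((h \<lhd> transition q (e1 T)) \<bullet> (h \<lhd> ?q \<lhd> onTwo F (face T)))
        ((h \<lhd> ?q \<lhd> inv2 C (onTwo F (face T))) \<bullet> component h \<xi> (e1 T))"
      by (rule inverse2_vcomp[OF _ f _ inv]) simp_all
    have "inverse2 C ((h \<lhd> transition q (e2 T)) \<rhd> onOne F (e0 T))
        (component h \<xi> (e2 T) \<rhd> onOne F (e0 T))"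
      by (rule inverse2_rwhisker[OF _ inv]) simp_all
    then have 2: "inverse2 C (h \<lhd> (transition q (e2 T) \<rhd> onOne F (e0 T)))
        (component h \<xi> (e2 T) \<rhd> onOne F (e0 T))"
      by simp
    have R: "inverse2 C ((h \<lhd> transition q (e0 T)) \<bullet> (h \<lhd> (transition q (e2 T) \<rhd> onOne F (e0 T))))
        ((component h \<xi> (e2 T) \<rhd> onOne F (e0 T)) \<bullet> component h \<xi> (e0 T))"
      by (rule inverse2_vcomp[OF _ 2 _ inv]) simp_all
    have "(h \<lhd> ?q \<lhd> inv2 C (onTwo F (face T))) \<bullet> component h \<xi> (e1 T)
        = (component h \<xi> (e2 T) \<rhd> onOne F (e0 T)) \<bullet> component h \<xi> (e0 T)"
      by (rule inverse2_unique[OF _ L R[folded eq]]) simp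
    then have cancel: "((h \<lhd> (\<theta>' (e2 T) \<rhd> onOne F (e0 T))) \<bullet> (h \<lhd> D1 X \<lhd> \<rho>2 T)) \<bullet> (?L \<rhd> leg s T)
        = ((h \<lhd> (\<theta>' (e2 T) \<rhd> onOne F (e0 T))) \<bullet> (h \<lhd> D1 X \<lhd> \<rho>2 T)) \<bullet> (?R \<rhd> leg s T)"
      unfolding pseudocoequalizes_left[OF T] pseudocoequalizes_right[OF T] by simp
    have i: "invertible2 C ((h \<lhd> (\<theta>' (e2 T) \<rhd> onOne F (e0 T))) \<bullet> (h \<lhd> D1 X \<lhd> \<rho>2 T))"
      using T by (intro invertible2_vcomp invertible2_lwhisker invertible2_rwhisker) simp_all
    show "?L \<rhd> leg s T = ?R \<rhd> leg s T"
      by (rule vcomp_left_cancel[OF i _ _ _ _ cancel]) (use T in simp_all)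
  qed (simp_all add: hom1_iff hom2_iff)
  have "B \<in> Obj C" using h cod1_in_Obj[of h] by (simp add: hom1_iff)
  then show ?thesis
    unfolding pseudocoequalizes_def using h \<xi> inv_xi unit cocycle by simp
qed

text \<open>The unit equation trivializes the components at identities, which is what
  \<open>component_inverse\<close> asks for.\<close>

lemma pseudocoequalizes_component:
  assumes "pseudocoequalizes C X B (h, \<xi>)" "d \<in> \<Sigma>"
  shows "inverse2 C (h \<lhd> transition q d) (component h \<xi> d)"
proof (rule component_inverse[OF _ assms(2)])
  have "(h \<lhd> N1 X) \<bullet> (\<xi> \<rhd> U X) = h \<lhd> N0 X" using assms by (simp add: pseudocoequalizes_def)
  then show "component h \<xi> (id1 I i) = id2 C (h \<cdot> leg q i)" if "i \<in> Obj I" for i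
    using component_id_iff[OF that] by simp
qed

end

text \<open>Outside the context these rules have premises with an undetermined tip \<open>B\<close> and loop.\<close>

declare pair_simps [simp del] component_simps [simp del]

end

section \<open>Pseudocoequalizing pairs against sigma-cocones\<close>

context sigma_codescent
begin

lemma pseudocoequalizesD:
  assumes "pseudocoequalizes C X B (h, \<xi>)"
  shows "h \<in> hom1 C (X0 X) B" "\<xi> \<in> hom2 C (h \<cdot> D0 X) (h \<cdot> D1 X)"
  using assms unfolding pseudocoequalizes_def prod.case by blast+

lemma sigma_cocone_of_pseudocoequalizing:
  assumes p: "pseudocoequalizes C X B (h, \<xi>)"
  shows "sigma_cocone I C F \<Sigma> B (post_cocone I C q h)"
  unfolding sigma_cocone_def
proof (intro conjI ballI)
  note h = pseudocoequalizesD[OF p]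
  show "oplax_cocone I C F B (post_cocone I C q h)"
    by (rule base.bicolimit_post_cocone[OF q_bicolimit h(1)])
  fix d assume d: "d \<in> \<Sigma>"
  have "invertible2 C (h \<lhd> transition q d)"
    by (rule inverse2_imp_invertible2[OF _ pseudocoequalizes_component[OF h p d]])
      (use h d in \<open>simp add: hom1_iff\<close>)
  then show "invertible2 C (transition (post_cocone I C q h) d)"
    using d by (simp add: post_cocone_def)
qed

text \<open>The inverses of the h q_d are transported along \<theta> and \<theta>' to a modification
  on the cocone r, and fullness of the comparison for r produces \<xi>.\<close>

lemma pseudocoequalizing_of_invertible:
  assumes h: "h \<in> hom1 C (X0 X) B" and inv: "\<And>d. d \<in> \<Sigma> \<Longrightarrow> invertible2 C (h \<lhd> transition q d)"
  obtains \<xi> where "pseudocoequalizes C X B (h, \<xi>)"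
proof -
  let ?post = "post_cocone (Sigma2 I \<Sigma>) C" and ?mod = "modification (Sigma2 I \<Sigma>) C (F \<circ>\<^sub>2 Sigma2_dom I)"
  have [simp]: "h \<in> One C" "dom1 C h = X0 X" "cod1 C h = B" using h by (simp_all add: hom1_iff)
  have hD: "h \<cdot> D0 X \<in> hom1 C (X1 X) B" "h \<cdot> D1 X \<in> hom1 C (X1 X) B" by (simp_all add: hom1_iff)
  note p0 = edges.cocone_data_post_cocone[OF d0_data h] and p1 = edges.cocone_data_post_cocone[OF d1_data h]
    and p2 = edges.cocone_data_post_cocone[OF r_data hD(1)]
    and p3 = edges.cocone_data_post_cocone[OF r_data hD(2)]
  \<comment> \<open>The transitions of q form a modification on the edges before any inversion. At a
    square, compatibility is the law of q for the 2-cell \<open>sq_cell\<close>, with the composites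
    at both ends expanded.\<close>
  have tq: "?mod (d1_cocone I C F \<Sigma> q) (d0_cocone I \<Sigma> q) (\<lambda>d\<in>Obj (Sigma2 I \<Sigma>). transition q d)"
  proof (rule edges.modificationI)
    show "transition q d \<in> hom2 C (leg (d1_cocone I C F \<Sigma> q) d) (leg (d0_cocone I \<Sigma> q) d)"
      if "d \<in> Obj (Sigma2 I \<Sigma>)" for d
      using that by (simp add: hom2_iff d0_cocone_def d1_cocone_def)
    fix \<phi> assume "\<phi> \<in> One (Sigma2 I \<Sigma>)"
    then have \<phi>: "square I \<Sigma> \<phi>" by simp
    note [simp] = squareD[OF \<phi>]
    have "transition q (sq1 \<phi> \<cdot>\<^bsub>I\<^esub> sq_dom \<phi>) \<bullet> (leg q (cod1 I (sq_cod \<phi>)) \<lhd> onTwo F (sq_cell \<phi>))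
        = transition q (sq_cod \<phi> \<cdot>\<^bsub>I\<^esub> sq0 \<phi>)"
      using q_oplax_2cell[of "sq_cell \<phi>"] by (simp del: q_oplax)
    then show "transition q (dom1 (Sigma2 I \<Sigma>) \<phi>) \<bullet> transition (d1_cocone I C F \<Sigma> q) \<phi>
        = transition (d0_cocone I \<Sigma> q) \<phi>
          \<bullet> (transition q (cod1 (Sigma2 I \<Sigma>) \<phi>) \<rhd> onOne (F \<circ>\<^sub>2 Sigma2_dom I) \<phi>)"
      using \<phi> by (simp add: d0_cocone_def d1_cocone_def)
  qed
  have "?mod (?post (d1_cocone I C F \<Sigma> q) h) (?post (d0_cocone I \<Sigma> q) h)
      (\<lambda>d\<in>\<Sigma>. h \<lhd> transition q d)"
    using edges.modification_post_cocone[OF d1_data d0_data h tq] by (simp cong: restrict_cong)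
  then have m1: "?mod (?post (d0_cocone I \<Sigma> q) h) (?post (d1_cocone I C F \<Sigma> q) h)
      (\<lambda>d\<in>\<Sigma>. inv2 C (h \<lhd> transition q d))"
    using edges.modification_inverse[OF p1 p0, of _ "\<lambda>d. inv2 C (h \<lhd> transition q d)"] inv
    by (simp add: inverse2_inv2)
  have m0: "?mod (?post r (h \<cdot> D0 X)) (?post (d0_cocone I \<Sigma> q) h) (\<lambda>d\<in>\<Sigma>. h \<lhd> \<theta> d)"
    using edges.modification_post_cocone[OF rD0_data d0_data h edges.is_iso_modification[OF theta_iso]]
    unfolding edges.post_cocone_comp[OF r_data D_hom(1) h] by simp
  have m2: "?mod (?post (d1_cocone I C F \<Sigma> q) h) (?post r (h \<cdot> D1 X)) (\<lambda>d\<in>\<Sigma>. h \<lhd> inv2 C (\<theta>' d))"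
    using edges.modification_post_cocone[OF d1_data rD1_data h
        edges.is_iso_inverse_modification[OF rD1_data d1_data theta'_iso]]
    unfolding edges.post_cocone_comp[OF r_data D_hom(2) h]
    by (simp cong: restrict_cong)
  have "?mod (?post r (h \<cdot> D0 X)) (?post r (h \<cdot> D1 X))
      (\<lambda>d\<in>\<Sigma>. (h \<lhd> inv2 C (\<theta>' d)) \<bullet> inv2 C (h \<lhd> transition q d) \<bullet> (h \<lhd> \<theta> d))"
    using edges.modification_comp[OF p2 p1 p3 edges.modification_comp[OF p2 p0 p1 m0 m1] m2]
    by (simp cong: restrict_cong)
  then obtain \<xi> where \<xi>: "\<xi> \<in> hom2 C (h \<cdot> D0 X) (h \<cdot> D1 X)"
    and eq: "post_modification (Sigma2 I \<Sigma>) C r \<xi>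
      = (\<lambda>d\<in>\<Sigma>. (h \<lhd> inv2 C (\<theta>' d)) \<bullet> inv2 C (h \<lhd> transition q d) \<bullet> (h \<lhd> \<theta> d))"
    by (rule edges.bicolimit_full[OF r_bicolimit hD])
  \<comment> \<open>The conjugation in \<open>component\<close> undoes exactly the one used to build
    \<xi>.\<close>
  have "component h \<xi> d = inv2 C (h \<lhd> transition q d)" if d: "d \<in> \<Sigma>" for d
  proof -
    note [simp] = inv[OF d]
    have 1: "\<xi> \<rhd> leg r d = (h \<lhd> inv2 C (\<theta>' d)) \<bullet> inv2 C (h \<lhd> transition q d) \<bullet> (h \<lhd> \<theta> d)"
      using fun_cong[OF eq, of d] d by (simp add: post_modification_def)
    have 2: "(h \<lhd> \<theta>' d) \<bullet> (h \<lhd> inv2 C (\<theta>' d)) = id2 C (h \<cdot> leg q (cod1 I d) \<cdot> onOne F d)"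
      "(h \<lhd> \<theta> d) \<bullet> (h \<lhd> inv2 C (\<theta> d)) = id2 C (h \<cdot> leg q (dom1 I d))"
      using d lwhisker_vcomp[of h "inv2 C (\<theta>' d)" "\<theta>' d"] lwhisker_vcomp[of h "inv2 C (\<theta> d)" "\<theta> d"]
      by (simp_all del: lwhisker_vcomp)
    have "component h \<xi> d = ((h \<lhd> \<theta>' d) \<bullet> (h \<lhd> inv2 C (\<theta>' d)))
        \<bullet> inv2 C (h \<lhd> transition q d) \<bullet> ((h \<lhd> \<theta> d) \<bullet> (h \<lhd> inv2 C (\<theta> d)))"
      unfolding component_def 1 using d by simp
    then show ?thesis unfolding 2 using d by simp
  qed
  then have "pseudocoequalizes C X B (h, \<xi>)"
    using inv by (intro pseudocoequalizesI[OF h \<xi>]) (simp add: inverse2_inv2)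
  then show ?thesis by (rule that)
qed

text \<open>Any 2-cell \<alpha> : h => h' is natural with respect to q_d. Since \<xi>_d and \<xi>'_d
  are inverse to the whiskered q_d, \<alpha> also commutes with them, and \<theta>, \<theta>' carry
  this back to the legs of r.\<close>

lemma pseudocoequalizing_morphism:
  assumes p: "pseudocoequalizes C X B (h, \<xi>)" and p': "pseudocoequalizes C X B (h', \<xi>')"
    and \<alpha>: "\<alpha> \<in> hom2 C h h'"
  shows "\<xi>' \<bullet> (\<alpha> \<rhd> D0 X) = (\<alpha> \<rhd> D1 X) \<bullet> \<xi>"
proof (rule edges.bicolimit_faithful[OF r_bicolimit])
  note h = pseudocoequalizesD[OF p] and h' = pseudocoequalizesD[OF p']
  note [simp] = pair_simps[OF h] pair_simps[OF h'] component_simps[OF h] component_simps[OF h']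
  have [simp]: "\<alpha> \<in> Two C" "dom2 C \<alpha> = h" "cod2 C \<alpha> = h'" using \<alpha> by (simp_all add: hom2_iff)
  show "h \<cdot> D0 X \<in> hom1 C (X1 X) B" by (simp add: hom1_iff)
  show "\<xi>' \<bullet> (\<alpha> \<rhd> D0 X) \<in> hom2 C (h \<cdot> D0 X) (h' \<cdot> D1 X)"
    "(\<alpha> \<rhd> D1 X) \<bullet> \<xi> \<in> hom2 C (h \<cdot> D0 X) (h' \<cdot> D1 X)" by (simp_all add: hom2_iff)
  fix d assume "d \<in> Obj (Sigma2 I \<Sigma>)"
  then have d: "d \<in> \<Sigma>" by simp
  let ?x = "component h \<xi> d" and ?x' = "component h' \<xi>' d"
  let ?a0 = "\<alpha> \<rhd> leg q (dom1 I d)" and ?a1 = "\<alpha> \<rhd> leg q (cod1 I d) \<rhd> onOne F d"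
  have inv: "inverse2 C (h \<lhd> transition q d) ?x" "inverse2 C (h' \<lhd> transition q d) ?x'"
    using pseudocoequalizes_component[OF h p d] pseudocoequalizes_component[OF h' p' d] .
  have inv_eq: "(h \<lhd> transition q d) \<bullet> ?x = id2 C (h \<cdot> leg q (dom1 I d))"
    "?x' \<bullet> (h' \<lhd> transition q d) = id2 C (h' \<cdot> leg q (cod1 I d) \<cdot> onOne F d)"
    using inv d by (simp_all add: inverse2_def)
  have nat: "?a0 \<bullet> (h \<lhd> transition q d) = (h' \<lhd> transition q d) \<bullet> ?a1"
    using whisker_exchange[of "transition q d" _ _ \<alpha> h h'] d by (simp add: hom2_iff)
  \<comment> \<open>A trivial composite of h q_d and \<xi>_d is inserted on the right, so that
    naturality applies and \<xi>'_d cancels against h' q_d.\<close>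
  have "?x' \<bullet> ?a0 = ?x' \<bullet> (?a0 \<bullet> (h \<lhd> transition q d)) \<bullet> ?x"
    using d inv_eq(1) by simp
  also have "\<dots> = (?x' \<bullet> (h' \<lhd> transition q d)) \<bullet> ?a1 \<bullet> ?x"
    unfolding nat using d by simp
  finally have x: "?x' \<bullet> ?a0 = ?a1 \<bullet> ?x" unfolding inv_eq(2) using d by simp
  have t: "?a0 \<bullet> (h \<lhd> \<theta> d) = (h' \<lhd> \<theta> d) \<bullet> (\<alpha> \<rhd> D0 X \<rhd> leg r d)"
    using whisker_exchange[of "\<theta> d" _ _ \<alpha> h h'] d by (simp add: hom2_iff)
  have t': "?a1 \<bullet> (h \<lhd> \<theta>' d) = (h' \<lhd> \<theta>' d) \<bullet> (\<alpha> \<rhd> D1 X \<rhd> leg r d)"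
    using whisker_exchange[of "\<theta>' d" _ _ \<alpha> h h'] d by (simp add: hom2_iff)
  have "(h' \<lhd> \<theta>' d) \<bullet> ((\<xi>' \<bullet> (\<alpha> \<rhd> D0 X)) \<rhd> leg r d)
      = ((h' \<lhd> \<theta>' d) \<bullet> (\<xi>' \<rhd> leg r d)) \<bullet> (\<alpha> \<rhd> D0 X \<rhd> leg r d)"
    using d by simp
  also have "\<dots> = ?x' \<bullet> (?a0 \<bullet> (h \<lhd> \<theta> d))"
    unfolding component_theta[OF h' d, symmetric] t using d by simp
  also have "\<dots> = (?x' \<bullet> ?a0) \<bullet> (h \<lhd> \<theta> d)" using d by simp
  also have "\<dots> = ?a1 \<bullet> (?x \<bullet> (h \<lhd> \<theta> d))" unfolding x using d by simp
  also have "\<dots> = (?a1 \<bullet> (h \<lhd> \<theta>' d)) \<bullet> (\<xi> \<rhd> leg r d)"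
    unfolding component_theta[OF h d] using d by simp
  also have "\<dots> = (h' \<lhd> \<theta>' d) \<bullet> (((\<alpha> \<rhd> D1 X) \<bullet> \<xi>) \<rhd> leg r d)"
    unfolding t' using d by simp
  finally have cancel: "(h' \<lhd> \<theta>' d) \<bullet> ((\<xi>' \<bullet> (\<alpha> \<rhd> D0 X)) \<rhd> leg r d)
      = (h' \<lhd> \<theta>' d) \<bullet> (((\<alpha> \<rhd> D1 X) \<bullet> \<xi>) \<rhd> leg r d)" .
  have "invertible2 C (h' \<lhd> \<theta>' d)" using d by (intro invertible2_lwhisker) simp_all
  then show "(\<xi>' \<bullet> (\<alpha> \<rhd> D0 X)) \<rhd> leg r d = ((\<alpha> \<rhd> D1 X) \<bullet> \<xi>) \<rhd> leg r d"
    by (rule vcomp_left_cancel[OF _ _ _ _ _ cancel]) (use d in simp_all)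
qed

text \<open>Arrows between pairs do not depend on \<xi>, so 2-cells obtained from the bicolimit q
  can be fed directly to the universal property of the bicoequalizer.\<close>

lemma pseudocoeq_hom:
  assumes "pseudocoequalizes C X B (h, \<xi>)" "pseudocoequalizes C X B (h', \<xi>')"
  shows "chom (pseudocoeq_cat C X B) (h, \<xi>) (h', \<xi>') = hom2 C h h'"
  using pseudocoequalizing_morphism[OF assms] by (auto simp: pseudocoeq_cat_def)

lemma is_category_pseudocoeq_cat: "is_category (pseudocoeq_cat C X B)"
proof -
  have obj: "cobj (pseudocoeq_cat C X B) = {p. pseudocoequalizes C X B p}"
    by (simp add: pseudocoeq_cat_def)
  have One: "h \<in> One C" if "pseudocoequalizes C X B (h, \<xi>)" for h \<xi>
    using pseudocoequalizesD(1)[OF that] by (simp add: hom1_iff)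
  have hom: "chom (pseudocoeq_cat C X B) p p' = hom2 C (fst p) (fst p')"
    if "pseudocoequalizes C X B p" "pseudocoequalizes C X B p'" for p p'
    using that pseudocoeq_hom[of B "fst p" "snd p" "fst p'" "snd p'"] by simp
  have One': "fst p \<in> One C" if "pseudocoequalizes C X B p" for p
    using One[of "fst p" "snd p"] that by simp
  have ops: "ccomp (pseudocoeq_cat C X B) = vcomp C" "cid (pseudocoeq_cat C X B) p = id2 C (fst p)" for p
    by (simp_all add: pseudocoeq_cat_def split_beta)
  show ?thesis unfolding is_category_def obj ops
    by (auto simp: hom One' hom2_iff)
qed

lemma sigma_cat_sel:
  "cobj (sigma_cocone_cat I C F \<Sigma> B) = {w. sigma_cocone I C F \<Sigma> B w}"
  "chom (sigma_cocone_cat I C F \<Sigma> B) = chom (oplax_cocone_cat I C F B)"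
  "cid (sigma_cocone_cat I C F \<Sigma> B) = cid (oplax_cocone_cat I C F B)"
  "ccomp (sigma_cocone_cat I C F \<Sigma> B) = ccomp (oplax_cocone_cat I C F B)"
  by (simp_all add: sigma_cocone_cat_def)

lemma is_category_sigma_cocone_cat: "is_category (sigma_cocone_cat I C F \<Sigma> B)"
  unfolding sigma_cocone_cat_def
  by (rule is_category_full_subcategory[OF base.is_category_oplax_cocone_cat])
    (auto simp: sigma_cocone_def oplax_cocone_cat_def)

section \<open>The comparison functor out of a bicoequalizer\<close>

context
  fixes E c \<xi>
  assumes bicoeq: "bicoequalizer C X E (c, \<xi>)"
begin

lemma bicoeq_pseudocoequalizes: "pseudocoequalizes C X E (c, \<xi>)"
  using bicoeq by (simp add: bicoequalizer_def)

lemma bicoeq_hom: "c \<in> hom1 C (X0 X) E"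
  using pseudocoequalizesD(1)[OF bicoeq_pseudocoequalizes] .

lemma bicoeq_equivalence:
  "B \<in> Obj C \<Longrightarrow> is_equivalence (hom_cat C E B) (pseudocoeq_cat C X B)
        (\<lambda>f. (f \<cdot> c, f \<lhd> \<xi>)) (\<lambda>f g \<alpha>. \<alpha> \<rhd> c)"
  using bicoeq by (simp add: bicoequalizer_def)

lemma bicoeq_post:
  assumes "f \<in> hom1 C E B"
  shows "pseudocoequalizes C X B (f \<cdot> c, f \<lhd> \<xi>)"
proof -
  have "B \<in> Obj C" using assms by (auto simp: hom1_iff)
  from is_functorD(1)[OF equivalence_imp_functor[OF bicoeq_equivalence[OF this]], of f]
  show ?thesis using assms by (simp add: hom_cat_def pseudocoeq_cat_def)
qed

text \<open>Together with \<open>bicoeq_post_modification\<close> this exhibits the comparison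
  functor as whiskering with c followed by the comparison for q, on the nose. Its properties are
  inherited from the two factors.\<close>

lemma bicoeq_post_cocone:
  "f \<in> hom1 C E B \<Longrightarrow> post_cocone I C (post_cocone I C q c) f = post_cocone I C q (f \<cdot> c)"
  using base.post_cocone_comp[OF q_data bicoeq_hom] .

lemma bicoeq_post_modification:
  assumes "f \<in> hom1 C E B" "\<alpha> \<in> hom2 C f g"
  shows "post_modification I C (post_cocone I C q c) \<alpha> = post_modification I C q (\<alpha> \<rhd> c)"
  using assms bicoeq_hom unfolding post_modification_def
  by (auto simp: post_cocone_def hom1_iff hom2_iff intro!: restrict_ext)

lemma bicoeq_functor:
  assumes B: "B \<in> Obj C"
  shows "is_functor (hom_cat C E B) (sigma_cocone_cat I C F \<Sigma> B)
    (post_cocone I C (post_cocone I C q c)) (\<lambda>f g. post_modification I C (post_cocone I C q c))"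
proof -
  have c: "c \<in> One C" "dom1 C c = X0 X" "cod1 C c = E" using bicoeq_hom by (simp_all add: hom1_iff)
  note FQ = equivalence_imp_functor[OF base.bicolimit_equivalence[OF q_bicolimit B]]
  have h: "f \<cdot> c \<in> hom1 C (X0 X) B" if "f \<in> hom1 C E B" for f using that c by (simp add: hom1_iff)
  have h2: "\<alpha> \<rhd> c \<in> hom2 C (f \<cdot> c) (g \<cdot> c)" if "f \<in> hom1 C E B" "\<alpha> \<in> hom2 C f g" for f g \<alpha>
    using that c by (auto simp: hom1_iff hom2_iff)
  have H: "cobj (hom_cat C Y Z) = hom1 C Y Z" "chom (hom_cat C Y Z) = hom2 C"
    "cid (hom_cat C Y Z) = id2 C" "ccomp (hom_cat C Y Z) = vcomp C" for Y Z
    by (simp_all add: hom_cat_def)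
  show ?thesis unfolding is_functor_def sigma_cat_sel H
  proof (intro conjI ballI)
    fix f assume f: "f \<in> hom1 C E B"
    show "post_cocone I C (post_cocone I C q c) f \<in> {w. sigma_cocone I C F \<Sigma> B w}"
      using sigma_cocone_of_pseudocoequalizing[OF bicoeq_post[OF f]]
      unfolding bicoeq_post_cocone[OF f] by simp
    have "id2 C f \<rhd> c = id2 C (f \<cdot> c)" using f c by (simp add: hom1_iff)
    moreover have "id2 C f \<in> hom2 C f f" using f by (simp add: hom1_iff hom2_iff)
    ultimately show "post_modification I C (post_cocone I C q c) (id2 C f)
        = cid (oplax_cocone_cat I C F B) (post_cocone I C (post_cocone I C q c) f)"
      using is_functorD(3)[OF FQ, of "f \<cdot> c"] h[OF f]
      by (simp add: H bicoeq_post_cocone[OF f] bicoeq_post_modification[OF f])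
    fix g assume g: "g \<in> hom1 C E B"
    fix \<alpha> assume \<alpha>: "\<alpha> \<in> hom2 C f g"
    show "post_modification I C (post_cocone I C q c) \<alpha> \<in> chom (oplax_cocone_cat I C F B)
        (post_cocone I C (post_cocone I C q c) f) (post_cocone I C (post_cocone I C q c) g)"
      using is_functorD(2)[OF FQ, of "\<alpha> \<rhd> c" "f \<cdot> c" "g \<cdot> c"] h[OF f] h[OF g] h2[OF f \<alpha>]
      by (simp add: H bicoeq_post_cocone[OF f] bicoeq_post_cocone[OF g]
          bicoeq_post_modification[OF f \<alpha>])
  next
    fix f g k \<alpha> \<beta>
    assume o: "f \<in> hom1 C E B" "g \<in> hom1 C E B" "k \<in> hom1 C E B"
      and \<alpha>: "\<alpha> \<in> hom2 C f g" and \<beta>: "\<beta> \<in> hom2 C g k"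
    have \<beta>\<alpha>: "\<beta> \<bullet> \<alpha> \<in> hom2 C f k" using \<alpha> \<beta> by (simp add: hom2_iff)
    have "(\<beta> \<bullet> \<alpha>) \<rhd> c = (\<beta> \<rhd> c) \<bullet> (\<alpha> \<rhd> c)" using o \<alpha> \<beta> c by (simp add: hom1_iff hom2_iff)
    then show "post_modification I C (post_cocone I C q c) (\<beta> \<bullet> \<alpha>)
        = ccomp (oplax_cocone_cat I C F B) (post_modification I C (post_cocone I C q c) \<beta>)
            (post_modification I C (post_cocone I C q c) \<alpha>)"
      using is_functorD(4)[OF FQ, of "\<alpha> \<rhd> c" "f \<cdot> c" "g \<cdot> c" "\<beta> \<rhd> c" "k \<cdot> c"]
        h[OF o(1)] h[OF o(2)] h[OF o(3)] h2[OF o(1) \<alpha>] h2[OF o(2) \<beta>]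
      by (simp add: H bicoeq_post_modification[OF o(1) \<alpha>] bicoeq_post_modification[OF o(2) \<beta>]
          bicoeq_post_modification[OF o(1) \<beta>\<alpha>])
  qed
qed

lemma bicoeq_faithful:
  assumes B: "B \<in> Obj C"
  shows "faithful (hom_cat C E B) (\<lambda>f g. post_modification I C (post_cocone I C q c))"
  unfolding faithful_def
proof (intro ballI inj_onI)
  fix f g \<alpha> \<beta>
  assume "f \<in> cobj (hom_cat C E B)" "g \<in> cobj (hom_cat C E B)"
    and "\<alpha> \<in> chom (hom_cat C E B) f g" "\<beta> \<in> chom (hom_cat C E B) f g"
    and eq: "post_modification I C (post_cocone I C q c) \<alpha> = post_modification I C (post_cocone I C q c) \<beta>"
  then have f: "f \<in> hom1 C E B" and g: "g \<in> hom1 C E B"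
    and \<alpha>: "\<alpha> \<in> hom2 C f g" and \<beta>: "\<beta> \<in> hom2 C f g" by (simp_all add: hom_cat_def)
  have c: "c \<in> One C" "dom1 C c = X0 X" "cod1 C c = E" using bicoeq_hom by (simp_all add: hom1_iff)
  have eq': "post_modification I C q (\<alpha> \<rhd> c) = post_modification I C q (\<beta> \<rhd> c)"
    using eq unfolding bicoeq_post_modification[OF f \<alpha>] bicoeq_post_modification[OF f \<beta>] .
  have "\<alpha> \<rhd> c = \<beta> \<rhd> c"
  proof (rule base.bicolimit_faithful[OF q_bicolimit, of "f \<cdot> c" B _ "g \<cdot> c"])
    show "(\<alpha> \<rhd> c) \<rhd> leg q i = (\<beta> \<rhd> c) \<rhd> leg q i" if "i \<in> Obj I" for i
      using fun_cong[OF eq', of i] that by (simp add: post_modification_def)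
  qed (use f g \<alpha> \<beta> c in \<open>auto simp: hom1_iff hom2_iff\<close>)
  then show "\<alpha> = \<beta>"
    using equivalence_imp_faithful[OF is_category_hom_cat bicoeq_equivalence[OF B]] f g \<alpha> \<beta>
    unfolding faithful_def inj_on_def by (simp add: hom_cat_def)
qed

lemma bicoeq_full:
  assumes B: "B \<in> Obj C"
  shows "full (hom_cat C E B) (sigma_cocone_cat I C F \<Sigma> B)
    (post_cocone I C (post_cocone I C q c)) (\<lambda>f g. post_modification I C (post_cocone I C q c))"
  unfolding full_def
proof (intro ballI subsetI)
  fix f g m
  assume "f \<in> cobj (hom_cat C E B)" "g \<in> cobj (hom_cat C E B)"
    and "m \<in> chom (sigma_cocone_cat I C F \<Sigma> B) (post_cocone I C (post_cocone I C q c) f)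
      (post_cocone I C (post_cocone I C q c) g)"
  then have f: "f \<in> hom1 C E B" and g: "g \<in> hom1 C E B"
    and m: "modification I C F (post_cocone I C q (f \<cdot> c)) (post_cocone I C q (g \<cdot> c)) m"
    using bicoeq_post_cocone by (simp_all add: hom_cat_def sigma_cat_sel oplax_cocone_cat_def)
  have c: "f \<cdot> c \<in> hom1 C (X0 X) B" "g \<cdot> c \<in> hom1 C (X0 X) B"
    using f g bicoeq_hom by (simp_all add: hom1_iff)
  obtain \<beta> where \<beta>: "\<beta> \<in> hom2 C (f \<cdot> c) (g \<cdot> c)" and \<beta>m: "post_modification I C q \<beta> = m"
    by (rule base.bicolimit_full[OF q_bicolimit c m])
  \<comment> \<open>The 2-cell lifted along q is automatically a morphism of pairs, so it lifts once
    more, along c.\<close>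
  have "\<beta> \<in> chom (pseudocoeq_cat C X B) (f \<cdot> c, f \<lhd> \<xi>) (g \<cdot> c, g \<lhd> \<xi>)"
    using \<beta> unfolding pseudocoeq_hom[OF bicoeq_post[OF f] bicoeq_post[OF g]] .
  then obtain \<alpha> where \<alpha>: "\<alpha> \<in> hom2 C f g" and "\<alpha> \<rhd> c = \<beta>"
    using fullE[OF equivalence_imp_full[OF is_category_hom_cat is_category_pseudocoeq_cat
          bicoeq_equivalence[OF B]], of f g \<beta>] f g by (auto simp: hom_cat_def)
  then have "m = post_modification I C (post_cocone I C q c) \<alpha>"
    using \<beta>m bicoeq_post_modification[OF f \<alpha>] by simp
  then show "m \<in> post_modification I C (post_cocone I C q c) ` chom (hom_cat C E B) f g"
    using \<alpha> by (simp add: hom_cat_def)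
qed

text \<open>A \<sigma>-cocone w is isomorphic to the composite of q with some h. Invertibility of
  the transitions passes from w to h, so h carries a pair, which is isomorphic to one factoring
  through c. Composing the two isomorphisms reaches w.\<close>

lemma bicoeq_essentially_surjective:
  assumes B: "B \<in> Obj C"
  shows "essentially_surjective (hom_cat C E B) (sigma_cocone_cat I C F \<Sigma> B)
    (post_cocone I C (post_cocone I C q c))"
  unfolding essentially_surjective_def
proof
  let ?A = "oplax_cocone_cat I C F B" and ?P = "pseudocoeq_cat C X B"
  fix w assume "w \<in> cobj (sigma_cocone_cat I C F \<Sigma> B)"
  then have w: "oplax_cocone I C F B w" and inv: "\<And>d. d \<in> \<Sigma> \<Longrightarrow> invertible2 C (transition w d)"
    by (simp_all add: sigma_cat_sel sigma_cocone_def)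
  obtain h m where h: "h \<in> hom1 C (X0 X) B" and iso: "is_iso ?A (post_cocone I C q h) w m"
    by (rule base.bicolimit_mediating[OF q_bicolimit w])
  have [simp]: "h \<in> One C" "dom1 C h = X0 X" "cod1 C h = B" using h by (simp_all add: hom1_iff)
  note m = base.is_iso_modification[OF iso]
  note [simp] = base.cocone_dataD[OF base.oplax_cocone_data[OF w]]
  have ms [simp]: "m i \<in> Two C" "dom2 C (m i) = h \<cdot> leg q i" "cod2 C (m i) = leg w i"
    "invertible2 C (m i)" if "i \<in> Obj I" for i
    using base.modificationD(1-3)[OF m that] base.is_iso_inverse2(2)[OF iso that] that
    by (simp_all add: post_cocone_def)
  have "invertible2 C (h \<lhd> transition q d)" if d: "d \<in> \<Sigma>" for d
  proof -
    \<comment> \<open>Solved for h q_d, this square writes it as a composite of invertible cells: an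
      inverse of \<open>m\<close>, the transition of w, and \<open>m\<close> whiskered.\<close>
    have nat: "m (dom1 I d) \<bullet> (h \<lhd> transition q d) = transition w d \<bullet> (m (cod1 I d) \<rhd> onOne F d)"
      using base.modificationD(4)[OF m, of d] d by (simp add: post_cocone_def)
    have "h \<lhd> transition q d = (inv2 C (m (dom1 I d)) \<bullet> m (dom1 I d)) \<bullet> (h \<lhd> transition q d)"
      using d by (simp del: vcomp_assoc)
    also have "\<dots> = inv2 C (m (dom1 I d)) \<bullet> (m (dom1 I d) \<bullet> (h \<lhd> transition q d))"
      using d by (intro vcomp_assoc) simp_all
    also have "\<dots> = inv2 C (m (dom1 I d)) \<bullet> (transition w d \<bullet> (m (cod1 I d) \<rhd> onOne F d))"
      unfolding nat ..
    finally have eq: "h \<lhd> transition q d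
      = inv2 C (m (dom1 I d)) \<bullet> (transition w d \<bullet> (m (cod1 I d) \<rhd> onOne F d))" .
    show ?thesis unfolding eq
      using d inv[OF d] by (intro invertible2_vcomp invertible2_rwhisker invertible2_inv2) simp_all
  qed
  then obtain \<zeta> where p: "pseudocoequalizes C X B (h, \<zeta>)"
    by (rule pseudocoequalizing_of_invertible[OF h])
  then have "(h, \<zeta>) \<in> cobj ?P" by (simp add: pseudocoeq_cat_def)
  then obtain f \<alpha> where "f \<in> cobj (hom_cat C E B)" and \<alpha>: "is_iso ?P (f \<cdot> c, f \<lhd> \<xi>) (h, \<zeta>) \<alpha>"
    using equivalence_imp_essentially_surjective[OF bicoeq_equivalence[OF B]]
    unfolding essentially_surjective_def by blast
  then have f: "f \<in> hom1 C E B" by (simp add: hom_cat_def)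
  have fc: "f \<cdot> c \<in> hom1 C (X0 X) B" using f bicoeq_hom by (simp add: hom1_iff)
  \<comment> \<open>Morphisms of pairs in both directions are arbitrary 2-cells, so an isomorphism
    of pairs is the same as an invertible 2-cell of 1-cells.\<close>
  have \<alpha>': "is_iso (hom_cat C (X0 X) B) (f \<cdot> c) h \<alpha>"
    using \<alpha> unfolding is_iso_def pseudocoeq_hom[OF bicoeq_post[OF f] p]
      pseudocoeq_hom[OF p bicoeq_post[OF f]]
    by (simp add: hom_cat_def pseudocoeq_cat_def)
  have "is_iso ?A (post_cocone I C q (f \<cdot> c)) (post_cocone I C q h) (post_modification I C q \<alpha>)"
    using is_iso_functor[OF equivalence_imp_functor[OF base.bicolimit_equivalence[OF q_bicolimit B]] \<alpha>']
      fc h by (simp add: hom_cat_def)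
  then have "is_iso ?A (post_cocone I C q (f \<cdot> c)) w
      (ccomp ?A m (post_modification I C q \<alpha>))"
    by (rule is_iso_comp[OF base.is_category_oplax_cocone_cat _ iso])
      (use base.bicolimit_post_cocone[OF q_bicolimit] fc h w in \<open>simp_all add: oplax_cocone_cat_def\<close>)
  \<comment> \<open>The \<sigma>-cocone category has the same arrows, identities and composition as
    the oplax one, so the isomorphism is inherited.\<close>
  then have "is_iso (sigma_cocone_cat I C F \<Sigma> B) (post_cocone I C (post_cocone I C q c) f) w
      (ccomp ?A m (post_modification I C q \<alpha>))"
    unfolding is_iso_def sigma_cat_sel bicoeq_post_cocone[OF f] .
  then show "\<exists>f\<in>cobj (hom_cat C E B).
      \<exists>k. is_iso (sigma_cocone_cat I C F \<Sigma> B) (post_cocone I C (post_cocone I C q c) f) w k"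
    using f by (auto simp: hom_cat_def)
qed

lemma bicoequalizer_sigma_bicolimit: "sigma_bicolimit I C F \<Sigma> E (post_cocone I C q c)"
  unfolding sigma_bicolimit_def
  using sigma_cocone_of_pseudocoequalizing[OF bicoeq_pseudocoequalizes]
    equivalenceI[OF is_category_hom_cat is_category_sigma_cocone_cat bicoeq_functor
      bicoeq_faithful bicoeq_full bicoeq_essentially_surjective]
  by blast

end

end

text \<open>The colimiting cocone is explicit, namely q followed by the bicoequalizing 1-cell c. The
  conclusion is thus the universal property of E itself, from which the equivalence with any other
  \<sigma>-bicolimit follows.\<close>

theorem proposition1p18:
  fixes C :: "('o, 'a, 'c) two_cat"
    and I :: "('io, 'ia, 'ic) two_cat"
    and F :: "('io, 'ia, 'ic, 'o, 'a, 'c) two_fun"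
    and \<Sigma> :: "'ia set"
    and q :: "('io, 'ia, 'a, 'c) cocone"
    and X :: "('o, 'a, 'c) codescent"
    and E :: "'o" and c :: "'a" and \<xi> :: "'c"
  assumes "two_category C"
    and "infinite (UNIV :: 'u set)"
    and "has_small_oplax_bicolimits TYPE('u) C"
    and "two_category I"
    and "small_two_cat TYPE('u) I"
    and "\<Sigma> \<subseteq> One I"
    and "\<forall>i\<in>Obj I. id1 I i \<in> \<Sigma>"
    and "\<forall>d\<in>\<Sigma>. \<forall>e\<in>\<Sigma>. dom1 I e = cod1 I d \<longrightarrow> e \<cdot>\<^bsub>I\<^esub> d \<in> \<Sigma>"
    and "two_functor I C F"
    and "associated_codescent I C F \<Sigma> q X"
    and "bicoequalizer C X E (c, \<xi>)"
  shows "sigma_bicolimit I C F \<Sigma> E (post_cocone I C q c)"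
proof -
  obtain r s \<theta> \<theta>' \<kappa> \<rho>0 \<rho>1 \<rho>2 where "sigma_codescent I C F \<Sigma> q X r s \<theta> \<theta>' \<kappa> \<rho>0 \<rho>1 \<rho>2"
    using assms(10) unfolding associated_codescent_def
    by (elim conjE exE) (rule that, (unfold_locales; (insert assms(1,4,6,7,9), assumption)))
  then show ?thesis
    using assms(11) by (rule sigma_codescent.bicoequalizer_sigma_bicolimit)
qed

end
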